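(* Let $x_d\in(0,1)$, let $V\in W^{2,\infty}(0,x_d)$ be real-valued and $E>0$, put $a:=E-V$, and assume there are constants $\tau_{ev},M_{ev}$ with $0<\tau_{ev}\le -a(x)=V(x)-E\le M_{ev}$ for all $x\in(0,x_d)$. Let $a(0)<0$ be a given constant. Then there is a constant $C>0$, independent of $\varepsilon$ and of the grid, such that for every $0<\varepsilon<1$ and every grid $0=x_1<x_2<\dots<x_N=x_d$ with maximal mesh size $h$, the error $e_h:=\chi_{ex}-\chi_h$ between the exact solution $\chi_{ex}\in H^1(0,x_d)$ of the continuous variational problem and the numerical solution $\chi_h\in\mathcal{V}_h$ of the discrete variational problem (both defined in the context) satisfies $$\|e_h\|_{L^2(0,x_d)}\le C\sqrt{\varepsilon}\,h\,\min\{\varepsilon,h\},\qquad \varepsilon\,\|e_h'\|_{L^2(0,x_d)}\le C\,\varepsilon^{3/2}\,h,$$ $$\|e_h\|_{C[0,x_d]}\le C\,\sqrt{h}\,\min\{\varepsilon^{3/2},h^{3/2}\},\qquad \varepsilon\,\|e_h'\|_{L^\infty(0,x_d)}\le C\,\varepsilon\,\sqrt{h}\,\min\{\sqrt{\varepsilon},\sqrt{h}\}.$$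
   Context: The constant $a(0)<0$ is the (constant) value of the coefficient in the left lead $x\le0$. Continuous problem. Let $\mathcal{V}:=H^1(0,x_d)$ (complex-valued) with inner product $(\chi,\theta)_{\mathcal V}:=(\chi,\theta)_{L^2(0,x_d)}+\varepsilon^2(\chi',\theta')_{L^2(0,x_d)}$. Define $$b(\chi,\theta):=\varepsilon^2\int_0^{x_d}\chi'\,\overline{\theta}'\,dx-\int_0^{x_d}a\,\chi\,\overline{\theta}\,dx+\varepsilon\sqrt{|a(0)|}\,\chi(0)\overline{\theta}(0),\qquad L(\theta):=\varepsilon\,\overline{\theta}(x_d).$$ $\chi_{ex}\in\mathcal V$ is the unique solution of $b(\chi_{ex},\theta)=L(\theta)$ for all $\theta\in\mathcal V$. (This is the weak form of $\varepsilon^2\chi''+a\chi=0$ on $(0,x_d)$, $\varepsilon\chi'(0)-\sqrt{|a(0)|}\chi(0)=0$, $\varepsilon\chi'(x_d)=1$.) Discrete problem (WKB-FEM). For a grid $0=x_1<\dots<x_N=x_d$ let $h_n:=x_{n+1}-x_n$, $h:=\max_{1\le n\le N-1}h_n$. Define $$\sigma_n(x):=\frac1\varepsilon\int_{x_n}^x\sqrt{|a(y)|}\,dy,\quad \gamma_n:=\frac1\varepsilon\int_{x_n}^{x_{n+1}}\sqrt{|a(y)|}\,dy,\quad q_n(x):=\frac{(V(x_n)-E)^{1/4}}{(V(x)-E)^{1/4}},$$ $$\alpha_n(x):=-\frac{\sinh\sigma_{n+1}(x)}{\sinh\gamma_n},\quad \beta_n(x):=\frac{\sinh\sigma_n(x)}{\sinh\gamma_n},\quad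 w_n:=\alpha_n q_n,\quad v_n:=\beta_n q_{n+1}.$$ The WKB hat functions are $\zeta_n(x):=v_{n-1}(x)$ for $x\in[x_{n-1},x_n]$, $\zeta_n(x):=w_n(x)$ for $x\in[x_n,x_{n+1}]$, and $\zeta_n(x):=0$ otherwise (for $n=1$ and $n=N$ only the part inside $[0,x_d]$ is used). Let $\mathcal V_h:=\{\sum_{n=1}^N z_n\zeta_n:\ z_n\in\mathbb{C}\}\subset\mathcal V$. $\chi_h\in\mathcal V_h$ is the unique solution of $b(\chi_h,\theta_h)=L(\theta_h)$ for all $\theta_h\in\mathcal V_h$. All integrals of $\sqrt{|a|}$ are assumed to be computed exactly. *)

theory Defs
  imports "HOL-Analysis.Analysis" "HOL-Probability.Essential_Supremum"
begin

section \<open>Sobolev spaces on the interval from 0 to d\<close>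

text \<open>Functions on the interval are total functions on the reals; none of the notions below depends
  on their values outside the closed interval.\<close>

abbreviation ivl_measure :: "real \<Rightarrow> real measure" where
  "ivl_measure d \<equiv> lebesgue_on {0<..<d}"

definition test_functions :: "real \<Rightarrow> (real \<Rightarrow> real) set" where
  "test_functions d = {\<phi>. (\<forall>k. (deriv ^^ k) \<phi> differentiable_on UNIV) \<and>
     (\<exists>K. compact K \<and> K \<subseteq> {0<..<d} \<and> (\<forall>t. t \<notin> K \<longrightarrow> \<phi> t = 0))}"

definition locally_L1 :: "real \<Rightarrow> (real \<Rightarrow> 'a::euclidean_space) set" where
  "locally_L1 d = {u. \<forall>K. compact K \<and> K \<subseteq> {0<..<d} \<longrightarrow> integrable (lebesgue_on K) u}"

definition has_weak_deriv :: "real \<Rightarrow> (real \<Rightarrow> 'a::euclidean_space) \<Rightarrow> (real \<Rightarrow> 'a) \<Rightarrow> bool" where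
  "has_weak_deriv d u g \<longleftrightarrow> u \<in> locally_L1 d \<and> g \<in> locally_L1 d \<and>
     (\<forall>\<phi> \<in> test_functions d.
        (\<integral>t. deriv \<phi> t *\<^sub>R u t \<partial>ivl_measure d) = - (\<integral>t. \<phi> t *\<^sub>R g t \<partial>ivl_measure d))"

text \<open>The weak derivative is determined only almost everywhere, so \<open>weak_deriv d u\<close> is an arbitrary
  representative. All integrals and essential suprema below are independent of that choice.\<close>

definition weak_deriv :: "real \<Rightarrow> (real \<Rightarrow> 'a::euclidean_space) \<Rightarrow> (real \<Rightarrow> 'a)" where
  "weak_deriv d u = (SOME g. has_weak_deriv d u g)"

definition L2 :: "real \<Rightarrow> (real \<Rightarrow> 'a::euclidean_space) set" where
  "L2 d = {u. u \<in> borel_measurable (ivl_measure d) \<and> integrable (ivl_measure d) (\<lambda>t. (norm (u t))\<^sup>2)}"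

definition L2_norm :: "real \<Rightarrow> (real \<Rightarrow> 'a::euclidean_space) \<Rightarrow> real" where
  "L2_norm d u = sqrt (\<integral>t. (norm (u t))\<^sup>2 \<partial>ivl_measure d)"

definition Linf_norm :: "real \<Rightarrow> (real \<Rightarrow> 'a::euclidean_space) \<Rightarrow> ereal" where
  "Linf_norm d u = esssup (ivl_measure d) (\<lambda>t. ereal (norm (u t)))"

definition Linf :: "real \<Rightarrow> (real \<Rightarrow> 'a::euclidean_space) set" where
  "Linf d = {u. u \<in> borel_measurable (ivl_measure d) \<and> Linf_norm d u < \<infinity>}"

definition C_norm :: "real \<Rightarrow> (real \<Rightarrow> 'a::euclidean_space) \<Rightarrow> real" where
  "C_norm d u = (SUP t\<in>{0..d}. norm (u t))"

text \<open>As point values are needed, elements of \<open>H\<^sup>1\<close> and \<open>W\<^sup>2\<^sup>,\<^sup>\<infinity>\<close> are represented by their unique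
  representative that is continuous on the closed interval.\<close>

definition H1 :: "real \<Rightarrow> (real \<Rightarrow> complex) set" where
  "H1 d = {u. continuous_on {0..d} u \<and> u \<in> L2 d \<and> (\<exists>g \<in> L2 d. has_weak_deriv d u g)}"

definition W2inf :: "real \<Rightarrow> (real \<Rightarrow> real) set" where
  "W2inf d = {u. continuous_on {0..d} u \<and> u \<in> Linf d \<and>
     (\<exists>g \<in> Linf d. has_weak_deriv d u g \<and> (\<exists>k \<in> Linf d. has_weak_deriv d g k))}"


section \<open>The continuous variational problem\<close>

definition coef :: "real \<Rightarrow> (real \<Rightarrow> real) \<Rightarrow> real \<Rightarrow> real" where
  "coef E V t = E - V t"

text \<open>\<open>a0\<close> is the constant coefficient in the left lead, usually written \<open>a(0)\<close>. It is a parameter of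
  its own and need not be the limit of \<open>coef E V\<close> at 0 from the right.\<close>

definition b_form ::
  "real \<Rightarrow> real \<Rightarrow> (real \<Rightarrow> real) \<Rightarrow> real \<Rightarrow> real \<Rightarrow> (real \<Rightarrow> complex) \<Rightarrow> (real \<Rightarrow> complex) \<Rightarrow> complex" where
  "b_form d E V a0 \<epsilon> u \<theta> =
     of_real (\<epsilon>\<^sup>2) * (\<integral>t. weak_deriv d u t * cnj (weak_deriv d \<theta> t) \<partial>ivl_measure d)
     - (\<integral>t. of_real (coef E V t) * u t * cnj (\<theta> t) \<partial>ivl_measure d)
     + of_real (\<epsilon> * sqrt \<bar>a0\<bar>) * u 0 * cnj (\<theta> 0)"

definition L_form :: "real \<Rightarrow> real \<Rightarrow> (real \<Rightarrow> complex) \<Rightarrow> complex" where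
  "L_form d \<epsilon> \<theta> = of_real \<epsilon> * cnj (\<theta> d)"

definition is_exact_solution ::
  "real \<Rightarrow> real \<Rightarrow> (real \<Rightarrow> real) \<Rightarrow> real \<Rightarrow> real \<Rightarrow> (real \<Rightarrow> complex) \<Rightarrow> bool" where
  "is_exact_solution d E V a0 \<epsilon> u \<longleftrightarrow>
     u \<in> H1 d \<and> (\<forall>\<theta> \<in> H1 d. b_form d E V a0 \<epsilon> u \<theta> = L_form d \<epsilon> \<theta>)"


section \<open>The WKB finite element method\<close>

text \<open>The grid points are \<open>x 1, \<dots>, x N\<close>; \<open>N \<ge> 2\<close> is forced by \<open>0 < d\<close>. The value \<open>x 0\<close> is not used.\<close>

definition is_grid :: "real \<Rightarrow> nat \<Rightarrow> (nat \<Rightarrow> real) \<Rightarrow> bool" where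
  "is_grid d N x \<longleftrightarrow> 2 \<le> N \<and> x 1 = 0 \<and> x N = d \<and> (\<forall>n\<in>{1..<N}. x n < x (n + 1))"

definition mesh_size :: "nat \<Rightarrow> (nat \<Rightarrow> real) \<Rightarrow> real" where
  "mesh_size N x = (MAX n\<in>{1..<N}. x (n + 1) - x n)"

definition wkb_sigma :: "real \<Rightarrow> (real \<Rightarrow> real) \<Rightarrow> real \<Rightarrow> (nat \<Rightarrow> real) \<Rightarrow> nat \<Rightarrow> real \<Rightarrow> real" where
  "wkb_sigma E V \<epsilon> x n t = 1 / \<epsilon> * (LBINT y=x n..t. sqrt \<bar>coef E V y\<bar>)"

definition wkb_gamma :: "real \<Rightarrow> (real \<Rightarrow> real) \<Rightarrow> real \<Rightarrow> (nat \<Rightarrow> real) \<Rightarrow> nat \<Rightarrow> real" where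
  "wkb_gamma E V \<epsilon> x n = 1 / \<epsilon> * (LBINT y=x n..x (n + 1). sqrt \<bar>coef E V y\<bar>)"

definition wkb_q :: "real \<Rightarrow> (real \<Rightarrow> real) \<Rightarrow> (nat \<Rightarrow> real) \<Rightarrow> nat \<Rightarrow> real \<Rightarrow> real" where
  "wkb_q E V x n t = (V (x n) - E) powr (1/4) / (V t - E) powr (1/4)"

definition wkb_alpha :: "real \<Rightarrow> (real \<Rightarrow> real) \<Rightarrow> real \<Rightarrow> (nat \<Rightarrow> real) \<Rightarrow> nat \<Rightarrow> real \<Rightarrow> real" where
  "wkb_alpha E V \<epsilon> x n t = - sinh (wkb_sigma E V \<epsilon> x (n + 1) t) / sinh (wkb_gamma E V \<epsilon> x n)"

definition wkb_beta :: "real \<Rightarrow> (real \<Rightarrow> real) \<Rightarrow> real \<Rightarrow> (nat \<Rightarrow> real) \<Rightarrow> nat \<Rightarrow> real \<Rightarrow> real" where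
  "wkb_beta E V \<epsilon> x n t = sinh (wkb_sigma E V \<epsilon> x n t) / sinh (wkb_gamma E V \<epsilon> x n)"

definition wkb_w :: "real \<Rightarrow> (real \<Rightarrow> real) \<Rightarrow> real \<Rightarrow> (nat \<Rightarrow> real) \<Rightarrow> nat \<Rightarrow> real \<Rightarrow> real" where
  "wkb_w E V \<epsilon> x n t = wkb_alpha E V \<epsilon> x n t * wkb_q E V x n t"

definition wkb_v :: "real \<Rightarrow> (real \<Rightarrow> real) \<Rightarrow> real \<Rightarrow> (nat \<Rightarrow> real) \<Rightarrow> nat \<Rightarrow> real \<Rightarrow> real" where
  "wkb_v E V \<epsilon> x n t = wkb_beta E V \<epsilon> x n t * wkb_q E V x (n + 1) t"

definition wkb_hat ::
  "real \<Rightarrow> (real \<Rightarrow> real) \<Rightarrow> real \<Rightarrow> nat \<Rightarrow> (nat \<Rightarrow> real) \<Rightarrow> nat \<Rightarrow> real \<Rightarrow> real" where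
  "wkb_hat E V \<epsilon> N x n t =
     (if 1 < n \<and> t \<in> {x (n - 1)..x n} then wkb_v E V \<epsilon> x (n - 1) t
      else if n < N \<and> t \<in> {x n..x (n + 1)} then wkb_w E V \<epsilon> x n t
      else 0)"

definition wkb_space ::
  "real \<Rightarrow> (real \<Rightarrow> real) \<Rightarrow> real \<Rightarrow> nat \<Rightarrow> (nat \<Rightarrow> real) \<Rightarrow> (real \<Rightarrow> complex) set" where
  "wkb_space E V \<epsilon> N x =
     range (\<lambda>z :: nat \<Rightarrow> complex. \<lambda>t. \<Sum>n=1..N. z n * of_real (wkb_hat E V \<epsilon> N x n t))"

definition is_wkb_fem_solution ::
  "real \<Rightarrow> real \<Rightarrow> (real \<Rightarrow> real) \<Rightarrow> real \<Rightarrow> real \<Rightarrow> nat \<Rightarrow> (nat \<Rightarrow> real) \<Rightarrow> (real \<Rightarrow> complex) \<Rightarrow> bool" where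
  "is_wkb_fem_solution d E V a0 \<epsilon> N x u \<longleftrightarrow>
     u \<in> wkb_space E V \<epsilon> N x \<and>
     (\<forall>\<theta> \<in> wkb_space E V \<epsilon> N x. b_form d E V a0 \<epsilon> u \<theta> = L_form d \<epsilon> \<theta>)"

end

theory Submission
  imports Defs "HOL-Computational_Algebra.Polynomial"
begin

text \<open>The WKB functions \<open>q * exp (S / \<epsilon>)\<close> and \<open>q * exp (- S / \<epsilon>)\<close>, with
\<open>q = (V - E) powr (- 1 / 4)\<close> and \<open>S' = 1 / q\<^sup>2\<close>, span the finite element space on each cell. Write
\<open>p = V - E = 1 / q ^ 4\<close>. The exact solution \<open>u\<close> satisfies \<open>\<epsilon>\<^sup>2 * u'' = p * u\<close>, and the WKB
functions satisfy \<open>\<epsilon>\<^sup>2 * \<theta>'' = (p + \<epsilon>\<^sup>2 * r) * \<theta>\<close> with the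
bounded defect \<open>r = q'' / q\<close> (\<open>wkb_sol_sinh\<close>). Everything follows from the factor
\<open>\<epsilon>\<^sup>2\<close> in front of \<open>r\<close>.

The error is split into the interpolation error \<open>\<eta>\<close> and the discrete function \<open>\<delta>\<close> that is
the difference between the interpolant and the Galerkin solution. On a cell, the pair
\<open>y = \<eta> / q\<close>, \<open>Y = \<epsilon> * (q * \<eta>' - q' * \<eta>)\<close> satisfies a first-order system with a
definite energy, homogeneous boundary values for \<open>y\<close> and the forcing term \<open>\<epsilon> * q'' * u\<close>. The
energy identity and the Poincare inequality bound \<open>\<eta>\<close> in \<open>L^2\<close> by the square of the minimum of
\<open>\<epsilon>\<close> and the cell length, times the norm of \<open>u\<close> on the cell; increments of \<open>y\<^sup>2\<close> and
\<open>Y\<^sup>2\<close> give the bounds at points (\<open>cell_transformed_estimates\<close>). The remaining powers of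
\<open>\<epsilon>\<close> and \<open>h\<close> come from \<open>u\<close>: its square has integral of order \<open>\<epsilon>\<close>, and it is bounded, so
that on a cell the integral is also at most of order \<open>h\<close> (\<open>exact_solution_bounds\<close>).

As \<open>\<eta>\<close> vanishes at the nodes, integration by parts on the cells shows that the bilinear form of
\<open>\<eta>\<close> with a discrete function is \<open>- \<epsilon>\<^sup>2\<close> times the integral of \<open>r * \<eta>\<close> against this
function (\<open>nodal_zero_consistency\<close>). By Galerkin orthogonality \<open>\<delta>\<close> solves the discrete problem
with this small load, so its energy is at most of order \<open>\<epsilon> ^ 4\<close> times the integral of
\<open>\<eta>\<^sup>2\<close> (\<open>error_equation\<close>, \<open>discrete_energy\<close>). The only norm that the energy does not control is the supremum
of the derivative of \<open>\<delta>\<close>, because cells may be arbitrarily short; a step-like discrete test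
function isolates its value at a node (\<open>discrete_derivative_sup\<close>).

These arguments use classical derivatives and integration by parts for functions whose second derivative
exists only almost everywhere. They are supplied by a calculus of absolutely continuous functions with
a product rule (\<open>ac_mult\<close>) and by the lemma of du Bois-Reymond (\<open>weak_constant\<close>), which identifies
functions with an integrable weak derivative with absolutely continuous ones. In particular the exact
solution is classical (\<open>weak_solution_classical\<close>), and \<open>V\<close> has a Lipschitz derivative (\<open>W2inf_regular\<close>).
Complex solutions are treated through their real and imaginary parts, which solve the same real problem
with loads 1 and 0.\<close>

section \<open>Smooth bump functions\<close>

text \<open>The derivative of such a function has the same form again, with another polynomial and a larger
exponent. This closure is what makes all of them smooth; the parameter \<open>c\<close> is there because the
functions with \<open>P = 1\<close> and \<open>k = 0\<close> tend to the indicator of the interval as \<open>c\<close> tends to 0.\<close>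

definition bump :: "real \<Rightarrow> real \<Rightarrow> real \<Rightarrow> real poly \<Rightarrow> nat \<Rightarrow> real \<Rightarrow> real" where
  "bump \<alpha> \<beta> c P k t =
     (if \<alpha> < t \<and> t < \<beta> then poly P t * exp (- c / ((t - \<alpha>) * (\<beta> - t))) / ((t - \<alpha>) * (\<beta> - t)) ^ k else 0)"

lemma power_le_fact_exp:
  fixes x :: real
  assumes "0 \<le> x"
  shows "x ^ n \<le> fact n * exp x"
proof -
  have s: "(\<lambda>n. x ^ n /\<^sub>R fact n) sums exp x" by (rule exp_converges)
  have "(\<Sum>i\<in>{n}. x ^ i /\<^sub>R fact i) \<le> (\<Sum>i. x ^ i /\<^sub>R fact i)"
    by (rule sum_le_suminf) (use s assms in \<open>auto simp: sums_iff\<close>)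
  then show ?thesis
    using s by (simp add: sums_iff field_simps)
qed

text \<open>The exponential decays faster than any power of \<open>(t - \<alpha>) * (\<beta> - t)\<close>, so it beats
the negative power and leaves a square, which vanishes to second order at both end points.\<close>

lemma bump_quadratic_decay:
  assumes c: "0 < c" and ab: "\<alpha> < \<beta>"
  obtains C where "\<And>t s. s \<le> \<alpha> \<or> \<beta> \<le> s \<Longrightarrow> \<bar>bump \<alpha> \<beta> c P k t\<bar> \<le> C * (t - s)\<^sup>2"
proof -
  have "compact (poly P ` {\<alpha>..\<beta>})"
    by (intro compact_continuous_image continuous_intros compact_Icc)
  then obtain B where B: "\<And>t. t \<in> {\<alpha>..\<beta>} \<Longrightarrow> \<bar>poly P t\<bar> \<le> B"
    using compact_imp_bounded bounded_iff by (metis imageI real_norm_def)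
  have "0 \<le> B" using B[of \<alpha>] ab by (meson abs_ge_zero atLeastAtMost_iff less_imp_le order_refl order_trans)
  define C where "C = B * (fact (k + 2) / c ^ (k + 2)) * (\<beta> - \<alpha>)\<^sup>2"
  have C0: "0 \<le> C" unfolding C_def using \<open>0 \<le> B\<close> c by simp
  show ?thesis
  proof
    fix t s assume s: "s \<le> \<alpha> \<or> \<beta> \<le> s"
    show "\<bar>bump \<alpha> \<beta> c P k t\<bar> \<le> C * (t - s)\<^sup>2"
    proof (cases "\<alpha> < t \<and> t < \<beta>")
      case False
      then show ?thesis using C0 by (auto simp: bump_def)
    next
      case True
      define w where "w = (t - \<alpha>) * (\<beta> - t)"
      have w: "0 < w" using True by (simp add: w_def)
      have "(c / w) ^ (k + 2) \<le> fact (k + 2) * exp (c / w)"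
        using power_le_fact_exp[of "c / w" "k + 2"] c w by (simp del: fact_Suc power_Suc)
      then have e: "exp (- c / w) \<le> fact (k + 2) / c ^ (k + 2) * w ^ (k + 2)"
        using c w by (simp add: exp_minus field_simps)
      have "exp (- c / w) / w ^ k \<le> fact (k + 2) / c ^ (k + 2) * w\<^sup>2"
        using e w by (simp add: divide_le_eq power_add power2_eq_square mult_ac)
      then have "\<bar>poly P t\<bar> * (exp (- c / w) / w ^ k) \<le> B * (fact (k + 2) / c ^ (k + 2) * w\<^sup>2)"
        using B True w \<open>0 \<le> B\<close> by (intro mult_mono) auto
      moreover have "w \<le> (\<beta> - \<alpha>) * \<bar>t - s\<bar>"
      proof (cases "s \<le> \<alpha>")
        case True
        then show ?thesis
          using \<open>\<alpha> < t \<and> t < \<beta>\<close> unfolding w_def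
          by (subst mult.commute) (intro mult_mono, auto)
      next
        case False
        then show ?thesis
          using \<open>\<alpha> < t \<and> t < \<beta>\<close> s unfolding w_def by (intro mult_mono) auto
      qed
      then have "w\<^sup>2 \<le> (\<beta> - \<alpha>)\<^sup>2 * (t - s)\<^sup>2"
        using w by (metis less_imp_le power2_abs power_mono power_mult_distrib)
      then have "B * (fact (k + 2) / c ^ (k + 2) * w\<^sup>2)
          \<le> B * (fact (k + 2) / c ^ (k + 2) * ((\<beta> - \<alpha>)\<^sup>2 * (t - s)\<^sup>2))"
        using \<open>0 \<le> B\<close> c by (intro mult_left_mono) auto
      moreover have "\<bar>bump \<alpha> \<beta> c P k t\<bar> = \<bar>poly P t\<bar> * (exp (- c / w) / w ^ k)"
        using True w by (simp add: bump_def abs_mult w_def)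
      ultimately show ?thesis
        by (simp add: C_def mult_ac)
    qed
  qed
qed

lemma has_derivative_zero_if_quadratic:
  fixes f :: "real \<Rightarrow> real"
  assumes "\<And>t. \<bar>f t\<bar> \<le> C * (t - s)\<^sup>2"
  shows "(f has_real_derivative 0) (at s)"
proof -
  have fs: "f s = 0" using assms[of s] by simp
  have "((\<lambda>h. f (s + h) / h) \<longlongrightarrow> 0) (at 0)"
  proof (rule Lim_null_comparison)
    show "\<forall>\<^sub>F h in at 0. norm (f (s + h) / h) \<le> C * \<bar>h\<bar>"
      unfolding eventually_at
    proof (intro exI[of _ 1] conjI ballI impI)
      fix h :: real assume "h \<noteq> 0 \<and> dist h 0 < 1"
      then show "norm (f (s + h) / h) \<le> C * \<bar>h\<bar>"
        using divide_right_mono[OF assms[of "s + h"], of "\<bar>h\<bar>"]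
        by (cases "0 < h") (simp_all add: power2_eq_square abs_divide)
    qed simp
    have "((\<lambda>h. C * \<bar>h\<bar>) \<longlongrightarrow> C * \<bar>0\<bar>) (at (0::real))" by (intro tendsto_intros)
    then show "((\<lambda>h. C * \<bar>h\<bar>) \<longlongrightarrow> 0) (at (0::real))" by simp
  qed
  then show ?thesis by (simp add: DERIV_def fs)
qed

text \<open>The numerator that the quotient and chain rules produce over the common denominator \<open>W ^ (k + 2)\<close>,
where \<open>W\<close> is the polynomial \<open>(t - \<alpha>) * (\<beta> - t)\<close>.\<close>

definition bump_dpoly :: "real \<Rightarrow> real \<Rightarrow> real \<Rightarrow> real poly \<Rightarrow> nat \<Rightarrow> real poly" where
  "bump_dpoly \<alpha> \<beta> c P k =
     (let W = [:- \<alpha>, 1:] * [:\<beta>, - 1:] in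
      pderiv P * W ^ 2 - smult (real k) (P * pderiv W * W) + smult c (P * pderiv W))"

text \<open>Inside the interval this is a computation. Every other point is covered by the quadratic decay,
which forces derivative 0; this treats the end points and the exterior alike.\<close>

lemma bump_has_derivative:
  assumes c: "0 < c" and ab: "\<alpha> < \<beta>"
  shows "(bump \<alpha> \<beta> c P k has_real_derivative bump \<alpha> \<beta> c (bump_dpoly \<alpha> \<beta> c P k) (k + 2) t) (at t)"
proof (cases "\<alpha> < t \<and> t < \<beta>")
  case False
  obtain C where C: "\<And>t s. s \<le> \<alpha> \<or> \<beta> \<le> s \<Longrightarrow> \<bar>bump \<alpha> \<beta> c P k t\<bar> \<le> C * (t - s)\<^sup>2"
    using bump_quadratic_decay[OF c ab] by blast
  have "bump \<alpha> \<beta> c (bump_dpoly \<alpha> \<beta> c P k) (k + 2) t = 0"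
    using False by (auto simp: bump_def)
  then show ?thesis
    using has_derivative_zero_if_quadratic[of "bump \<alpha> \<beta> c P k" C t] C False by auto
next
  case True
  define W where "W = [:- \<alpha>, 1:] * [:\<beta>, - 1:]"
  define w where "w = poly W t"
  define w1 where "w1 = poly (pderiv W) t"
  have W: "poly W x = (x - \<alpha>) * (\<beta> - x)" for x by (simp add: W_def algebra_simps)
  have w: "0 < w" using True by (simp add: w_def W)
  have D: "((\<lambda>x. poly P x * exp (- c / poly W x) / poly W x ^ k) has_real_derivative
      ((poly P t * (exp (- c / w) * (c * w1 / w\<^sup>2)) + poly (pderiv P) t * exp (- c / w)) * w ^ k
        - poly P t * exp (- c / w) * (real k * w ^ (k - 1) * w1)) / (w ^ k * w ^ k)) (at t)"
  proof -
    have Wd: "(poly W has_real_derivative w1) (at t)"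
      unfolding w1_def by (rule poly_DERIV)
    have "((\<lambda>x. - c / poly W x) has_real_derivative - ((- c) * w1 / w\<^sup>2)) (at t)"
      using DERIV_divide[OF DERIV_const[of "- c"] Wd] w
      by (simp add: w_def power2_eq_square)
    then have E: "((\<lambda>x. exp (- c / poly W x)) has_real_derivative exp (- c / w) * (c * w1 / w\<^sup>2)) (at t)"
      using DERIV_fun_exp by (fastforce simp: w_def)
    have N: "((\<lambda>x. poly P x * exp (- c / poly W x)) has_real_derivative
        poly P t * (exp (- c / w) * (c * w1 / w\<^sup>2)) + poly (pderiv P) t * exp (- c / w)) (at t)"
      using DERIV_mult[OF poly_DERIV E] by (simp add: w_def algebra_simps)
    show ?thesis
      using DERIV_divide[OF N DERIV_power[OF Wd, of k]] w by (simp add: w_def mult_ac)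
  qed
  have pk: "real k * w ^ (k - 1) = real k * w ^ k / w"
    using w by (cases k) auto
  have "((poly P t * (exp (- c / w) * (c * w1 / w\<^sup>2)) + poly (pderiv P) t * exp (- c / w)) * w ^ k
        - poly P t * exp (- c / w) * (real k * w ^ (k - 1) * w1)) / (w ^ k * w ^ k)
      = (poly (pderiv P) t * w\<^sup>2 - real k * (poly P t * w1 * w) + c * (poly P t * w1))
         * exp (- c / w) / w ^ (k + 2)"
    unfolding pk using w by (simp add: field_simps power2_eq_square power_add)
  also have "\<dots> = bump \<alpha> \<beta> c (bump_dpoly \<alpha> \<beta> c P k) (k + 2) t"
    using True unfolding bump_def bump_dpoly_def Let_def W_def[symmetric]
    by (simp add: w_def w1_def W)
  finally have D': "((\<lambda>x. poly P x * exp (- c / poly W x) / poly W x ^ k) has_real_derivative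
      bump \<alpha> \<beta> c (bump_dpoly \<alpha> \<beta> c P k) (k + 2) t) (at t)"
    using D by simp
  show ?thesis
    by (rule has_field_derivative_transform_within_open[OF D', of "{\<alpha><..<\<beta>}"])
       (use True in \<open>auto simp: bump_def W\<close>)
qed

lemma bump_higher_deriv:
  assumes "0 < c" "\<alpha> < \<beta>"
  shows "\<exists>Q l. (deriv ^^ k) (bump \<alpha> \<beta> c P j) = bump \<alpha> \<beta> c Q l"
proof (induction k)
  case 0
  show ?case by auto
next
  case (Suc k)
  then obtain Q l where "(deriv ^^ k) (bump \<alpha> \<beta> c P j) = bump \<alpha> \<beta> c Q l" by blast
  moreover have "deriv (bump \<alpha> \<beta> c Q l) = bump \<alpha> \<beta> c (bump_dpoly \<alpha> \<beta> c Q l) (l + 2)"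
    using bump_has_derivative[OF assms] by (intro ext DERIV_imp_deriv)
  ultimately show ?case by auto
qed

lemma bump_test_function:
  assumes "0 < c" "0 < \<alpha>" "\<alpha> < \<beta>" "\<beta> < d"
  shows "bump \<alpha> \<beta> c P k \<in> test_functions d"
  unfolding test_functions_def
proof (intro CollectI conjI allI)
  fix j
  obtain Q l where "(deriv ^^ j) (bump \<alpha> \<beta> c P k) = bump \<alpha> \<beta> c Q l"
    using bump_higher_deriv assms by blast
  then show "(deriv ^^ j) (bump \<alpha> \<beta> c P k) differentiable_on UNIV"
    using bump_has_derivative[OF assms(1,3)]
    by (auto simp: differentiable_on_def intro!: differentiableI has_field_derivative_imp_has_derivative
        intro: has_field_derivative_at_within)
next
  show "\<exists>K. compact K \<and> K \<subseteq> {0<..<d} \<and> (\<forall>t. t \<notin> K \<longrightarrow> bump \<alpha> \<beta> c P k t = 0)"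
    using assms by (intro exI[of _ "{\<alpha>..\<beta>}"]) (auto simp: bump_def)
qed

section \<open>The fundamental lemma of the calculus of variations\<close>

subsection \<open>Integrals over the open and the closed interval\<close>

lemmas HK_integral_add = Henstock_Kurzweil_Integration.integral_add
  and HK_integral_diff = Henstock_Kurzweil_Integration.integral_diff
  and HK_integral_neg = Henstock_Kurzweil_Integration.integral_neg
  and HK_integral_cong = Henstock_Kurzweil_Integration.integral_cong
  and HK_integral_combine = Henstock_Kurzweil_Integration.integral_combine

lemma integrable_lebesgue_on_iff:
  "S \<in> sets lebesgue \<Longrightarrow> integrable (lebesgue_on S) f \<longleftrightarrow> f absolutely_integrable_on S"
  by (simp add: integrable_restrict_space set_integrable_def)

lemma integrable_ivl_iff:
  fixes f :: "real \<Rightarrow> 'a::euclidean_space"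
  shows "integrable (ivl_measure d) f \<longleftrightarrow> f absolutely_integrable_on {0..d}"
  by (simp add: integrable_lebesgue_on_iff absolutely_integrable_on_Icc_iff_Ioo)

lemma integral_ivl:
  fixes f :: "real \<Rightarrow> 'a::euclidean_space"
  assumes "f absolutely_integrable_on {0..d}"
  shows "(\<integral>t. f t \<partial>ivl_measure d) = integral {0..d} f"
  using assms
  by (simp add: lebesgue_integral_eq_integral integrable_ivl_iff integral_open_interval_real)

lemma AE_ivl_iff: "(AE t in ivl_measure d. P t) \<longleftrightarrow> (AE t in lebesgue. 0 < t \<and> t < d \<longrightarrow> P t)"
  by (subst AE_restrict_space_iff) auto

subsection \<open>Test functions\<close>

lemma test_function_has_derivative:
  assumes "\<phi> \<in> test_functions d"
  shows "(\<phi> has_real_derivative deriv \<phi> t) (at t)"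
proof -
  have "((deriv ^^ 0) \<phi>) differentiable_on UNIV"
    using assms unfolding test_functions_def by blast
  then show ?thesis
    by (simp add: differentiable_on_def DERIV_deriv_iff_real_differentiable)
qed

lemma test_function_deriv_continuous:
  assumes "\<phi> \<in> test_functions d"
  shows "continuous_on S (deriv \<phi>)"
proof -
  have "((deriv ^^ 1) \<phi>) differentiable_on UNIV"
    using assms unfolding test_functions_def by blast
  then show ?thesis
    by (metis One_nat_def comp_id continuous_on_subset differentiable_imp_continuous_on funpow.simps subset_UNIV)
qed

lemma test_function_support:
  assumes "\<phi> \<in> test_functions d" "0 < d"
  obtains \<alpha> \<beta> where "0 < \<alpha>" "\<alpha> < \<beta>" "\<beta> < d" "\<And>t. t \<notin> {\<alpha>..\<beta>} \<Longrightarrow> \<phi> t = 0 \<and> deriv \<phi> t = 0"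
proof -
  obtain K where K: "compact K" "K \<subseteq> {0<..<d}" "\<And>t. t \<notin> K \<Longrightarrow> \<phi> t = 0"
    using assms unfolding test_functions_def by blast
  define L where "L = insert (d/2) K"
  have L: "compact L" "L \<subseteq> {0<..<d}" "L \<noteq> {}" using K assms by (auto simp: L_def)
  obtain p where p: "p \<in> L" "\<And>t. t \<in> L \<Longrightarrow> p \<le> t" using compact_attains_inf[OF L(1,3)] by blast
  obtain q where q: "q \<in> L" "\<And>t. t \<in> L \<Longrightarrow> t \<le> q" using compact_attains_sup[OF L(1,3)] by blast
  have pq: "0 < p" "p \<le> q" "q < d" using p q L by (auto dest: subsetD)
  have z: "\<phi> t = 0" if "t < p \<or> q < t" for t
    using that p q K(3)[of t] by (fastforce simp: L_def)
  show ?thesis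
  proof (rule that[of "p / 2" "(q + d) / 2"])
    fix t assume t: "t \<notin> {p/2..(q + d)/2}"
    have "t < p \<or> q < t" using t pq by auto
    moreover have "(\<phi> has_real_derivative 0) (at t)"
      by (rule has_field_derivative_transform_within_open[OF DERIV_const, of "- {p..q}" t 0])
         (use \<open>t < p \<or> q < t\<close> z in auto)
    ultimately show "\<phi> t = 0 \<and> deriv \<phi> t = 0" using z DERIV_imp_deriv by blast
  qed (use pq in auto)
qed

lemma locally_L1_Icc:
  assumes "u \<in> locally_L1 d" "0 < \<alpha>" "\<beta> < d"
  shows "u absolutely_integrable_on {\<alpha>..\<beta>}"
proof -
  have "compact {\<alpha>..\<beta>}" "{\<alpha>..\<beta>} \<subseteq> {0<..<d}" using assms by auto
  then have "integrable (lebesgue_on {\<alpha>..\<beta>}) u"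
    using assms unfolding locally_L1_def by blast
  then show ?thesis by (simp add: integrable_lebesgue_on_iff)
qed

lemma supported_product_integrable:
  fixes u :: "real \<Rightarrow> real"
  assumes "u \<in> locally_L1 d" "0 < \<alpha>" "\<beta> < d" "continuous_on {\<alpha>..\<beta>} f" "\<And>t. t \<notin> {\<alpha>..\<beta>} \<Longrightarrow> f t = 0"
  shows "(\<lambda>t. f t * u t) absolutely_integrable_on {0..d}"
proof -
  have "u absolutely_integrable_on {\<alpha>..\<beta>}"
    using assms(1-3) by (rule locally_L1_Icc)
  moreover have "f \<in> borel_measurable (lebesgue_on {\<alpha>..\<beta>})"
    using assms(4) by (intro continuous_imp_measurable_on_sets_lebesgue) auto
  moreover have "bounded (f ` {\<alpha>..\<beta>})"
    using assms(4) compact_continuous_image compact_imp_bounded by blast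
  ultimately have "(\<lambda>t. f t * u t) absolutely_integrable_on {\<alpha>..\<beta>}"
    by (intro absolutely_integrable_bounded_measurable_product_real) auto
  moreover have "(\<lambda>t. indicator {0..d} t *\<^sub>R (f t * u t)) = (\<lambda>t. indicator {\<alpha>..\<beta>} t *\<^sub>R (f t * u t))"
    using assms(2,3,5) by (auto simp: indicator_def fun_eq_iff)
  ultimately show ?thesis by (simp only: set_integrable_def)
qed

lemma test_product_integrable:
  fixes u :: "real \<Rightarrow> real"
  assumes "\<phi> \<in> test_functions d" "u \<in> locally_L1 d" "0 < d"
  shows "(\<lambda>t. \<phi> t * u t) absolutely_integrable_on {0..d}"
    and "(\<lambda>t. deriv \<phi> t * u t) absolutely_integrable_on {0..d}"
proof -
  obtain \<alpha> \<beta> where ab: "0 < \<alpha>" "\<alpha> < \<beta>" "\<beta> < d" "\<And>t. t \<notin> {\<alpha>..\<beta>} \<Longrightarrow> \<phi> t = 0 \<and> deriv \<phi> t = 0"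
    using test_function_support assms by blast
  have "continuous_on {\<alpha>..\<beta>} \<phi>"
    using test_function_has_derivative[OF assms(1)] by (meson DERIV_continuous_on has_field_derivative_at_within)
  then show "(\<lambda>t. \<phi> t * u t) absolutely_integrable_on {0..d}"
    using ab assms(2) by (intro supported_product_integrable) auto
  show "(\<lambda>t. deriv \<phi> t * u t) absolutely_integrable_on {0..d}"
    using ab assms(2) test_function_deriv_continuous[OF assms(1)]
    by (intro supported_product_integrable[where \<alpha>=\<alpha> and \<beta>=\<beta>]) auto
qed

lemma test_function_combination:
  assumes "\<phi> \<in> test_functions d" "\<psi> \<in> test_functions d"
  shows "(\<lambda>t. \<phi> t - c * \<psi> t) \<in> test_functions d"
proof -
  have D: "((deriv ^^ k) f has_real_derivative (deriv ^^ Suc k) f t) (at t)" if "f \<in> test_functions d" for f k t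
    using that unfolding test_functions_def
    by (simp add: differentiable_on_def DERIV_deriv_iff_real_differentiable)
  have eq: "(deriv ^^ k) (\<lambda>t. \<phi> t - c * \<psi> t) = (\<lambda>t. (deriv ^^ k) \<phi> t - c * (deriv ^^ k) \<psi> t)" for k
  proof (induction k)
    case (Suc k)
    have "((\<lambda>t. (deriv ^^ k) \<phi> t - c * (deriv ^^ k) \<psi> t) has_real_derivative
            (deriv ^^ Suc k) \<phi> t - c * (deriv ^^ Suc k) \<psi> t) (at t)" for t
      using assms by (intro DERIV_diff DERIV_cmult D)
    then show ?case using Suc by (auto intro!: DERIV_imp_deriv)
  qed simp
  have "(deriv ^^ k) (\<lambda>t. \<phi> t - c * \<psi> t) differentiable_on UNIV" for k
    using assms unfolding eq test_functions_def by (auto intro!: derivative_intros)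
  moreover obtain K1 K2 where "compact K1" "K1 \<subseteq> {0<..<d}" "\<And>t. t \<notin> K1 \<Longrightarrow> \<phi> t = 0"
     "compact K2" "K2 \<subseteq> {0<..<d}" "\<And>t. t \<notin> K2 \<Longrightarrow> \<psi> t = 0"
    using assms unfolding test_functions_def by blast
  then have "\<exists>K. compact K \<and> K \<subseteq> {0<..<d} \<and> (\<forall>t. t \<notin> K \<longrightarrow> \<phi> t - c * \<psi> t = 0)"
    by (intro exI[of _ "K1 \<union> K2"]) auto
  ultimately show ?thesis by (simp add: test_functions_def)
qed

subsection \<open>Functions orthogonal to all test functions\<close>

text \<open>The open intervals are stable under intersection and generate the Borel sets, and the sets over
which \<open>G\<close> integrates to 0 form a Dynkin system.\<close>

lemma integral_borel_zero_if_intervals_zero: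
  fixes G :: "real \<Rightarrow> real"
  assumes G: "integrable lborel G" and tot: "(\<integral>t. G t \<partial>lborel) = 0"
    and ivl: "\<And>a b. (\<integral>t. indicator {a<..<b} t *\<^sub>R G t \<partial>lborel) = 0"
    and A: "A \<in> sets borel"
  shows "(LINT t:A|lborel. G t) = 0"
proof -
  have intg: "set_integrable lborel A G" if "A \<in> sets borel" for A
    unfolding set_integrable_def using integrable_mult_indicator[OF _ G] that by simp
  have bs: "sets borel = sigma_sets UNIV (range (\<lambda>(a, b). box a b :: real set))"
    by (subst borel_eq_box) (rule sets_measure_of, auto)
  have A': "A \<in> sigma_sets UNIV (range (\<lambda>(a, b). box a b :: real set))" using A bs by simp
  have Int: "Int_stable (range (\<lambda>(a, b). box a b :: real set))"
  proof (rule Int_stableI)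
    fix a b assume "a \<in> range (\<lambda>(a, b). box a b :: real set)" "b \<in> range (\<lambda>(a, b). box a b :: real set)"
    then obtain p q r s where "a = box p q" "b = box r s" by auto
    then have "a \<inter> b = (case (max p r, min q s) of (a, b) \<Rightarrow> box a b)" by auto
    then show "a \<inter> b \<in> range (\<lambda>(a, b). box a b :: real set)" by blast
  qed
  have sub: "range (\<lambda>(a, b). box a b :: real set) \<subseteq> Pow UNIV" by simp
  show ?thesis
    using Int sub A'
  proof (induction rule: sigma_sets_induct_disjoint)
    case (basic A)
    then show ?case using ivl by (auto simp: set_lebesgue_integral_def)
  next
    case empty
    then show ?case by (simp add: set_lebesgue_integral_def)
  next
    case (compl A)
    have A: "A \<in> sets borel" using compl bs by simp
    have "(LINT t:UNIV - A|lborel. G t) = (\<integral>t. G t - indicator A t *\<^sub>R G t \<partial>lborel)"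
      unfolding set_lebesgue_integral_def
      by (intro Bochner_Integration.integral_cong) (auto simp: indicator_def)
    also have "\<dots> = (\<integral>t. G t \<partial>lborel) - (LINT t:A|lborel. G t)"
      unfolding set_lebesgue_integral_def
      using G intg[OF A] by (intro Bochner_Integration.integral_diff) (auto simp: set_integrable_def)
    finally show ?case using compl tot by simp
  next
    case (union A)
    have A: "A i \<in> sets borel" for i using union(2) bs by auto
    have "(LINT t:(\<Union>i. A i)|lborel. G t) = (\<Sum>i. (LINT t:(A i)|lborel. G t))"
      using union(1) A by (intro lebesgue_integral_countable_add intg)
        (auto simp: disjoint_family_on_def)
    then show ?case using union by simp
  qed
qed

lemma AE_zero_if_intervals_zero:
  fixes G :: "real \<Rightarrow> real"
  assumes G: "integrable lebesgue G" and tot: "(\<integral>t. G t \<partial>lebesgue) = 0"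
    and ivl: "\<And>a b. (\<integral>t. indicator {a<..<b} t *\<^sub>R G t \<partial>lebesgue) = 0"
  shows "AE t in lebesgue. G t = 0"
proof -
  obtain G' where G': "G' \<in> borel_measurable lborel" "AE t in lborel. G t = G' t"
    using completion_ex_borel_measurable_real[of G lborel] G by auto
  have ae: "AE t in lebesgue. G t = G' t" using G'(2) by (rule AE_completion)
  have ml: "G' \<in> borel_measurable lebesgue" using G'(1) by (rule measurable_completion)
  have "integrable lebesgue G'"
    using G integrable_cong_AE[OF _ ml ae] by auto
  then have int: "integrable lborel G'" using G'(1) integrable_completion by blast
  have eq: "(\<integral>t. indicator A t *\<^sub>R G' t \<partial>lborel) = (\<integral>t. indicator A t *\<^sub>R G t \<partial>lebesgue)"
    if A: "A \<in> sets borel" for A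
  proof -
    have [measurable]: "A \<in> sets borel" "G' \<in> borel_measurable lborel" by fact+
    have Al: "A \<in> sets lebesgue" using A by simp
    have "(\<integral>t. indicator A t *\<^sub>R G' t \<partial>lborel) = (\<integral>t. indicator A t *\<^sub>R G' t \<partial>lebesgue)"
      by (rule integral_completion[symmetric]) measurable
    also have "\<dots> = (\<integral>t. indicator A t *\<^sub>R G t \<partial>lebesgue)"
    proof (rule integral_cong_AE)
      show "AE t in lebesgue. indicat_real A t *\<^sub>R G' t = indicat_real A t *\<^sub>R G t"
        using ae by eventually_elim simp
      show "(\<lambda>t. indicat_real A t *\<^sub>R G' t) \<in> borel_measurable lebesgue"
        using integrable_mult_indicator[OF Al \<open>integrable lebesgue G'\<close>] by simp
      show "(\<lambda>t. indicat_real A t *\<^sub>R G t) \<in> borel_measurable lebesgue"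
        using integrable_mult_indicator[OF Al G] by simp
    qed
    finally show ?thesis .
  qed
  have "AE t in lborel. G' t = 0"
  proof (rule sigma_finite_measure.density_zero[OF sigma_finite_lborel int])
    fix A :: "real set" assume "A \<in> sets lborel"
    then show "(LINT t:A|lborel. G' t) = 0"
      using eq[of UNIV] tot eq[of "{_<..<_}"] ivl
      by (intro integral_borel_zero_if_intervals_zero[OF int]) auto
  qed
  then have "AE t in lebesgue. G' t = 0" by (rule AE_completion)
  with ae show ?thesis by eventually_elim simp
qed

lemma bump_tendsto_indicator:
  "(\<lambda>n. bump \<alpha> \<beta> (1 / real (Suc n)) 1 0 t) \<longlonglongrightarrow> indicator {\<alpha><..<\<beta>} t"
proof (cases "\<alpha> < t \<and> t < \<beta>")
  case True
  define w where "w = (t - \<alpha>) * (\<beta> - t)"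
  have "(\<lambda>n. 1 / real (Suc n)) \<longlonglongrightarrow> 0" using LIMSEQ_inverse_real_of_nat by (simp add: inverse_eq_divide)
  then have "(\<lambda>n. exp (- (1 / real (Suc n)) / w)) \<longlonglongrightarrow> exp (- 0 / w)"
    using True by (intro tendsto_intros) (auto simp: w_def)
  then show ?thesis using True by (simp add: bump_def w_def)
qed (auto simp: bump_def)

text \<open>Bump functions are test functions that converge boundedly to the indicator of the interval, so
dominated convergence carries the hypothesis over to the indicator.\<close>

lemma weak_zero_interval:
  fixes g :: "real \<Rightarrow> real"
  assumes g: "g \<in> locally_L1 d"
    and z: "\<And>\<phi>. \<phi> \<in> test_functions d \<Longrightarrow> (\<integral>t. \<phi> t * g t \<partial>ivl_measure d) = 0"
    and ab: "0 < a" "a < b" "b < d"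
  shows "(\<integral>t. indicator {a<..<b} t *\<^sub>R g t \<partial>lebesgue) = 0"
proof -
  have ga: "g absolutely_integrable_on {a..b}"
    using locally_L1_Icc[OF g] ab by simp
  let ?s = "\<lambda>n t. bump a b (1 / real (Suc n)) 1 0 t * g t"
  have T: "bump a b (1 / real (Suc n)) 1 0 \<in> test_functions d" for n
    by (rule bump_test_function) (use ab in auto)
  have supp: "indicator {0<..<d} t *\<^sub>R ?s n t = ?s n t" for n t
    using ab by (auto simp: indicator_def bump_def)
  have int0: "(\<integral>t. ?s n t \<partial>lebesgue) = 0" for n
  proof -
    have "(\<integral>t. ?s n t \<partial>ivl_measure d) = (\<integral>t. indicator {0<..<d} t *\<^sub>R ?s n t \<partial>lebesgue)"
      by (rule integral_restrict_space) simp
    then show ?thesis using z[OF T[of n]] unfolding supp by simp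
  qed
  have ms: "?s n \<in> borel_measurable lebesgue" for n
  proof -
    have "integrable (ivl_measure d) (?s n)"
      using test_product_integrable(1)[OF T g] ab by (simp add: integrable_ivl_iff)
    then have "integrable lebesgue (\<lambda>t. indicator {0<..<d} t *\<^sub>R ?s n t)"
      by (simp add: integrable_restrict_space)
    then show ?thesis unfolding supp by simp
  qed
  have "(\<lambda>n. \<integral>t. ?s n t \<partial>lebesgue) \<longlonglongrightarrow> (\<integral>t. indicator {a<..<b} t *\<^sub>R g t \<partial>lebesgue)"
  proof (rule integral_dominated_convergence)
    have "set_integrable lebesgue {a<..<b} g"
      using ga by (rule set_integrable_subset) auto
    then show "(\<lambda>t. indicat_real {a<..<b} t *\<^sub>R g t) \<in> borel_measurable lebesgue"
      by (auto simp: set_integrable_def)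
    show "integrable lebesgue (\<lambda>t. norm (indicat_real {a..b} t *\<^sub>R g t))"
      using ga unfolding set_integrable_def by (rule integrable_norm)
    show "AE t in lebesgue. (\<lambda>n. ?s n t) \<longlonglongrightarrow> indicat_real {a<..<b} t *\<^sub>R g t"
      by (intro AE_I2) (use tendsto_mult_right[OF bump_tendsto_indicator] in auto)
    show "AE t in lebesgue. norm (?s n t) \<le> norm (indicat_real {a..b} t *\<^sub>R g t)" for n
    proof (intro AE_I2)
      fix t
      have "bump a b (1 / real (Suc n)) 1 0 t \<in> {0..indicat_real {a..b} t}"
        using ab by (auto simp: bump_def indicator_def)
      then show "norm (?s n t) \<le> norm (indicat_real {a..b} t *\<^sub>R g t)"
        by (auto simp: abs_mult intro!: mult_right_mono)
    qed
  qed (rule ms)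
  then have "(\<lambda>n. 0) \<longlonglongrightarrow> (\<integral>t. indicator {a<..<b} t *\<^sub>R g t \<partial>lebesgue)" unfolding int0 .
  then show ?thesis using LIMSEQ_unique tendsto_const by blast
qed

text \<open>Intervals with rational end points exhaust the open interval, so countably many null sets suffice.\<close>

lemma weak_zero_imp_AE_zero:
  fixes g :: "real \<Rightarrow> real"
  assumes g: "g \<in> locally_L1 d"
    and z: "\<And>\<phi>. \<phi> \<in> test_functions d \<Longrightarrow> (\<integral>t. \<phi> t * g t \<partial>ivl_measure d) = 0"
  shows "AE t in ivl_measure d. g t = 0"
proof -
  have loc: "AE t in lebesgue. \<alpha> < t \<and> t < \<beta> \<longrightarrow> g t = 0" if ab: "0 < \<alpha>" "\<alpha> < \<beta>" "\<beta> < d" for \<alpha> \<beta>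
  proof -
    let ?G = "\<lambda>t. indicator {\<alpha><..<\<beta>} t *\<^sub>R g t"
    have ga: "g absolutely_integrable_on {\<alpha>..\<beta>}"
      using locally_L1_Icc[OF g] ab by simp
    have "set_integrable lebesgue {\<alpha><..<\<beta>} g"
      using ga by (rule set_integrable_subset) auto
    then have G: "integrable lebesgue ?G" by (simp add: set_integrable_def)
    have "AE t in lebesgue. ?G t = 0"
    proof (rule AE_zero_if_intervals_zero[OF G])
      show "(\<integral>t. ?G t \<partial>lebesgue) = 0" by (rule weak_zero_interval[OF g z ab])
      fix a b :: real
      have "(\<lambda>t. indicator {a<..<b} t *\<^sub>R ?G t) = (\<lambda>t. indicator {max a \<alpha><..<min b \<beta>} t *\<^sub>R g t)"
        by (auto simp: indicator_def fun_eq_iff)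
      moreover have "(\<integral>t. indicator {max a \<alpha><..<min b \<beta>} t *\<^sub>R g t \<partial>lebesgue) = 0"
      proof (cases "max a \<alpha> < min b \<beta>")
        case True
        then show ?thesis using ab by (intro weak_zero_interval[OF g z]) auto
      next
        case False
        then have "{max a \<alpha><..<min b \<beta>} = {}" using ab by (intro greaterThanLessThan_empty) linarith
        then show ?thesis by simp
      qed
      ultimately show "(\<integral>t. indicator {a<..<b} t *\<^sub>R ?G t \<partial>lebesgue) = 0" by simp
    qed
    then show ?thesis by eventually_elim (auto simp: indicator_def)
  qed
  have "AE t in lebesgue. \<forall>r::rat \<times> rat. 0 < real_of_rat (fst r) \<and> real_of_rat (snd r) < d \<longrightarrow>
      real_of_rat (fst r) < t \<and> t < real_of_rat (snd r) \<longrightarrow> g t = 0"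
    unfolding AE_all_countable
  proof
    fix r :: "rat \<times> rat"
    show "AE t in lebesgue. 0 < real_of_rat (fst r) \<and> real_of_rat (snd r) < d \<longrightarrow>
      real_of_rat (fst r) < t \<and> t < real_of_rat (snd r) \<longrightarrow> g t = 0"
    proof (cases "0 < real_of_rat (fst r) \<and> real_of_rat (fst r) < real_of_rat (snd r) \<and> real_of_rat (snd r) < d")
      case True
      then have "AE t in lebesgue. real_of_rat (fst r) < t \<and> t < real_of_rat (snd r) \<longrightarrow> g t = 0"
        by (intro loc) auto
      then show ?thesis by eventually_elim auto
    next
      case False
      show ?thesis by (intro AE_I2) (use False in auto)
    qed
  qed
  then show ?thesis
    unfolding AE_ivl_iff
  proof eventually_elim
    case (elim t)
    show ?case
    proof
      assume t: "0 < t \<and> t < d"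
      obtain p where "0 < real_of_rat p" "real_of_rat p < t" using of_rat_dense t by blast
      moreover obtain q where "t < real_of_rat q" "real_of_rat q < d" using of_rat_dense t by blast
      ultimately show "g t = 0" using elim[rule_format, of "(p, q)"] by simp
    qed
  qed
qed

text \<open>The lemma of du Bois-Reymond. A test function of mean 0 is the derivative of a test function. So
after subtracting a multiple of one fixed bump \<open>\<psi>\<close> from an arbitrary test function, the
hypothesis shows that \<open>u\<close> minus its mean with respect to \<open>\<psi>\<close> is orthogonal to all test
functions.\<close>

lemma weak_constant:
  fixes u :: "real \<Rightarrow> real"
  assumes u: "u \<in> locally_L1 d" and d: "0 < d"
    and z: "\<And>\<phi>. \<phi> \<in> test_functions d \<Longrightarrow> (\<integral>t. deriv \<phi> t * u t \<partial>ivl_measure d) = 0"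
  shows "\<exists>c. AE t in ivl_measure d. u t = c"
proof -
  define \<psi> where "\<psi> = bump (d/3) (2*d/3) 1 1 0"
  have \<psi>: "\<psi> \<in> test_functions d"
    unfolding \<psi>_def by (rule bump_test_function) (use d in auto)
  have cont: "continuous_on S \<phi>" if "\<phi> \<in> test_functions d" for \<phi> S
    using test_function_has_derivative[OF that] by (meson DERIV_continuous_on has_field_derivative_at_within)
  define I where "I = integral {0..d} \<psi>"
  have \<psi>_nonneg: "0 \<le> \<psi> t" for t by (simp add: \<psi>_def bump_def)
  have "I \<noteq> 0"
  proof
    assume "I = 0"
    then have "\<psi> (d/2) = 0"
      unfolding I_def using d
      by (subst (asm) integral_eq_0_iff[OF cont[OF \<psi>]]) (auto simp: \<psi>_nonneg)
    then show False using d by (simp add: \<psi>_def bump_def)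
  qed
  define c where "c = integral {0..d} (\<lambda>t. \<psi> t * u t) / I"
  have "AE t in ivl_measure d. u t - c = 0"
  proof (rule weak_zero_imp_AE_zero)
    show "(\<lambda>t. u t - c) \<in> locally_L1 d"
      using u unfolding locally_L1_def
    proof clarify
      fix K :: "real set"
      assume *: "\<forall>K. compact K \<and> K \<subseteq> {0<..<d} \<longrightarrow> integrable (lebesgue_on K) u" "compact K" "K \<subseteq> {0<..<d}"
      then have "(\<lambda>t. c) absolutely_integrable_on K"
        by (intro absolutely_integrable_on_const lmeasurable_compact)
      then show "integrable (lebesgue_on K) (\<lambda>t. u t - c)"
        using * by (intro Bochner_Integration.integrable_diff)
          (auto simp: integrable_lebesgue_on_iff lmeasurable_compact fmeasurableD)
    qed
    fix \<phi> assume \<phi>: "\<phi> \<in> test_functions d"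
    define \<kappa> where "\<kappa> = integral {0..d} \<phi> / I"
    define \<eta> where "\<eta> = (\<lambda>t. \<phi> t - \<kappa> * \<psi> t)"
    have \<eta>: "\<eta> \<in> test_functions d" unfolding \<eta>_def by (rule test_function_combination[OF \<phi> \<psi>])
    have integ: "\<phi> integrable_on {0..t}" "\<psi> integrable_on {0..t}" "\<eta> integrable_on {0..t}" for t
      using cont \<phi> \<psi> \<eta> by (auto intro: integrable_continuous_real)
    have \<eta>0: "integral {0..d} \<eta> = 0"
    proof -
      have "integral {0..d} \<eta> = integral {0..d} \<phi> - integral {0..d} (\<lambda>t. \<kappa> * \<psi> t)"
        unfolding \<eta>_def using integ(1)[of d] integrable_cmul[OF integ(2)[of d], of \<kappa>]
        by (intro HK_integral_diff) auto
      then show ?thesis using \<open>I \<noteq> 0\<close> by (simp add: \<kappa>_def I_def)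
    qed
    obtain \<alpha> \<beta> where ab: "0 < \<alpha>" "\<alpha> < \<beta>" "\<beta> < d" "\<And>t. t \<notin> {\<alpha>..\<beta>} \<Longrightarrow> \<eta> t = 0 \<and> deriv \<eta> t = 0"
      using test_function_support[OF \<eta> d] by blast
    define \<Phi> where "\<Phi> = (\<lambda>t. integral {0..t} \<eta>)"
    have \<Phi>0: "\<Phi> t = 0" if "t \<notin> {\<alpha>..\<beta>}" for t
    proof (cases "t < \<alpha>")
      case True
      have "integral {0..t} \<eta> = integral {0..t} (\<lambda>t. 0)"
        by (intro HK_integral_cong) (use True ab in auto)
      then show ?thesis by (simp add: \<Phi>_def)
    next
      case False
      then have t: "\<beta> < t" using that by simp
      have 1: "integral {0..s} \<eta> = integral {0..\<beta>} \<eta>" if "\<beta> \<le> s" for s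
      proof -
        have "integral {0..\<beta>} \<eta> + integral {\<beta>..s} \<eta> = integral {0..s} \<eta>"
          using integ(3)[of s] ab that by (intro HK_integral_combine) auto
        moreover have "integral {\<beta>..s} \<eta> = integral {\<beta>..s} (\<lambda>t. 0)"
          using ab by (intro integral_spike[of "{\<beta>}"]) auto
        ultimately show ?thesis by simp
      qed
      show ?thesis using 1[of t] 1[of d] t ab \<eta>0 by (simp add: \<Phi>_def)
    qed
    have D\<Phi>: "(\<Phi> has_real_derivative \<eta> t) (at t)" for t
    proof (cases "t < \<alpha>")
      case True
      have "(\<Phi> has_real_derivative 0) (at t)"
        by (rule has_field_derivative_transform_within_open[OF DERIV_const, of "{..<\<alpha>}" t 0])
           (use True \<Phi>0 in auto)
      then show ?thesis using ab True by simp
    next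
      case False
      have "(\<Phi> has_real_derivative \<eta> t) (at t within {0..t + 1})"
        unfolding \<Phi>_def
        using integral_has_real_derivative[OF cont[OF \<eta>], of t 0 "t + 1"] False ab by auto
      moreover have "at t within {0..t + 1} = at t"
        by (rule at_within_interior) (use False ab in auto)
      ultimately show ?thesis by simp
    qed
    then have d\<Phi>: "deriv \<Phi> = \<eta>" by (auto intro: DERIV_imp_deriv)
    have \<Phi>: "\<Phi> \<in> test_functions d"
      unfolding test_functions_def
    proof (intro CollectI conjI allI)
      fix k show "(deriv ^^ k) \<Phi> differentiable_on UNIV"
      proof (cases k)
        case 0
        then show ?thesis using D\<Phi>
          by (auto simp: differentiable_on_def intro!: differentiableI has_field_derivative_imp_has_derivative
              intro: has_field_derivative_at_within)
      next
        case (Suc j)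
        have "(deriv ^^ Suc j) \<Phi> = (deriv ^^ j) \<eta>"
          by (simp only: funpow_Suc_right o_apply d\<Phi>)
        then show ?thesis using \<eta> Suc by (auto simp: test_functions_def)
      qed
    qed (use \<Phi>0 ab in \<open>intro exI[of _ "{\<alpha>..\<beta>}"], auto\<close>)
    have *: "(\<lambda>t. \<phi> t * u t) absolutely_integrable_on {0..d}" "(\<lambda>t. \<psi> t * u t) absolutely_integrable_on {0..d}"
       "(\<lambda>t. \<eta> t * u t) absolutely_integrable_on {0..d}"
      using \<phi> \<psi> \<eta> u d test_product_integrable by blast+
    have 0: "integral {0..d} (\<lambda>t. \<eta> t * u t) = 0"
      using z[OF \<Phi>] *(3) by (simp add: d\<Phi> integral_ivl)
    have "integral {0..d} (\<lambda>t. \<eta> t * u t) = integral {0..d} (\<lambda>t. \<phi> t * u t - \<kappa> * (\<psi> t * u t))"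
      by (intro HK_integral_cong) (simp add: \<eta>_def algebra_simps)
    also have "\<dots> = integral {0..d} (\<lambda>t. \<phi> t * u t) - \<kappa> * integral {0..d} (\<lambda>t. \<psi> t * u t)"
      using * by (subst HK_integral_diff) (auto intro: absolutely_integrable_on_def[THEN iffD1, THEN conjunct1])
    finally have eq: "integral {0..d} (\<lambda>t. \<phi> t * u t) = c * integral {0..d} \<phi>"
      using 0 by (simp add: c_def \<kappa>_def mult_ac)
    have \<phi>a: "\<phi> absolutely_integrable_on {0..d}"
      using cont[OF \<phi>] by (rule absolutely_integrable_continuous_real)
    have "(\<integral>t. \<phi> t * (u t - c) \<partial>ivl_measure d) = (\<integral>t. \<phi> t * u t - c * \<phi> t \<partial>ivl_measure d)"
      by (intro Bochner_Integration.integral_cong) (auto simp: algebra_simps)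
    also have "\<dots> = (\<integral>t. \<phi> t * u t \<partial>ivl_measure d) - c * (\<integral>t. \<phi> t \<partial>ivl_measure d)"
      using * \<phi>a by (subst Bochner_Integration.integral_diff) (auto simp: integrable_ivl_iff)
    also have "\<dots> = 0"
      using * \<phi>a eq by (simp add: integral_ivl)
    finally show "(\<integral>t. \<phi> t * (u t - c) \<partial>ivl_measure d) = 0" .
  qed
  then show ?thesis by auto
qed

section \<open>Absolutely continuous functions\<close>

text \<open>\<open>F\<close> is absolutely continuous on the interval and \<open>f\<close> is one of its derivatives, which matters only
up to null sets. The derivative is carried along as a parameter: all functions that occur below have
a concrete one, and second derivatives exist only in this sense because \<open>V\<close> is only of class
\<open>W^{2,\<infinity>}\<close>.\<close>

definition ac :: "real \<Rightarrow> real \<Rightarrow> (real \<Rightarrow> real) \<Rightarrow> (real \<Rightarrow> real) \<Rightarrow> bool" where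
  "ac a b F f \<longleftrightarrow> f absolutely_integrable_on {a..b} \<and> (\<forall>t\<in>{a..b}. F t = F a + integral {a..t} f)"

lemma abs_int_integrable: "f absolutely_integrable_on S \<Longrightarrow> f integrable_on (S :: real set)" for f :: "real \<Rightarrow> real"
  by (rule set_lebesgue_integral_eq_integral)

lemma abs_int_Icc_subset:
  "f absolutely_integrable_on {a..b} \<Longrightarrow> a \<le> c \<Longrightarrow> e \<le> b \<Longrightarrow> f absolutely_integrable_on {c..e::real}"
  for f :: "real \<Rightarrow> real"
  by (rule set_integrable_subset) auto

lemma abs_int_mult_continuous:
  fixes f g :: "real \<Rightarrow> real"
  assumes "f absolutely_integrable_on {a..b}" "continuous_on {a..b} g"
  shows "(\<lambda>t. f t * g t) absolutely_integrable_on {a..b}" "(\<lambda>t. g t * f t) absolutely_integrable_on {a..b}"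
proof -
  show "(\<lambda>t. g t * f t) absolutely_integrable_on {a..b}"
    using assms compact_continuous_image[OF assms(2)]
    by (intro absolutely_integrable_bounded_measurable_product_real continuous_imp_measurable_on_sets_lebesgue)
       (auto intro: compact_imp_bounded)
  then show "(\<lambda>t. f t * g t) absolutely_integrable_on {a..b}" by (simp add: mult.commute)
qed

lemma ac_I:
  assumes "f absolutely_integrable_on {a..b}" "\<And>t. a \<le> t \<Longrightarrow> t \<le> b \<Longrightarrow> F t - F a = integral {a..t} f"
  shows "ac a b F f"
  using assms by (fastforce simp: ac_def)

lemma ac_integrable: "ac a b F f \<Longrightarrow> f absolutely_integrable_on {a..b}"
  by (simp add: ac_def)

lemma ac_eq: "ac a b F f \<Longrightarrow> t \<in> {a..b} \<Longrightarrow> F t = F a + integral {a..t} f"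
  unfolding ac_def by blast

lemma ac_integral:
  assumes "ac a b F f" "a \<le> s" "s \<le> t" "t \<le> b"
  shows "integral {s..t} f = F t - F s"
proof -
  have "f integrable_on {a..t}"
    by (rule abs_int_integrable[OF abs_int_Icc_subset[OF ac_integrable[OF assms(1)]]]) (use assms in auto)
  then have "integral {a..s} f + integral {s..t} f = integral {a..t} f"
    using assms by (intro HK_integral_combine) auto
  moreover have "F s = F a + integral {a..s} f" "F t = F a + integral {a..t} f"
    by (rule ac_eq[OF assms(1)]; use assms in simp)+
  ultimately show ?thesis by simp
qed

lemma ac_continuous: "ac a b F f \<Longrightarrow> continuous_on {a..b} F"
proof -
  assume F: "ac a b F f"
  then have "continuous_on {a..b} (\<lambda>t. F a + integral {a..t} f)"
    by (intro continuous_intros indefinite_integral_continuous_1 abs_int_integrable ac_integrable)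
  then show ?thesis
    by (rule continuous_on_eq) (rule ac_eq[OF F, symmetric])
qed

lemma ac_subinterval: "ac a b F f \<Longrightarrow> a \<le> c \<Longrightarrow> e \<le> b \<Longrightarrow> ac c e F f"
  by (rule ac_I) (auto intro: abs_int_Icc_subset ac_integrable simp: ac_integral)


lemma ac_combine:
  assumes "ac a b F f" "ac b c F f" "a \<le> b" "b \<le> c"
  shows "ac a c F f"
proof (rule ac_I)
  have "{a..b} \<union> {b..c} = {a..c}" using assms by auto
  then show f: "f absolutely_integrable_on {a..c}"
    using set_integrable_Un[OF ac_integrable[OF assms(1)] ac_integrable[OF assms(2)]] by simp
  fix t assume t: "a \<le> t" "t \<le> c"
  show "F t - F a = integral {a..t} f"
  proof (cases "t \<le> b")
    case True
    then show ?thesis using ac_integral[OF assms(1), of a t] t by simp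
  next
    case False
    then have "integral {a..b} f + integral {b..t} f = integral {a..t} f"
      using assms t abs_int_integrable[OF abs_int_Icc_subset[OF f, of a t]]
      by (intro HK_integral_combine) simp_all
    then show ?thesis
      using ac_integral[OF assms(1), of a b] ac_integral[OF assms(2), of b t] assms t False by simp
  qed
qed

lemma ac_C1:
  assumes "\<And>t. a \<le> t \<Longrightarrow> t \<le> b \<Longrightarrow> (F has_real_derivative f t) (at t within {a..b})" "continuous_on {a..b} f"
  shows "ac a b F f"
proof (rule ac_I)
  show "f absolutely_integrable_on {a..b}" using assms(2) by (rule absolutely_integrable_continuous_real)
  fix t assume t: "a \<le> t" "t \<le> b"
  have "(f has_integral (F t - F a)) {a..t}"
  proof (rule fundamental_theorem_of_calculus)
    fix x assume "x \<in> {a..t}"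
    then have "(F has_real_derivative f x) (at x within {a..t})"
      using assms(1)[of x] t by (auto intro: DERIV_subset)
    then show "(F has_vector_derivative f x) (at x within {a..t})"
      by (simp add: has_real_derivative_iff_has_vector_derivative)
  qed (use t in simp)
  then show "F t - F a = integral {a..t} f" by (simp add: integral_unique)
qed

lemma ac_spike:
  assumes "ac a b F f" "negligible N" "\<And>t. t \<in> {a..b} - N \<Longrightarrow> g t = f t"
    "\<And>t. t \<in> {a..b} \<Longrightarrow> G t = F t"
  shows "ac a b G g"
proof (rule ac_I)
  show "g absolutely_integrable_on {a..b}"
    by (rule absolutely_integrable_spike[OF ac_integrable[OF assms(1)] assms(2,3)])
  fix t assume t: "a \<le> t" "t \<le> b"
  have "integral {a..t} g = integral {a..t} f"
    by (rule integral_spike[OF assms(2)]) (use assms(3) t in auto)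
  then show "G t - G a = integral {a..t} g"
    using ac_integral[OF assms(1), of a t] t assms(4) by simp
qed

lemma ac_cong:
  assumes "ac a b F f" "\<And>t. t \<in> {a..b} \<Longrightarrow> F t = G t" "\<And>t. t \<in> {a..b} \<Longrightarrow> f t = g t"
  shows "ac a b G g"
  using assms ac_spike[of a b F f "{}" g G] by simp

lemma ac_const: "ac a b (\<lambda>t. c) (\<lambda>t. 0)"
  by (rule ac_I) auto

lemma ac_id: "ac a b (\<lambda>t. t) (\<lambda>t. 1)"
  by (rule ac_C1) auto

lemma ac_add:
  assumes "ac a b F f" "ac a b G g"
  shows "ac a b (\<lambda>t. F t + G t) (\<lambda>t. f t + g t)"
proof (rule ac_I)
  show "(\<lambda>t. f t + g t) absolutely_integrable_on {a..b}"
    using assms by (intro set_integral_add ac_integrable)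
  fix t assume t: "a \<le> t" "t \<le> b"
  have "integral {a..t} (\<lambda>t. f t + g t) = integral {a..t} f + integral {a..t} g"
    using assms t by (intro HK_integral_add abs_int_integrable) (auto intro: abs_int_Icc_subset ac_integrable)
  then show "F t + G t - (F a + G a) = integral {a..t} (\<lambda>t. f t + g t)"
    using ac_integral[OF assms(1), of a t] ac_integral[OF assms(2), of a t] t by simp
qed

lemma ac_cmult:
  assumes "ac a b F f"
  shows "ac a b (\<lambda>t. c * F t) (\<lambda>t. c * f t)"
proof (rule ac_I)
  show "(\<lambda>t. c * f t) absolutely_integrable_on {a..b}"
    using ac_integrable[OF assms] by simp
  fix t assume t: "a \<le> t" "t \<le> b"
  show "c * F t - c * F a = integral {a..t} (\<lambda>t. c * f t)"
    using ac_integral[OF assms, of a t] t by (simp add: right_diff_distrib)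
qed

lemma ac_diff:
  assumes "ac a b F f" "ac a b G g"
  shows "ac a b (\<lambda>t. F t - G t) (\<lambda>t. f t - g t)"
  using ac_add[OF assms(1) ac_cmult[OF assms(2), of "- 1"]] by simp

text \<open>Summing the increments over a uniform partition gives at most the total variation of
\<open>\<Phi>\<close> times its largest increment, which tends to 0 by uniform continuity.\<close>

lemma constant_if_increments_quadratic:
  fixes H \<Phi> :: "real \<Rightarrow> real"
  assumes ab: "a \<le> b" and cont: "continuous_on {a..b} \<Phi>"
    and H: "\<And>s t. a \<le> s \<Longrightarrow> s \<le> t \<Longrightarrow> t \<le> b \<Longrightarrow> \<Phi> s \<le> \<Phi> t \<and> \<bar>H t - H s\<bar> \<le> C * (\<Phi> t - \<Phi> s)\<^sup>2"
  shows "H b = H a"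
proof (rule ccontr)
  assume ne: "H b \<noteq> H a"
  define T where "T = \<bar>C\<bar> * (\<Phi> b - \<Phi> a) + 1"
  have T: "0 < T" using H[of a b] ab by (simp add: T_def add_nonneg_pos)
  define e where "e = \<bar>H b - H a\<bar> / T"
  have e: "0 < e" using ne T by (simp add: e_def)
  have "uniformly_continuous_on {a..b} \<Phi>" using cont compact_uniformly_continuous by blast
  then obtain \<delta> where \<delta>: "0 < \<delta>"
     "\<And>s t. s \<in> {a..b} \<Longrightarrow> t \<in> {a..b} \<Longrightarrow> dist t s < \<delta> \<Longrightarrow> dist (\<Phi> t) (\<Phi> s) < e"
    unfolding uniformly_continuous_on_def using e by metis
  obtain n :: nat where n: "(b - a) / \<delta> < real n" using reals_Archimedean2 by blast
  have n0: "0 < real n" using n \<delta> ab by (smt (verit) divide_nonneg_pos)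
  define p where "p = (\<lambda>i::nat. a + real i * (b - a) / real n)"
  have p0: "p 0 = a" "p n = b" using n0 by (auto simp: p_def)
  have step: "p (Suc i) - p i = (b - a) / real n" for i
    by (simp add: p_def flip: diff_divide_distrib) (simp add: algebra_simps)
  have pm: "p i \<le> p (Suc i)" for i using step[of i] ab n0 by (smt (verit) divide_nonneg_pos)
  have pin: "p i \<in> {a..b}" if "i \<le> n" for i
  proof -
    have "real i * (b - a) / real n \<le> real n * (b - a) / real n"
      using that ab n0 by (intro divide_right_mono mult_right_mono) auto
    then show ?thesis using n0 ab by (simp add: p_def)
  qed
  have "\<bar>H (p n) - H (p 0)\<bar> = \<bar>\<Sum>i<n. H (p (Suc i)) - H (p i)\<bar>"
    using sum_lessThan_telescope[of "\<lambda>i. H (p i)" n] by simp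
  also have "\<dots> \<le> (\<Sum>i<n. \<bar>H (p (Suc i)) - H (p i)\<bar>)" by (rule sum_abs)
  also have "\<dots> \<le> (\<Sum>i<n. \<bar>C\<bar> * e * (\<Phi> (p (Suc i)) - \<Phi> (p i)))"
  proof (rule sum_mono)
    fix i assume i: "i \<in> {..<n}"
    have in2: "p i \<in> {a..b}" "p (Suc i) \<in> {a..b}" using i pin by auto
    have "dist (p (Suc i)) (p i) < \<delta>"
    proof -
      have "(b - a) / real n < \<delta>" using n n0 \<delta>(1) by (simp add: field_simps)
      then show ?thesis using step[of i] pm[of i] by (simp add: dist_real_def)
    qed
    then have "dist (\<Phi> (p (Suc i))) (\<Phi> (p i)) < e" using \<delta>(2) in2 by blast
    moreover have *: "\<Phi> (p i) \<le> \<Phi> (p (Suc i))" "\<bar>H (p (Suc i)) - H (p i)\<bar> \<le> C * (\<Phi> (p (Suc i)) - \<Phi> (p i))\<^sup>2"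
      using H[of "p i" "p (Suc i)"] in2 pm by auto
    ultimately have "(\<Phi> (p (Suc i)) - \<Phi> (p i))\<^sup>2 \<le> e * (\<Phi> (p (Suc i)) - \<Phi> (p i))"
      unfolding power2_eq_square by (intro mult_right_mono) (auto simp: dist_real_def)
    then have "\<bar>C\<bar> * (\<Phi> (p (Suc i)) - \<Phi> (p i))\<^sup>2 \<le> \<bar>C\<bar> * (e * (\<Phi> (p (Suc i)) - \<Phi> (p i)))"
      by (rule mult_left_mono) simp
    moreover have "C * (\<Phi> (p (Suc i)) - \<Phi> (p i))\<^sup>2 \<le> \<bar>C\<bar> * (\<Phi> (p (Suc i)) - \<Phi> (p i))\<^sup>2"
      by (rule mult_right_mono) auto
    ultimately show "\<bar>H (p (Suc i)) - H (p i)\<bar> \<le> \<bar>C\<bar> * e * (\<Phi> (p (Suc i)) - \<Phi> (p i))"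
      using * by (simp add: mult.assoc)
  qed
  also have "\<dots> = \<bar>C\<bar> * e * (\<Phi> (p n) - \<Phi> (p 0))"
    using sum_lessThan_telescope[of "\<lambda>i. \<Phi> (p i)" n] by (simp flip: sum_distrib_left)
  finally have "\<bar>H b - H a\<bar> \<le> e * (T - 1)" by (simp add: p0 T_def mult_ac)
  also have "\<dots> = \<bar>H b - H a\<bar> - e" using T by (simp add: e_def right_diff_distrib)
  finally show False using e by simp
qed

lemma integral_abs_bound:
  fixes f g :: "real \<Rightarrow> real"
  assumes "f absolutely_integrable_on {s..t}" "continuous_on {s..t} g" "\<And>r. r \<in> {s..t} \<Longrightarrow> \<bar>g r\<bar> \<le> B"
  shows "\<bar>integral {s..t} (\<lambda>r. f r * g r)\<bar> \<le> integral {s..t} (\<lambda>r. \<bar>f r\<bar>) * B"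
proof -
  have fa: "(\<lambda>r. \<bar>f r\<bar>) integrable_on {s..t}"
    using assms(1)[unfolded absolutely_integrable_on_def] by simp
  then have "(\<lambda>r. \<bar>f r\<bar> * B) integrable_on {s..t}"
    by (rule integrable_on_mult_left)
  then have "norm (integral {s..t} (\<lambda>r. f r * g r)) \<le> integral {s..t} (\<lambda>r. \<bar>f r\<bar> * B)"
    by (intro integral_norm_bound_integral[OF abs_int_integrable[OF abs_int_mult_continuous(1)[OF assms(1,2)]]])
      (use assms(3) in \<open>auto simp: abs_mult intro!: mult_left_mono\<close>)
  then show ?thesis by simp
qed

text \<open>The difference between \<open>F * G\<close> and the integral of the expected derivative has increments that are
bounded by products of an integral of \<open>\<bar>f\<bar>\<close> and an integral of \<open>\<bar>g\<bar>\<close> over the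
same interval, hence by the square of an increment of a continuous monotone function. So it is
constant.\<close>

theorem ac_mult:
  assumes F: "ac a b F f" and G: "ac a b G g"
  shows "ac a b (\<lambda>t. F t * G t) (\<lambda>t. f t * G t + F t * g t)"
proof (rule ac_I)
  let ?h = "\<lambda>t. f t * G t + F t * g t"
  note fG = abs_int_mult_continuous[OF ac_integrable[OF F] ac_continuous[OF G]]
  note Fg = abs_int_mult_continuous[OF ac_integrable[OF G] ac_continuous[OF F]]
  show h: "?h absolutely_integrable_on {a..b}"
    using fG(1) Fg(2) by (rule set_integral_add)
  fix t assume t: "a \<le> t" "t \<le> b"
  define \<Phi> where "\<Phi> = (\<lambda>t. integral {a..t} (\<lambda>r. \<bar>f r\<bar> + \<bar>g r\<bar>))"
  define H where "H = (\<lambda>t. F t * G t - integral {a..t} ?h)"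
  have ia: "(\<lambda>r. \<bar>f r\<bar>) absolutely_integrable_on {a..b}" "(\<lambda>r. \<bar>g r\<bar>) absolutely_integrable_on {a..b}"
    using absolutely_integrable_norm[OF ac_integrable[OF F]] absolutely_integrable_norm[OF ac_integrable[OF G]]
    by (simp_all add: o_def)
  have isum: "(\<lambda>r. \<bar>f r\<bar> + \<bar>g r\<bar>) absolutely_integrable_on {a..b}"
    using ia by (rule set_integral_add)
  have "H t = H a"
  proof (rule constant_if_increments_quadratic[of a t \<Phi> H 3])
    show "continuous_on {a..t} \<Phi>"
      unfolding \<Phi>_def
      by (rule indefinite_integral_continuous_1) (use abs_int_Icc_subset[OF isum] t abs_int_integrable in auto)
    fix s u assume su: "a \<le> s" "s \<le> u" "u \<le> t"
    define x where "x = integral {s..u} (\<lambda>r. \<bar>f r\<bar>)"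
    define y where "y = integral {s..u} (\<lambda>r. \<bar>g r\<bar>)"
    have sub: "k integrable_on {c..e}" if "k absolutely_integrable_on {a..b}" "a \<le> c" "e \<le> u" for k :: "real \<Rightarrow> real" and c e
      using abs_int_Icc_subset[OF that(1,2)] that(3) su t abs_int_integrable by simp
    have x0: "0 \<le> x" "0 \<le> y" unfolding x_def y_def by (auto intro!: integral_nonneg sub[OF ia(1)] sub[OF ia(2)] simp: su)
    have "\<Phi> u - \<Phi> s = integral {s..u} (\<lambda>r. \<bar>f r\<bar> + \<bar>g r\<bar>)"
      using HK_integral_combine[OF su(1,2) sub[OF isum]] by (simp add: \<Phi>_def)
    also have "\<dots> = x + y"
      unfolding x_def y_def using su by (intro HK_integral_add sub[OF ia(1)] sub[OF ia(2)]) auto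
    finally have \<Phi>: "\<Phi> u - \<Phi> s = x + y" .
    have Fd: "\<bar>F r - F s\<bar> \<le> x" if "r \<in> {s..u}" for r
    proof -
      have "F r - F s = integral {s..r} f" using ac_integral[OF F, of s r] su t that by simp
      also have "norm \<dots> \<le> integral {s..r} (\<lambda>r. \<bar>f r\<bar>)"
        by (rule integral_norm_bound_integral) (use sub[OF ac_integrable[OF F]] sub[OF ia(1)] that su in auto)
      also have "\<dots> \<le> x" unfolding x_def
        by (rule integral_subset_le) (use that sub[OF ia(1)] su in auto)
      finally show ?thesis by simp
    qed
    have Gd: "\<bar>G r - G s\<bar> \<le> y" if "r \<in> {s..u}" for r
    proof -
      have "G r - G s = integral {s..r} g" using ac_integral[OF G, of s r] su t that by simp
      also have "norm \<dots> \<le> integral {s..r} (\<lambda>r. \<bar>g r\<bar>)"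
        by (rule integral_norm_bound_integral) (use sub[OF ac_integrable[OF G]] sub[OF ia(2)] that su in auto)
      also have "\<dots> \<le> y" unfolding y_def
        by (rule integral_subset_le) (use that sub[OF ia(2)] su in auto)
      finally show ?thesis by simp
    qed
    have fs: "f absolutely_integrable_on {s..u}" "g absolutely_integrable_on {s..u}"
      using abs_int_Icc_subset ac_integrable F G su t by (meson order_trans)+
    have cs: "continuous_on {s..u} F" "continuous_on {s..u} G"
      using ac_continuous F G su t by (meson ac_subinterval order_trans)+
    have 1: "\<bar>integral {s..u} (\<lambda>r. f r * (G r - G s))\<bar> \<le> x * y"
      unfolding x_def by (rule integral_abs_bound[OF fs(1)]) (use Gd cs in \<open>auto intro!: continuous_intros\<close>)
    have 2: "\<bar>integral {s..u} (\<lambda>r. g r * (F r - F s))\<bar> \<le> y * x"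
      unfolding y_def by (rule integral_abs_bound[OF fs(2)]) (use Fd cs in \<open>auto intro!: continuous_intros\<close>)
    have "integral {s..u} ?h = integral {s..u} (\<lambda>r. (f r * (G r - G s) + g r * (F r - F s)) + (G s * f r + F s * g r))"
      by (rule HK_integral_cong) (simp add: algebra_simps)
    also have "\<dots> = (integral {s..u} (\<lambda>r. f r * (G r - G s)) + integral {s..u} (\<lambda>r. g r * (F r - F s)))
        + (integral {s..u} (\<lambda>r. G s * f r) + integral {s..u} (\<lambda>r. F s * g r))"
    proof -
      have i1: "(\<lambda>r. f r * (G r - G s)) integrable_on {s..u}" "(\<lambda>r. g r * (F r - F s)) integrable_on {s..u}"
        by (intro abs_int_integrable abs_int_mult_continuous(1) fs continuous_intros cs)+
      have i2: "(\<lambda>r. G s * f r) integrable_on {s..u}" "(\<lambda>r. F s * g r) integrable_on {s..u}"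
        by (intro integrable_on_mult_right abs_int_integrable fs)+
      show ?thesis
        using HK_integral_add[OF integrable_add[OF i1] integrable_add[OF i2]]
          HK_integral_add[OF i1] HK_integral_add[OF i2]
        by simp
    qed
    also have "integral {s..u} (\<lambda>r. G s * f r) = G s * (F u - F s)"
      using ac_integral[OF F, of s u] su t by simp
    also have "integral {s..u} (\<lambda>r. F s * g r) = F s * (G u - G s)"
      using ac_integral[OF G, of s u] su t by simp
    finally have I: "integral {s..u} ?h = integral {s..u} (\<lambda>r. f r * (G r - G s)) + integral {s..u} (\<lambda>r. g r * (F r - F s))
        + (G s * (F u - F s) + F s * (G u - G s))" .
    have "H u - H s = F u * G u - F s * G s - integral {s..u} ?h"
      using HK_integral_combine[OF su(1,2) sub[OF h]] by (simp add: H_def)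
    also have "\<dots> = (F u - F s) * (G u - G s) - integral {s..u} (\<lambda>r. f r * (G r - G s)) - integral {s..u} (\<lambda>r. g r * (F r - F s))"
      unfolding I by (simp add: algebra_simps)
    finally have "\<bar>H u - H s\<bar> \<le> \<bar>(F u - F s) * (G u - G s)\<bar> + x * y + y * x" using 1 2 by linarith
    also have "\<bar>(F u - F s) * (G u - G s)\<bar> \<le> x * y"
      using Fd[of u] Gd[of u] su x0 by (auto simp: abs_mult intro!: mult_mono)
    finally have "\<bar>H u - H s\<bar> \<le> 3 * (x * y)" by simp
    also have "\<dots> \<le> 3 * (x + y)\<^sup>2"
      using x0 by (simp add: power2_eq_square algebra_simps)
    finally show "\<Phi> s \<le> \<Phi> u \<and> \<bar>H u - H s\<bar> \<le> 3 * (\<Phi> u - \<Phi> s)\<^sup>2"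
      using \<Phi> x0 by simp
  qed (use t in auto)
  then show "F t * G t - F a * G a = integral {a..t} ?h" by (simp add: H_def)
qed

lemma integral_by_parts_ac:
  assumes "ac a b F f" "ac a b G g" "a \<le> b"
  shows "integral {a..b} (\<lambda>t. f t * G t + F t * g t) = F b * G b - F a * G a"
  using ac_integral[OF ac_mult[OF assms(1,2)], of a b] assms(3) by simp

section \<open>Weak derivatives\<close>

lemma AE_ivl_negligible:
  assumes "AE t in ivl_measure d. P t"
  obtains N where "negligible N" "\<And>t. t \<in> {0..d} - N \<Longrightarrow> P t"
proof -
  have "AE t in lebesgue. 0 < t \<and> t < d \<longrightarrow> P t"
    using assms by (simp only: AE_ivl_iff)
  then obtain N where N: "N \<in> null_sets lebesgue" "{t. \<not> (0 < t \<and> t < d \<longrightarrow> P t)} \<subseteq> N"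
    unfolding eventually_ae_filter by auto
  have "negligible (N \<union> {0, d})"
    using N(1) by (intro negligible_Un) (auto simp: negligible_iff_null_sets)
  then show ?thesis
    using N(2) by (intro that[of "N \<union> {0, d}"]) (auto simp: subset_eq less_le)
qed

lemma negligible_AE_ivl:
  assumes "negligible N" "\<And>t. t \<in> {0..d} - N \<Longrightarrow> P t"
  shows "AE t in ivl_measure d. P t"
proof -
  have "AE t in lebesgue. t \<notin> N"
    using assms(1) by (intro AE_not_in) (simp add: negligible_iff_null_sets)
  then show ?thesis
    unfolding AE_ivl_iff by eventually_elim (use assms(2) in auto)
qed

lemma ivl_integral_spike:
  fixes f g :: "real \<Rightarrow> 'a::euclidean_space"
  assumes f: "integrable (ivl_measure d) f" and ae: "AE t in ivl_measure d. g t = f t"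
  shows "integrable (ivl_measure d) g" "(\<integral>t. g t \<partial>ivl_measure d) = (\<integral>t. f t \<partial>ivl_measure d)"
proof -
  obtain N where N: "negligible N" "\<And>t. t \<in> {0..d} - N \<Longrightarrow> g t = f t"
    using AE_ivl_negligible[OF ae] by blast
  have fa: "f absolutely_integrable_on {0..d}" using f by (simp add: integrable_ivl_iff)
  have ga: "g absolutely_integrable_on {0..d}" by (rule absolutely_integrable_spike[OF fa N])
  then show "integrable (ivl_measure d) g" by (simp add: integrable_ivl_iff)
  show "(\<integral>t. g t \<partial>ivl_measure d) = (\<integral>t. f t \<partial>ivl_measure d)"
    unfolding integral_ivl[OF fa] integral_ivl[OF ga] by (rule integral_spike[OF N(1)]) (use N(2) in auto)
qed

lemma abs_int_locally_L1:
  fixes f :: "real \<Rightarrow> 'a::euclidean_space"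
  assumes "f absolutely_integrable_on {0..d}"
  shows "f \<in> locally_L1 d"
  unfolding locally_L1_def
proof clarify
  fix K :: "real set" assume K: "compact K" "K \<subseteq> {0<..<d}"
  have Ks: "K \<in> sets lebesgue" using K(1) by (simp add: borel_compact)
  have "K \<subseteq> {0..d}" using K(2) by (auto dest: subsetD)
  then have "f absolutely_integrable_on K" by (intro set_integrable_subset[OF assms Ks])
  then show "integrable (lebesgue_on K) f" using Ks by (simp add: integrable_lebesgue_on_iff)
qed

lemma AE_zero_continuous:
  fixes f :: "real \<Rightarrow> real"
  assumes "continuous_on {0..d} f" "AE t in ivl_measure d. f t = 0" "0 < d" "t \<in> {0..d}"
  shows "f t = 0"
proof -
  obtain N where N: "negligible N" "\<And>t. t \<in> {0..d} - N \<Longrightarrow> f t = 0"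
    using AE_ivl_negligible[OF assms(2)] by blast
  have c: "continuous_on {0..d} (\<lambda>t. \<bar>f t\<bar>)" using assms(1) by (intro continuous_intros)
  have "integral {0..d} (\<lambda>t. \<bar>f t\<bar>) = integral {0..d} (\<lambda>t. 0)"
    by (rule integral_spike[OF N(1)]) (use N(2) in auto)
  then have "\<forall>t\<in>{0..d}. \<bar>f t\<bar> = 0"
    using assms(3) integral_eq_0_iff[OF c] by simp
  then show ?thesis using assms(4) by auto
qed

subsection \<open>Weak derivatives of real functions\<close>

lemma test_function_ac:
  assumes "\<phi> \<in> test_functions d"
  shows "ac a b \<phi> (deriv \<phi>)"
  using test_function_has_derivative[OF assms] test_function_deriv_continuous[OF assms]
  by (intro ac_C1) (auto intro: has_field_derivative_at_within)

lemma test_function_zero: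
  assumes "\<phi> \<in> test_functions d" "t \<le> 0 \<or> d \<le> t"
  shows "\<phi> t = 0"
proof -
  obtain K where "K \<subseteq> {0<..<d}" "\<And>t. t \<notin> K \<Longrightarrow> \<phi> t = 0"
    using assms(1) unfolding test_functions_def by blast
  moreover have "t \<notin> {0<..<d}" using assms(2) by auto
  ultimately show ?thesis by blast
qed

lemma ac_imp_has_weak_deriv:
  assumes "0 < d" and F: "ac 0 d F f"
  shows "has_weak_deriv d F f"
  unfolding has_weak_deriv_def
proof (intro conjI ballI)
  show "F \<in> locally_L1 d"
    by (intro abs_int_locally_L1 absolutely_integrable_continuous_real ac_continuous[OF F])
  show "f \<in> locally_L1 d" by (intro abs_int_locally_L1 ac_integrable[OF F])
  fix \<phi> assume \<phi>: "\<phi> \<in> test_functions d"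
  note p = test_function_ac[OF \<phi>, of 0 d]
  have i: "(\<lambda>t. deriv \<phi> t * F t) absolutely_integrable_on {0..d}" "(\<lambda>t. \<phi> t * f t) absolutely_integrable_on {0..d}"
    by (intro abs_int_mult_continuous ac_integrable[OF p] ac_continuous[OF F] ac_integrable[OF F] ac_continuous[OF p])+
  have "integral {0..d} (\<lambda>t. deriv \<phi> t * F t + \<phi> t * f t) = 0"
    using integral_by_parts_ac[OF p F] assms(1) test_function_zero[OF \<phi>] by simp
  then have "integral {0..d} (\<lambda>t. deriv \<phi> t * F t) + integral {0..d} (\<lambda>t. \<phi> t * f t) = 0"
    using HK_integral_add[OF abs_int_integrable[OF i(1)] abs_int_integrable[OF i(2)]] by simp
  then show "(\<integral>t. deriv \<phi> t *\<^sub>R F t \<partial>ivl_measure d) = - (\<integral>t. \<phi> t *\<^sub>R f t \<partial>ivl_measure d)"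
    using i by (simp add: integral_ivl)
qed

lemma locally_L1_diff:
  fixes f g :: "real \<Rightarrow> real"
  shows "f \<in> locally_L1 d \<Longrightarrow> g \<in> locally_L1 d \<Longrightarrow> (\<lambda>t. f t - g t) \<in> locally_L1 d"
  unfolding locally_L1_def by (auto intro: Bochner_Integration.integrable_diff)

lemma has_weak_deriv_diff:
  fixes u v :: "real \<Rightarrow> real"
  assumes "0 < d" "has_weak_deriv d u f" "has_weak_deriv d v g"
  shows "has_weak_deriv d (\<lambda>t. u t - v t) (\<lambda>t. f t - g t)"
  unfolding has_weak_deriv_def
proof (intro conjI ballI)
  have L: "u \<in> locally_L1 d" "f \<in> locally_L1 d" "v \<in> locally_L1 d" "g \<in> locally_L1 d"
    using assms unfolding has_weak_deriv_def by auto
  then show "(\<lambda>t. u t - v t) \<in> locally_L1 d" "(\<lambda>t. f t - g t) \<in> locally_L1 d"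
    by (auto intro: locally_L1_diff)
  fix \<phi> assume \<phi>: "\<phi> \<in> test_functions d"
  have "(\<integral>t. deriv \<phi> t * u t \<partial>ivl_measure d) = - (\<integral>t. \<phi> t * f t \<partial>ivl_measure d)"
    "(\<integral>t. deriv \<phi> t * v t \<partial>ivl_measure d) = - (\<integral>t. \<phi> t * g t \<partial>ivl_measure d)"
    using assms \<phi> unfolding has_weak_deriv_def by auto
  then show "(\<integral>t. deriv \<phi> t *\<^sub>R (u t - v t) \<partial>ivl_measure d) = - (\<integral>t. \<phi> t *\<^sub>R (f t - g t) \<partial>ivl_measure d)"
    using test_product_integrable[OF \<phi> L(1) assms(1)] test_product_integrable[OF \<phi> L(2) assms(1)]
      test_product_integrable[OF \<phi> L(3) assms(1)] test_product_integrable[OF \<phi> L(4) assms(1)]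
    by (simp add: right_diff_distrib integrable_ivl_iff)
qed

lemma weak_deriv_unique:
  fixes u :: "real \<Rightarrow> real"
  assumes "0 < d" "has_weak_deriv d u f" "has_weak_deriv d u g"
  shows "AE t in ivl_measure d. f t = g t"
proof -
  have D: "has_weak_deriv d (\<lambda>t. u t - u t) (\<lambda>t. f t - g t)" by (rule has_weak_deriv_diff[OF assms])
  have "AE t in ivl_measure d. f t - g t = 0"
    by (rule weak_zero_imp_AE_zero) (use D in \<open>auto simp: has_weak_deriv_def\<close>)
  then show ?thesis by auto
qed

text \<open>Subtracting the primitive of \<open>g\<close> leaves a function with weak derivative 0, which is constant.\<close>

lemma has_weak_deriv_imp_ac:
  fixes u :: "real \<Rightarrow> real"
  assumes "0 < d" "has_weak_deriv d u g" "g absolutely_integrable_on {0..d}"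
  obtains U where "ac 0 d U g" "AE t in ivl_measure d. u t = U t"
proof -
  define W where "W = (\<lambda>t. integral {0..t} g)"
  have W: "ac 0 d W g" by (rule ac_I[OF assms(3)]) (simp add: W_def)
  have D: "has_weak_deriv d (\<lambda>t. u t - W t) (\<lambda>t. g t - g t)"
    by (rule has_weak_deriv_diff[OF assms(1,2) ac_imp_has_weak_deriv[OF assms(1) W]])
  have "\<exists>c. AE t in ivl_measure d. u t - W t = c"
    by (rule weak_constant) (use D assms(1) in \<open>auto simp: has_weak_deriv_def\<close>)
  then obtain c where c: "AE t in ivl_measure d. u t - W t = c" ..
  have "ac 0 d (\<lambda>t. W t + c) g" using ac_add[OF W ac_const[of 0 d c]] by simp
  moreover have "AE t in ivl_measure d. u t = W t + c" using c by eventually_elim auto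
  ultimately show ?thesis by (rule that)
qed

lemma continuous_has_weak_deriv_imp_ac:
  fixes u :: "real \<Rightarrow> real"
  assumes "0 < d" "has_weak_deriv d u g" "g absolutely_integrable_on {0..d}" "continuous_on {0..d} u"
  shows "ac 0 d u g"
proof -
  obtain U where U: "ac 0 d U g" "AE t in ivl_measure d. u t = U t"
    using has_weak_deriv_imp_ac[OF assms(1-3)] by blast
  have "u t - U t = 0" if "t \<in> {0..d}" for t
    by (rule AE_zero_continuous[OF _ _ assms(1) that])
       (use U(2) assms(4) ac_continuous[OF U(1)] in \<open>auto intro!: continuous_intros\<close>)
  then show ?thesis by (intro ac_cong[OF U(1)]) auto
qed

lemma ac_AE_cong:
  assumes "ac 0 d F f" "AE t in ivl_measure d. f t = g t"
  shows "ac 0 d F g"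
proof -
  obtain N where "negligible N" "\<And>t. t \<in> {0..d} - N \<Longrightarrow> f t = g t"
    using AE_ivl_negligible[OF assms(2)] by blast
  then show ?thesis by (intro ac_spike[OF assms(1)]) auto
qed

subsection \<open>Regularity of the potential\<close>

lemma Linf_bounded:
  assumes "g \<in> Linf d"
  obtains K where "AE t in ivl_measure d. norm (g t) \<le> K"
proof -
  have "Linf_norm d g < \<infinity>" using assms by (simp add: Linf_def)
  then obtain K where K: "Linf_norm d g \<le> ereal K" by (cases "Linf_norm d g") auto
  have "AE t in ivl_measure d. ereal (norm (g t)) \<le> Linf_norm d g"
    unfolding Linf_norm_def by (rule esssup_AE)
  then have "AE t in ivl_measure d. norm (g t) \<le> K"
  proof eventually_elim
    case (elim t)
    then have "ereal (norm (g t)) \<le> ereal K" using K by (rule order_trans)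
    then show ?case by simp
  qed
  then show ?thesis by (rule that)
qed

lemma Linf_abs_int:
  fixes g :: "real \<Rightarrow> real"
  assumes "g \<in> Linf d"
  shows "g absolutely_integrable_on {0..d}"
proof -
  obtain K where K: "AE t in ivl_measure d. norm (g t) \<le> K" using Linf_bounded[OF assms] .
  have "integrable (ivl_measure d) (\<lambda>t. K)"
    by (subst integrable_ivl_iff) simp
  then have "integrable (ivl_measure d) g"
    by (rule Bochner_Integration.integrable_bound) (use assms K in \<open>auto simp: Linf_def\<close>)
  then show ?thesis by (simp add: integrable_ivl_iff)
qed

lemma continuous_bounded_Icc:
  fixes f :: "real \<Rightarrow> real"
  assumes "continuous_on {a..b} f"
  obtains K where "\<And>t. t \<in> {a..b} \<Longrightarrow> \<bar>f t\<bar> \<le> K"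
proof -
  obtain K where "\<forall>x\<in>f ` {a..b}. norm x \<le> K"
    using compact_imp_bounded[OF compact_continuous_image[OF assms compact_Icc]]
    unfolding bounded_iff by blast
  then show ?thesis by (intro that[of K]) simp
qed

text \<open>The first weak derivative of \<open>V\<close> agrees almost everywhere with a primitive of the second one. The
latter is changed on a null set so that its bound holds everywhere.\<close>

lemma W2inf_regular:
  assumes d: "0 < d" and V: "V \<in> W2inf d"
  obtains V1 V2 K where "ac 0 d V V1" "ac 0 d V1 V2" "\<And>t. \<bar>V2 t\<bar> \<le> K"
proof -
  obtain g k where g: "g \<in> Linf d" "has_weak_deriv d V g" and k: "k \<in> Linf d" "has_weak_deriv d g k"
    and cont: "continuous_on {0..d} V"
    using V unfolding W2inf_def by blast
  have Vg: "ac 0 d V g"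
    by (rule continuous_has_weak_deriv_imp_ac[OF d g(2) Linf_abs_int[OF g(1)] cont])
  obtain G where G: "ac 0 d G k" "AE t in ivl_measure d. g t = G t"
    using has_weak_deriv_imp_ac[OF d k(2) Linf_abs_int[OF k(1)]] .
  have VG: "ac 0 d V G" by (rule ac_AE_cong[OF Vg G(2)])
  obtain K where K: "AE t in ivl_measure d. norm (k t) \<le> K" using Linf_bounded[OF k(1)] .
  define k' where "k' = (\<lambda>t. if \<bar>k t\<bar> \<le> K then k t else 0)"
  have "AE t in ivl_measure d. k t = k' t"
    using K by eventually_elim (simp add: k'_def)
  then have "ac 0 d G k'" by (rule ac_AE_cong[OF G(1)])
  moreover have "\<bar>k' t\<bar> \<le> \<bar>K\<bar>" for t by (simp add: k'_def)
  ultimately show ?thesis using VG that by blast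
qed

subsection \<open>Complex-valued functions\<close>

lemma integrable_Complex:
  "integrable M f \<Longrightarrow> integrable M g \<Longrightarrow> integrable M (\<lambda>t. Complex (f t) (g t))"
  unfolding Complex_eq by (intro Bochner_Integration.integrable_add integrable_mult_right integrable_of_real)

lemma integral_Complex:
  assumes "integrable M f" "integrable M g"
  shows "(\<integral>t. Complex (f t) (g t) \<partial>M) = Complex (\<integral>t. f t \<partial>M) (\<integral>t. g t \<partial>M)"
  using integral_Re[OF integrable_Complex[OF assms]] integral_Im[OF integrable_Complex[OF assms]]
  by (simp add: complex_eq_iff)

lemma integrable_complex_iff:
  fixes u :: "'a \<Rightarrow> complex"
  shows "integrable M u \<longleftrightarrow> integrable M (\<lambda>t. Re (u t)) \<and> integrable M (\<lambda>t. Im (u t))"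
  using integrable_Complex[of M "\<lambda>t. Re (u t)" "\<lambda>t. Im (u t)"] by auto

lemma has_weak_deriv_complex_iff:
  fixes u g :: "real \<Rightarrow> complex"
  assumes d: "0 < d"
  shows "has_weak_deriv d u g \<longleftrightarrow>
    has_weak_deriv d (\<lambda>t. Re (u t)) (\<lambda>t. Re (g t)) \<and> has_weak_deriv d (\<lambda>t. Im (u t)) (\<lambda>t. Im (g t))"
proof -
  have L: "f \<in> locally_L1 d \<longleftrightarrow> (\<lambda>t. Re (f t)) \<in> locally_L1 d \<and> (\<lambda>t. Im (f t)) \<in> locally_L1 d"
    for f :: "real \<Rightarrow> complex"
    unfolding locally_L1_def by (subst integrable_complex_iff) blast
  have I: "(\<integral>t. \<phi> t *\<^sub>R f t \<partial>ivl_measure d) =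
      Complex (\<integral>t. \<phi> t * Re (f t) \<partial>ivl_measure d) (\<integral>t. \<phi> t * Im (f t) \<partial>ivl_measure d)"
      "(\<integral>t. deriv \<phi> t *\<^sub>R f t \<partial>ivl_measure d) =
      Complex (\<integral>t. deriv \<phi> t * Re (f t) \<partial>ivl_measure d) (\<integral>t. deriv \<phi> t * Im (f t) \<partial>ivl_measure d)"
    if "f \<in> locally_L1 d" "\<phi> \<in> test_functions d" for f :: "real \<Rightarrow> complex" and \<phi>
  proof -
    have parts: "(\<lambda>t. Re (f t)) \<in> locally_L1 d" "(\<lambda>t. Im (f t)) \<in> locally_L1 d" using that L by auto
    note a = test_product_integrable[OF that(2) parts(1) d] test_product_integrable[OF that(2) parts(2) d]
    have eq: "\<psi> t *\<^sub>R f t = Complex (\<psi> t * Re (f t)) (\<psi> t * Im (f t))" for \<psi> :: "real \<Rightarrow> real" and t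
      by (simp add: complex_eq_iff)
    show "(\<integral>t. \<phi> t *\<^sub>R f t \<partial>ivl_measure d) =
      Complex (\<integral>t. \<phi> t * Re (f t) \<partial>ivl_measure d) (\<integral>t. \<phi> t * Im (f t) \<partial>ivl_measure d)"
      unfolding eq using a by (intro integral_Complex) (auto simp: integrable_ivl_iff)
    show "(\<integral>t. deriv \<phi> t *\<^sub>R f t \<partial>ivl_measure d) =
      Complex (\<integral>t. deriv \<phi> t * Re (f t) \<partial>ivl_measure d) (\<integral>t. deriv \<phi> t * Im (f t) \<partial>ivl_measure d)"
      unfolding eq using a by (intro integral_Complex) (auto simp: integrable_ivl_iff)
  qed
  show ?thesis
  proof (cases "u \<in> locally_L1 d \<and> g \<in> locally_L1 d")
    case True
    then show ?thesis
      using L[of u] L[of g] unfolding has_weak_deriv_def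
      by (simp add: I complex_eq_iff ball_conj_distrib)
  next
    case False
    then show ?thesis using L[of u] L[of g] unfolding has_weak_deriv_def by blast
  qed
qed

lemma weak_deriv_complex:
  fixes u :: "real \<Rightarrow> complex"
  assumes d: "0 < d" and "ac 0 d (\<lambda>t. Re (u t)) f" "ac 0 d (\<lambda>t. Im (u t)) g"
  shows "AE t in ivl_measure d. weak_deriv d u t = Complex (f t) (g t)"
proof -
  have "has_weak_deriv d u (\<lambda>t. Complex (f t) (g t))"
    using assms by (simp add: has_weak_deriv_complex_iff ac_imp_has_weak_deriv)
  then have "has_weak_deriv d u (weak_deriv d u)"
    unfolding weak_deriv_def using someI_ex[of "has_weak_deriv d u"] by blast
  then have w: "has_weak_deriv d (\<lambda>t. Re (u t)) (\<lambda>t. Re (weak_deriv d u t))"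
    "has_weak_deriv d (\<lambda>t. Im (u t)) (\<lambda>t. Im (weak_deriv d u t))"
    using d by (simp_all add: has_weak_deriv_complex_iff)
  have "AE t in ivl_measure d. Re (weak_deriv d u t) = f t"
    by (rule weak_deriv_unique[OF d w(1) ac_imp_has_weak_deriv[OF d assms(2)]])
  moreover have "AE t in ivl_measure d. Im (weak_deriv d u t) = g t"
    by (rule weak_deriv_unique[OF d w(2) ac_imp_has_weak_deriv[OF d assms(3)]])
  ultimately show ?thesis by eventually_elim (simp add: complex_eq_iff)
qed

lemma H1_ac_parts:
  assumes d: "0 < d" and u: "u \<in> H1 d"
  obtains f g where "ac 0 d (\<lambda>t. Re (u t)) f" "ac 0 d (\<lambda>t. Im (u t)) g"
proof -
  obtain w where w: "w \<in> L2 d" "has_weak_deriv d u w" and c: "continuous_on {0..d} u"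
    using u unfolding H1_def by blast
  have "integrable (ivl_measure d) (\<lambda>t. 1 + (norm (w t))\<^sup>2)"
  proof (intro Bochner_Integration.integrable_add)
    show "integrable (ivl_measure d) (\<lambda>t. 1::real)" by (subst integrable_ivl_iff) simp
  qed (use w in \<open>simp add: L2_def\<close>)
  then have "integrable (ivl_measure d) w"
  proof (rule Bochner_Integration.integrable_bound)
    have "norm z \<le> 1 + (norm z)\<^sup>2" for z :: complex
      using zero_le_power2[of "norm z - 1"] norm_ge_zero[of z] unfolding power2_diff one_power2 mult_1_right
      by linarith
    then show "AE t in ivl_measure d. norm (w t) \<le> norm (1 + (norm (w t))\<^sup>2)" by simp
  qed (use w in \<open>simp add: L2_def\<close>)
  then have i: "(\<lambda>t. Re (w t)) absolutely_integrable_on {0..d}" "(\<lambda>t. Im (w t)) absolutely_integrable_on {0..d}"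
    by (auto simp flip: integrable_ivl_iff)
  have "has_weak_deriv d (\<lambda>t. Re (u t)) (\<lambda>t. Re (w t))" "has_weak_deriv d (\<lambda>t. Im (u t)) (\<lambda>t. Im (w t))"
    using w(2) d by (simp_all add: has_weak_deriv_complex_iff)
  then have "ac 0 d (\<lambda>t. Re (u t)) (\<lambda>t. Re (w t))" "ac 0 d (\<lambda>t. Im (u t)) (\<lambda>t. Im (w t))"
    using c i d by (auto intro!: continuous_has_weak_deriv_imp_ac continuous_intros)
  then show ?thesis by (rule that)
qed

lemma C1_in_H1:
  assumes d: "0 < d" and F: "ac 0 d F f" and f: "continuous_on {0..d} f"
  shows "(\<lambda>t. complex_of_real (F t)) \<in> H1 d"
proof -
  have L2: "(\<lambda>t. complex_of_real (h t)) \<in> L2 d" if h: "continuous_on {0..d} h" for h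
  proof -
    have "integrable (ivl_measure d) (\<lambda>t. complex_of_real (h t))"
      by (intro integrable_of_real) (simp add: integrable_ivl_iff absolutely_integrable_continuous_real h)
    moreover have "integrable (ivl_measure d) (\<lambda>t. (norm (complex_of_real (h t)))\<^sup>2)"
      unfolding integrable_ivl_iff
      by (intro absolutely_integrable_continuous_real continuous_intros h)
    ultimately show ?thesis unfolding L2_def by auto
  qed
  have "has_weak_deriv d (\<lambda>t. complex_of_real (F t)) (\<lambda>t. complex_of_real (f t))"
    using ac_imp_has_weak_deriv[OF d F] ac_imp_has_weak_deriv[OF d ac_const[of 0 d 0]]
    by (simp add: has_weak_deriv_complex_iff d)
  then show ?thesis
    unfolding H1_def using L2[OF f] L2[OF ac_continuous[OF F]] ac_continuous[OF F]
    by (auto intro!: continuous_intros)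
qed

text \<open>The sesquilinear form on real functions, with explicit derivatives, with \<open>p\<close> in place of the negative
coefficient and with \<open>\<kappa>\<close> for the square root in the boundary term.\<close>

definition b_real ::
  "real \<Rightarrow> real \<Rightarrow> (real \<Rightarrow> real) \<Rightarrow> real \<Rightarrow> (real \<Rightarrow> real) \<Rightarrow> (real \<Rightarrow> real) \<Rightarrow> (real \<Rightarrow> real) \<Rightarrow> (real \<Rightarrow> real) \<Rightarrow> real" where
  "b_real d \<epsilon> p \<kappa> u u1 \<theta> \<theta>1 =
     \<epsilon>\<^sup>2 * integral {0..d} (\<lambda>t. u1 t * \<theta>1 t) + integral {0..d} (\<lambda>t. p t * u t * \<theta> t) + \<epsilon> * \<kappa> * u 0 * \<theta> 0"

lemma b_form_real_test:
  assumes d: "0 < d" and V: "continuous_on {0..d} V"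
    and u: "ac 0 d (\<lambda>t. Re (u t)) f" "ac 0 d (\<lambda>t. Im (u t)) g" and \<theta>: "ac 0 d \<theta> \<theta>1"
    and i: "(\<lambda>t. f t * \<theta>1 t) absolutely_integrable_on {0..d}" "(\<lambda>t. g t * \<theta>1 t) absolutely_integrable_on {0..d}"
  shows "b_form d E V a0 \<epsilon> u (\<lambda>t. complex_of_real (\<theta> t)) =
    Complex (b_real d \<epsilon> (\<lambda>t. V t - E) (sqrt \<bar>a0\<bar>) (\<lambda>t. Re (u t)) f \<theta> \<theta>1)
            (b_real d \<epsilon> (\<lambda>t. V t - E) (sqrt \<bar>a0\<bar>) (\<lambda>t. Im (u t)) g \<theta> \<theta>1)"
proof -
  have wu: "AE t in ivl_measure d. weak_deriv d u t = Complex (f t) (g t)"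
    by (rule weak_deriv_complex[OF d u])
  have w\<theta>: "AE t in ivl_measure d. weak_deriv d (\<lambda>t. complex_of_real (\<theta> t)) t = Complex (\<theta>1 t) 0"
    by (rule weak_deriv_complex[OF d]) (use \<theta> ac_const[of 0 d 0] in simp_all)
  have ae: "AE t in ivl_measure d. weak_deriv d u t * cnj (weak_deriv d (\<lambda>t. complex_of_real (\<theta> t)) t)
      = Complex (f t * \<theta>1 t) (g t * \<theta>1 t)"
    using wu w\<theta> by eventually_elim (simp add: complex_eq_iff)
  have ri: "integrable (ivl_measure d) (\<lambda>t. f t * \<theta>1 t)" "integrable (ivl_measure d) (\<lambda>t. g t * \<theta>1 t)"
    using i by (simp_all only: integrable_ivl_iff)
  have 1: "(\<integral>t. weak_deriv d u t * cnj (weak_deriv d (\<lambda>t. complex_of_real (\<theta> t)) t) \<partial>ivl_measure d)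
      = Complex (integral {0..d} (\<lambda>t. f t * \<theta>1 t)) (integral {0..d} (\<lambda>t. g t * \<theta>1 t))"
    unfolding ivl_integral_spike(2)[OF integrable_Complex[OF ri] ae]
    by (simp only: integral_Complex[OF ri] integral_ivl[OF i(1)] integral_ivl[OF i(2)])
  have c: "continuous_on {0..d} (\<lambda>t. coef E V t * Re (u t) * \<theta> t)" "continuous_on {0..d} (\<lambda>t. coef E V t * Im (u t) * \<theta> t)"
    unfolding coef_def using V ac_continuous[OF u(1)] ac_continuous[OF u(2)] ac_continuous[OF \<theta>]
    by (auto intro!: continuous_intros)
  have "(\<integral>t. of_real (coef E V t) * u t * cnj (complex_of_real (\<theta> t)) \<partial>ivl_measure d)
     = (\<integral>t. Complex (coef E V t * Re (u t) * \<theta> t) (coef E V t * Im (u t) * \<theta> t) \<partial>ivl_measure d)"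
    by (intro Bochner_Integration.integral_cong) (auto simp: complex_eq_iff)
  also have "\<dots> = Complex (integral {0..d} (\<lambda>t. coef E V t * Re (u t) * \<theta> t)) (integral {0..d} (\<lambda>t. coef E V t * Im (u t) * \<theta> t))"
    using c[THEN absolutely_integrable_continuous_real] by (simp add: integral_Complex integrable_ivl_iff integral_ivl)
  finally have 2: "(\<integral>t. of_real (coef E V t) * u t * cnj (complex_of_real (\<theta> t)) \<partial>ivl_measure d)
    = Complex (integral {0..d} (\<lambda>t. coef E V t * Re (u t) * \<theta> t)) (integral {0..d} (\<lambda>t. coef E V t * Im (u t) * \<theta> t))" .
  have 3: "integral {0..d} (\<lambda>t. (V t - E) * w t * \<theta> t) = - integral {0..d} (\<lambda>t. coef E V t * w t * \<theta> t)" for w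
    unfolding HK_integral_neg[symmetric]
    by (intro HK_integral_cong) (simp add: coef_def algebra_simps)
  show ?thesis
    unfolding b_form_def 1 2 b_real_def 3 by (simp add: complex_eq_iff)
qed

subsection \<open>Weak solutions are classical\<close>

text \<open>Test functions show that \<open>g\<close> has the continuous weak derivative \<open>p * w / \<epsilon>\<^sup>2\<close>, hence
it equals a continuously differentiable function almost everywhere. Testing with 1 and with the
identity then recovers the two boundary conditions.\<close>

lemma weak_solution_classical:
  assumes d: "0 < d" and \<epsilon>: "0 < \<epsilon>" and p: "continuous_on {0..d} p" and w: "ac 0 d w g"
    and eq: "\<And>\<theta> \<theta>1. ac 0 d \<theta> \<theta>1 \<Longrightarrow> continuous_on {0..d} \<theta>1 \<Longrightarrow> b_real d \<epsilon> p \<kappa> w g \<theta> \<theta>1 = \<epsilon> * l * \<theta> d"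
  obtains w1 where "ac 0 d w w1" "ac 0 d w1 (\<lambda>t. p t * w t / \<epsilon>\<^sup>2)" "\<epsilon> * w1 0 = \<kappa> * w 0" "\<epsilon> * w1 d = l"
proof -
  let ?F = "\<lambda>t. p t * w t / \<epsilon>\<^sup>2"
  have cF: "continuous_on {0..d} ?F" using p ac_continuous[OF w] \<epsilon> by (auto intro!: continuous_intros)
  have iF: "?F absolutely_integrable_on {0..d}" using cF by (rule absolutely_integrable_continuous_real)
  have D: "has_weak_deriv d g ?F"
    unfolding has_weak_deriv_def
  proof (intro conjI ballI)
    show "g \<in> locally_L1 d" by (intro abs_int_locally_L1 ac_integrable[OF w])
    show "?F \<in> locally_L1 d" by (intro abs_int_locally_L1 iF)
    fix \<phi> assume \<phi>: "\<phi> \<in> test_functions d"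
    have "\<epsilon>\<^sup>2 * integral {0..d} (\<lambda>t. g t * deriv \<phi> t) + integral {0..d} (\<lambda>t. p t * w t * \<phi> t) = 0"
      using eq[OF test_function_ac[OF \<phi>] test_function_deriv_continuous[OF \<phi>]] test_function_zero[OF \<phi>]
      by (simp add: b_real_def)
    moreover have "integral {0..d} (\<lambda>t. p t * w t * \<phi> t) = \<epsilon>\<^sup>2 * integral {0..d} (\<lambda>t. \<phi> t * ?F t)"
      unfolding integral_mult_right[symmetric]
      by (intro HK_integral_cong) (use \<epsilon> in simp)
    ultimately have "\<epsilon>\<^sup>2 * integral {0..d} (\<lambda>t. deriv \<phi> t * g t) = \<epsilon>\<^sup>2 * - integral {0..d} (\<lambda>t. \<phi> t * ?F t)"
      by (simp add: mult.commute)
    then have "integral {0..d} (\<lambda>t. deriv \<phi> t * g t) = - integral {0..d} (\<lambda>t. \<phi> t * ?F t)"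
      using \<epsilon> by (subst (asm) mult_cancel_left) auto
    moreover have "(\<lambda>t. deriv \<phi> t * g t) absolutely_integrable_on {0..d}" "(\<lambda>t. \<phi> t * ?F t) absolutely_integrable_on {0..d}"
      using test_product_integrable(2)[OF \<phi> abs_int_locally_L1[OF ac_integrable[OF w]] d]
        test_product_integrable(1)[OF \<phi> abs_int_locally_L1[OF iF] d] by auto
    ultimately show "(\<integral>t. deriv \<phi> t *\<^sub>R g t \<partial>ivl_measure d) = - (\<integral>t. \<phi> t *\<^sub>R ?F t \<partial>ivl_measure d)"
      by (simp only: real_scaleR_def integral_ivl)
  qed
  obtain w1 where w1: "ac 0 d w1 ?F" "AE t in ivl_measure d. g t = w1 t"
    using has_weak_deriv_imp_ac[OF d D iF] .
  have ww1: "ac 0 d w w1" by (rule ac_AE_cong[OF w w1(2)])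
  obtain N where N: "negligible N" "\<And>t. t \<in> {0..d} - N \<Longrightarrow> g t = w1 t"
    using AE_ivl_negligible[OF w1(2)] by blast
  have I1: "integral {0..d} (\<lambda>t. p t * w t) = \<epsilon>\<^sup>2 * (w1 d - w1 0)"
  proof -
    have "integral {0..d} (\<lambda>t. p t * w t) = \<epsilon>\<^sup>2 * integral {0..d} ?F"
      unfolding integral_mult_right[symmetric]
      by (intro HK_integral_cong) (use \<epsilon> in simp)
    moreover have "integral {0..d} ?F = w1 d - w1 0"
      by (rule ac_integral[OF w1(1)]) (use d in auto)
    ultimately show ?thesis by (simp only:)
  qed
  have e1: "\<epsilon>\<^sup>2 * (w1 d - w1 0) + \<epsilon> * \<kappa> * w 0 = \<epsilon> * l"
    using eq[OF ac_const[of 0 d 1]] I1 by (simp add: b_real_def)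
  have gi: "integral {0..d} g = integral {0..d} w1"
    by (rule integral_spike[OF N(1)]) (use N(2) in auto)
  have I2: "integral {0..d} (\<lambda>t. p t * w t * t) = \<epsilon>\<^sup>2 * (w1 d * d - integral {0..d} w1)"
  proof -
    have "integral {0..d} (\<lambda>t. ?F t * t + w1 t * 1) = w1 d * d"
      using integral_by_parts_ac[OF w1(1) ac_id] d by simp
    moreover have "integral {0..d} (\<lambda>t. ?F t * t + w1 t * 1) = integral {0..d} (\<lambda>t. ?F t * t) + integral {0..d} w1"
      using HK_integral_add[OF
          abs_int_integrable[OF abs_int_mult_continuous(1)[OF iF continuous_on_id]]
          integrable_continuous_real[OF ac_continuous[OF w1(1)]]]
      by (simp only: mult_1_right)
    moreover have "integral {0..d} (\<lambda>t. p t * w t * t) = \<epsilon>\<^sup>2 * integral {0..d} (\<lambda>t. ?F t * t)"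
      unfolding integral_mult_right[symmetric]
      by (intro HK_integral_cong) (use \<epsilon> in simp)
    ultimately show ?thesis by (metis add_diff_cancel_right')
  qed
  have "\<epsilon>\<^sup>2 * w1 d * d = \<epsilon> * l * d"
  proof -
    have "\<epsilon>\<^sup>2 * integral {0..d} w1 + \<epsilon>\<^sup>2 * (w1 d * d - integral {0..d} w1) = \<epsilon> * l * d"
      using eq[OF ac_id] by (simp add: b_real_def gi I2)
    then show ?thesis by (simp add: right_diff_distrib mult.assoc)
  qed
  then have l: "\<epsilon> * w1 d = l" using d \<epsilon> by (simp add: power2_eq_square)
  then have "\<epsilon> * (\<epsilon> * w1 0) = \<epsilon> * (\<kappa> * w 0)"
    using e1 unfolding l[symmetric] power2_eq_square right_diff_distrib mult.assoc by linarith
  then have "\<epsilon> * w1 0 = \<kappa> * w 0" using \<epsilon> mult_left_cancel[of \<epsilon>] by blast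
  then show ?thesis using that[OF ww1 w1(1)] l by blast
qed

section \<open>Energy estimates for WKB functions\<close>

subsection \<open>Integral inequalities\<close>

text \<open>All energy arguments below end in this form: the square of an energy is bounded by a constant times
the energy itself.\<close>

lemma square_le_mult_imp_le:
  fixes x y :: real
  assumes "x\<^sup>2 \<le> c * x" "0 \<le> x" "0 \<le> c"
  shows "x \<le> c"
  using assms by (cases "x = 0") (auto simp: power2_eq_square)

lemma Cauchy_Schwarz_integral:
  fixes f g :: "real \<Rightarrow> real"
  assumes f: "continuous_on {a..b} f" and g: "continuous_on {a..b} g"
  shows "(integral {a..b} (\<lambda>t. \<bar>f t\<bar> * \<bar>g t\<bar>))\<^sup>2 \<le> integral {a..b} (\<lambda>t. (f t)\<^sup>2) * integral {a..b} (\<lambda>t. (g t)\<^sup>2)"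
proof -
  define A where "A = integral {a..b} (\<lambda>t. (f t)\<^sup>2)"
  define B where "B = integral {a..b} (\<lambda>t. \<bar>f t\<bar> * \<bar>g t\<bar>)"
  define C where "C = integral {a..b} (\<lambda>t. (g t)\<^sup>2)"
  have ints: "(\<lambda>t. (f t)\<^sup>2) integrable_on {a..b}" "(\<lambda>t. \<bar>f t\<bar> * \<bar>g t\<bar>) integrable_on {a..b}" "(\<lambda>t. (g t)\<^sup>2) integrable_on {a..b}"
    using f g by (auto intro!: integrable_continuous_real continuous_intros)
  have A0: "0 \<le> A" "0 \<le> C" unfolding A_def C_def using ints by (auto intro: integral_nonneg)
  have quad: "0 \<le> x\<^sup>2 * A - 2 * (x * y) * B + y\<^sup>2 * C" for x y
  proof -
    have "integral {a..b} (\<lambda>t. (x * \<bar>f t\<bar> - y * \<bar>g t\<bar>)\<^sup>2)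
       = integral {a..b} (\<lambda>t. x\<^sup>2 * (f t)\<^sup>2 - 2 * (x * y) * (\<bar>f t\<bar> * \<bar>g t\<bar>) + y\<^sup>2 * (g t)\<^sup>2)"
      by (intro HK_integral_cong) (simp add: power2_diff power_mult_distrib)
    also have "\<dots> = x\<^sup>2 * A - 2 * (x * y) * B + y\<^sup>2 * C"
      unfolding A_def B_def C_def
      using HK_integral_add[OF integrable_diff[OF integrable_on_mult_right[OF ints(1)]
           integrable_on_mult_right[OF ints(2)]] integrable_on_mult_right[OF ints(3)], of "x\<^sup>2" "2 * (x * y)" "y\<^sup>2"]
         HK_integral_diff[OF integrable_on_mult_right[OF ints(1)] integrable_on_mult_right[OF ints(2)],
           of "x\<^sup>2" "2 * (x * y)"]
      by simp
    moreover have "0 \<le> integral {a..b} (\<lambda>t. (x * \<bar>f t\<bar> - y * \<bar>g t\<bar>)\<^sup>2)"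
      using f g by (intro integral_nonneg) (auto intro!: integrable_continuous_real continuous_intros)
    ultimately show ?thesis by simp
  qed
  show ?thesis
  proof (cases "C = 0")
    case True
    have "B = 0"
    proof (rule ccontr)
      assume "B \<noteq> 0"
      then show False
        using quad[of 1 "(A + 1) / (2 * B)"] True by simp
    qed
    then show ?thesis using True by (simp add: A_def B_def C_def)
  next
    case False
    have "0 \<le> C * (A * C - B\<^sup>2)" using quad[of C B] by (simp add: power2_eq_square algebra_simps)
    then have "B\<^sup>2 \<le> A * C" using False A0 by (simp add: zero_le_mult_iff)
    then show ?thesis by (simp add: A_def B_def C_def)
  qed
qed

lemma ac_increment_bound:
  assumes "ac a b F f" "G integrable_on {a..b}" "\<And>t. t \<in> {a..b} \<Longrightarrow> \<bar>f t\<bar> \<le> G t" "s \<in> {a..b}" "t \<in> {a..b}"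
  shows "\<bar>F t - F s\<bar> \<le> integral {a..b} G"
proof -
  have *: "\<bar>F t - F s\<bar> \<le> integral {a..b} G" if "s \<in> {a..b}" "t \<in> {a..b}" "s \<le> t" for s t
  proof -
    have i: "f integrable_on {s..t}" "G integrable_on {s..t}"
      using that assms(2) abs_int_integrable[OF ac_integrable[OF assms(1)]]
      by (auto intro: integrable_subinterval_real)
    have "norm (integral {s..t} f) \<le> integral {s..t} G"
      using that by (intro integral_norm_bound_integral i) (use assms(3) in auto)
    also have "\<dots> \<le> integral {a..b} G"
      by (rule integral_subset_le) (use that i assms(2) order_trans[OF abs_ge_zero assms(3)] in auto)
    finally show ?thesis using ac_integral[OF assms(1), of s t] that by simp
  qed
  show ?thesis using *[of s t] *[of t s] assms(4,5) by (cases "s \<le> t") (auto simp: abs_minus_commute)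
qed

lemma average_bound:
  fixes F :: "real \<Rightarrow> real"
  assumes "a < b" "F integrable_on {a..b}" "\<And>s. s \<in> {a..b} \<Longrightarrow> c \<le> F s + X"
  shows "(b - a) * c \<le> integral {a..b} F + (b - a) * X"
proof -
  have "integral {a..b} (\<lambda>s. c) \<le> integral {a..b} (\<lambda>s. F s + X)"
    using assms by (intro integral_le integrable_add) auto
  also have "\<dots> = integral {a..b} F + integral {a..b} (\<lambda>s. X)"
    using assms by (intro HK_integral_add) auto
  finally show ?thesis using assms(1) by simp
qed

lemma ac_has_derivative:
  assumes "ac a b F f" "continuous_on {a..b} f" "t \<in> {a..b}"
  shows "(F has_real_derivative f t) (at t within {a..b})"
proof -
  have "((\<lambda>t. F a + integral {a..t} f) has_real_derivative 0 + f t) (at t within {a..b})"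
    by (intro DERIV_add DERIV_const integral_has_real_derivative assms)
  then have "((\<lambda>t. F a + integral {a..t} f) has_real_derivative f t) (at t within {a..b})"
    by simp
  then show ?thesis
    by (rule has_field_derivative_transform_within[OF _ zero_less_one assms(3)])
       (rule ac_eq[OF assms(1), symmetric])
qed

subsection \<open>WKB functions\<close>

text \<open>The coefficient enters through \<open>q = (V - E) powr (- 1 / 4)\<close>; then \<open>V - E = 1 / q ^ 4\<close> and its square
root is \<open>1 / q\<^sup>2\<close>. A single constant \<open>K\<close> bounds all data, so that every estimate has an explicit
constant of the form number times power of \<open>K\<close>, visibly independent of \<open>\<epsilon>\<close> and of the grid.\<close>

locale wkb_coefficient =
  fixes d K :: real and q q1 q2 :: "real \<Rightarrow> real"
  assumes d_pos: "0 < d" and d_less: "d < 1" and K_ge: "1 \<le> K" and K_d: "1 / d \<le> K"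
    and ac_q: "ac 0 d q q1" and ac_q1: "ac 0 d q1 q2"
    and q_bounds: "\<And>t. t \<in> {0..d} \<Longrightarrow> 1 / K \<le> q t \<and> q t \<le> K \<and> \<bar>q1 t\<bar> \<le> K \<and> \<bar>q2 t\<bar> \<le> K"
begin

definition p :: "real \<Rightarrow> real" where "p t = 1 / q t ^ 4"

text \<open>The defect of the WKB approximation: with \<open>y = q * exp (S / \<epsilon>)\<close> one finds
\<open>y'' = (p / \<epsilon>\<^sup>2 + r) * y\<close> because \<open>S' = 1 / q\<^sup>2\<close>.\<close>

definition r :: "real \<Rightarrow> real" where "r t = q2 t / q t"

text \<open>The phase, a primitive of the square root of \<open>p\<close>.\<close>

definition S :: "real \<Rightarrow> real" where "S t = integral {0..t} (\<lambda>y. 1 / (q y)\<^sup>2)"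

lemma q_pos: "t \<in> {0..d} \<Longrightarrow> 0 < q t"
  using q_bounds[of t] K_ge by (smt (verit) divide_pos_pos)

lemma inverse_q_le: "t \<in> {0..d} \<Longrightarrow> 1 / q t \<le> K"
  using q_bounds[of t] q_pos[of t] K_ge by (simp add: field_simps)

lemma q_continuous: "continuous_on {0..d} q" by (rule ac_continuous[OF ac_q])

lemma q1_continuous: "continuous_on {0..d} q1" by (rule ac_continuous[OF ac_q1])

lemma p_continuous: "continuous_on {0..d} p"
  unfolding p_def using q_pos by (auto intro!: continuous_intros q_continuous simp: less_le)

lemma p_bounds: "t \<in> {0..d} \<Longrightarrow> 1 / K ^ 4 \<le> p t \<and> p t \<le> K ^ 4"
proof -
  assume t: "t \<in> {0..d}"
  have "q t ^ 4 \<le> K ^ 4" using q_bounds[OF t] q_pos[OF t] by (intro power_mono) auto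
  moreover have "(1 / q t) ^ 4 \<le> K ^ 4" using inverse_q_le[OF t] q_pos[OF t] by (intro power_mono) auto
  ultimately show ?thesis
    unfolding p_def using q_pos[OF t] K_ge by (auto simp: power_divide intro!: divide_left_mono)
qed

lemma s_bounds: "t \<in> {0..d} \<Longrightarrow> 1 / K\<^sup>2 \<le> 1 / (q t)\<^sup>2 \<and> 1 / (q t)\<^sup>2 \<le> K\<^sup>2"
proof -
  assume t: "t \<in> {0..d}"
  have "(q t)\<^sup>2 \<le> K\<^sup>2" using q_bounds[OF t] q_pos[OF t] by (intro power_mono) auto
  moreover have "(1 / q t)\<^sup>2 \<le> K\<^sup>2" using inverse_q_le[OF t] q_pos[OF t] by (intro power_mono) auto
  ultimately show ?thesis
    using q_pos[OF t] K_ge by (auto simp: power_divide intro!: divide_left_mono)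
qed

lemma r_bound: "t \<in> {0..d} \<Longrightarrow> \<bar>r t\<bar> \<le> K\<^sup>2"
  using mult_mono[of "\<bar>q2 t\<bar>" K "1 / q t" K] q_bounds[of t] inverse_q_le[of t] q_pos[of t] K_ge
  by (simp add: r_def power2_eq_square)

lemma ac_inverse_q: "ac 0 d (\<lambda>t. 1 / q t) (\<lambda>t. - q1 t / (q t)\<^sup>2)"
proof (rule ac_C1)
  fix t assume "0 \<le> t" "t \<le> d"
  then have t: "t \<in> {0..d}" by simp
  show "((\<lambda>t. 1 / q t) has_real_derivative - q1 t / (q t)\<^sup>2) (at t within {0..d})"
    using DERIV_divide[OF DERIV_const[of 1] ac_has_derivative[OF ac_q q1_continuous t]] q_pos[OF t]
    by (simp add: power2_eq_square)
next
  show "continuous_on {0..d} (\<lambda>t. - q1 t / (q t)\<^sup>2)"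
    using q_pos by (auto intro!: continuous_intros q_continuous q1_continuous simp: less_le)
qed

lemma S_derivative:
  assumes "t \<in> {0..d}"
  shows "(S has_real_derivative 1 / (q t)\<^sup>2) (at t within {0..d})"
  unfolding S_def
  by (rule integral_has_real_derivative[OF _ assms])
     (use q_pos in \<open>auto intro!: continuous_intros q_continuous simp: less_le\<close>)

lemma S_strict_mono: "0 \<le> a \<Longrightarrow> a < b \<Longrightarrow> b \<le> d \<Longrightarrow> S a < S b"
proof -
  assume ab: "0 \<le> a" "a < b" "b \<le> d"
  have c: "continuous_on {0..d} (\<lambda>y. 1 / (q y)\<^sup>2)"
    using q_pos by (auto intro!: continuous_intros q_continuous simp: less_le)
  have "ac 0 d S (\<lambda>y. 1 / (q y)\<^sup>2)" by (rule ac_C1[OF _ c]) (use S_derivative in auto)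
  then have "integral {a..b} (\<lambda>y. 1 / (q y)\<^sup>2) = S b - S a" using ac_integral ab by simp
  moreover have "integral {a..b} (\<lambda>y. 1 / K\<^sup>2) \<le> integral {a..b} (\<lambda>y. 1 / (q y)\<^sup>2)"
    using s_bounds ab continuous_on_subset[OF c, of "{a..b}"] by (intro integral_le integrable_continuous_real) auto
  moreover have "0 < integral {a..b} (\<lambda>y. 1 / K\<^sup>2)" using ab K_ge by simp
  ultimately show ?thesis by linarith
qed

text \<open>Here \<open>\<theta>\<close> solves the equation of the exact solution up to the bounded defect \<open>r\<close>, without any
inverse power of \<open>\<epsilon>\<close> in front of it. This is the sole source of the order of convergence.\<close>

definition wkb_sol :: "real \<Rightarrow> real \<Rightarrow> real \<Rightarrow> (real \<Rightarrow> real) \<Rightarrow> (real \<Rightarrow> real) \<Rightarrow> bool" where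
  "wkb_sol \<epsilon> a b \<theta> \<theta>1 \<longleftrightarrow> ac a b \<theta> \<theta>1 \<and> ac a b \<theta>1 (\<lambda>t. (p t / \<epsilon>\<^sup>2 + r t) * \<theta> t)"

lemma wkb_sol_add:
  assumes "wkb_sol \<epsilon> a b f f1" "wkb_sol \<epsilon> a b g g1"
  shows "wkb_sol \<epsilon> a b (\<lambda>t. A * f t + B * g t) (\<lambda>t. A * f1 t + B * g1 t)"
proof -
  note a = assms[unfolded wkb_sol_def]
  have 1: "ac a b (\<lambda>t. A * f t + B * g t) (\<lambda>t. A * f1 t + B * g1 t)"
    using a by (intro ac_add ac_cmult) auto
  have "ac a b (\<lambda>t. A * f1 t + B * g1 t) (\<lambda>t. A * ((p t / \<epsilon>\<^sup>2 + r t) * f t) + B * ((p t / \<epsilon>\<^sup>2 + r t) * g t))"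
    using a by (intro ac_add ac_cmult) auto
  then have "ac a b (\<lambda>t. A * f1 t + B * g1 t) (\<lambda>t. (p t / \<epsilon>\<^sup>2 + r t) * (A * f t + B * g t))"
    by (rule ac_cong) (simp_all add: algebra_simps add_divide_distrib)
  with 1 show ?thesis by (simp add: wkb_sol_def)
qed

lemma wkb_sol_cmult: "wkb_sol \<epsilon> a b f f1 \<Longrightarrow> wkb_sol \<epsilon> a b (\<lambda>t. A * f t) (\<lambda>t. A * f1 t)"
  using wkb_sol_add[of \<epsilon> a b f f1 f f1 A 0] by simp

lemma wkb_sol_cong: "wkb_sol \<epsilon> a b f f1 \<Longrightarrow> (\<And>t. t \<in> {a..b} \<Longrightarrow> f t = g t) \<Longrightarrow> wkb_sol \<epsilon> a b g f1"
  unfolding wkb_sol_def by (auto intro: ac_cong[where F=f] ac_cong[where F=f1])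

lemma wkb_sol_subinterval: "wkb_sol \<epsilon> a b f f1 \<Longrightarrow> a \<le> a' \<Longrightarrow> b' \<le> b \<Longrightarrow> wkb_sol \<epsilon> a' b' f f1"
  unfolding wkb_sol_def by (auto intro: ac_subinterval)

text \<open>In the second derivative the terms with \<open>cosh\<close> cancel, since \<open>q\<^sup>2 * S'\<close> is constant. The factor
\<open>q\<close> was chosen for this cancellation.\<close>

lemma wkb_sol_sinh:
  assumes \<epsilon>: "0 < \<epsilon>"
  shows "wkb_sol \<epsilon> 0 d (\<lambda>t. q t * sinh ((S t - c) / \<epsilon>))
    (\<lambda>t. q1 t * sinh ((S t - c) / \<epsilon>) + 1 / q t * (cosh ((S t - c) / \<epsilon>) / \<epsilon>))"
proof -
  have Sc: "continuous_on {0..d} S"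
    using S_derivative by (meson DERIV_continuous_on)
  have ac_sinh: "ac 0 d (\<lambda>t. sinh ((S t - c) / \<epsilon>)) (\<lambda>t. cosh ((S t - c) / \<epsilon>) * (1 / (q t)\<^sup>2 / \<epsilon>))"
    and ac_cosh: "ac 0 d (\<lambda>t. cosh ((S t - c) / \<epsilon>) / \<epsilon>) (\<lambda>t. sinh ((S t - c) / \<epsilon>) * (1 / (q t)\<^sup>2 / \<epsilon>) / \<epsilon>)"
  proof -
    have D: "((\<lambda>t. (S t - c) / \<epsilon>) has_real_derivative 1 / (q t)\<^sup>2 / \<epsilon>) (at t within {0..d})" if "t \<in> {0..d}" for t
      using DERIV_cdivide[OF DERIV_diff[OF S_derivative[OF that] DERIV_const[of c]], of \<epsilon>] by simp
    have cs: "continuous_on {0..d} (\<lambda>t. cosh ((S t - c) / \<epsilon>))" "continuous_on {0..d} (\<lambda>t. sinh ((S t - c) / \<epsilon>))"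
      unfolding cosh_field_def sinh_field_def using \<epsilon> Sc by (auto intro!: continuous_intros)
    have ci: "continuous_on {0..d} (\<lambda>t. 1 / (q t)\<^sup>2 / \<epsilon>)"
      using q_pos \<epsilon> by (auto intro!: continuous_intros q_continuous simp: less_le)
    show "ac 0 d (\<lambda>t. sinh ((S t - c) / \<epsilon>)) (\<lambda>t. cosh ((S t - c) / \<epsilon>) * (1 / (q t)\<^sup>2 / \<epsilon>))"
    proof (rule ac_C1)
      show "continuous_on {0..d} (\<lambda>t. cosh ((S t - c) / \<epsilon>) * (1 / (q t)\<^sup>2 / \<epsilon>))"
        by (intro continuous_on_mult cs ci)
    qed (intro has_field_derivative_sinh D; simp)
    show "ac 0 d (\<lambda>t. cosh ((S t - c) / \<epsilon>) / \<epsilon>) (\<lambda>t. sinh ((S t - c) / \<epsilon>) * (1 / (q t)\<^sup>2 / \<epsilon>) / \<epsilon>)"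
    proof (rule ac_C1)
      show "continuous_on {0..d} (\<lambda>t. sinh ((S t - c) / \<epsilon>) * (1 / (q t)\<^sup>2 / \<epsilon>) / \<epsilon>)"
        using \<epsilon> by (intro continuous_on_divide continuous_on_mult cs ci) auto
    qed (intro DERIV_cdivide has_field_derivative_cosh D; simp)
  qed
  have 1: "ac 0 d (\<lambda>t. q t * sinh ((S t - c) / \<epsilon>))
     (\<lambda>t. q1 t * sinh ((S t - c) / \<epsilon>) + 1 / q t * (cosh ((S t - c) / \<epsilon>) / \<epsilon>))"
  proof (rule ac_cong[OF ac_mult[OF ac_q ac_sinh]])
    fix t assume "t \<in> {0..d}"
    then show "q1 t * sinh ((S t - c) / \<epsilon>) + q t * (cosh ((S t - c) / \<epsilon>) * (1 / (q t)\<^sup>2 / \<epsilon>)) =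
         q1 t * sinh ((S t - c) / \<epsilon>) + 1 / q t * (cosh ((S t - c) / \<epsilon>) / \<epsilon>)"
      using q_pos[of t] by (simp add: power2_eq_square)
  qed simp
  have "ac 0 d (\<lambda>t. q1 t * sinh ((S t - c) / \<epsilon>) + 1 / q t * (cosh ((S t - c) / \<epsilon>) / \<epsilon>))
     (\<lambda>t. (p t / \<epsilon>\<^sup>2 + r t) * (q t * sinh ((S t - c) / \<epsilon>)))"
  proof (rule ac_cong[OF ac_add[OF ac_mult[OF ac_q1 ac_sinh] ac_mult[OF ac_inverse_q ac_cosh]]])
    fix t assume "t \<in> {0..d}"
    then show "q2 t * sinh ((S t - c) / \<epsilon>) + q1 t * (cosh ((S t - c) / \<epsilon>) * (1 / (q t)\<^sup>2 / \<epsilon>)) +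
         (- q1 t / (q t)\<^sup>2 * (cosh ((S t - c) / \<epsilon>) / \<epsilon>) +
          1 / q t * (sinh ((S t - c) / \<epsilon>) * (1 / (q t)\<^sup>2 / \<epsilon>) / \<epsilon>)) =
         (p t / \<epsilon>\<^sup>2 + r t) * (q t * sinh ((S t - c) / \<epsilon>))"
      using q_pos[of t] \<epsilon> by (simp add: p_def r_def field_simps power2_eq_square power4_eq_xxxx)
  qed simp
  with 1 show ?thesis by (simp add: wkb_sol_def)
qed

end

context wkb_coefficient
begin

subsection \<open>Estimates on one cell and for the exact solution\<close>

lemma K_pos: "0 < K" using K_ge by simp

text \<open>The energy estimate behind all interpolation errors, for the first-order system that the error
satisfies after division by \<open>q\<close>. Up to the forcing term \<open>\<epsilon> * q2 * u\<close> the system is the one of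
hyperbolic functions in the phase variable, so its energy is definite. As \<open>y\<close> vanishes at both ends,
the Poincare inequality gains one factor \<open>min 1 ((b - a) / \<epsilon>)\<close>, which enters twice: in the
estimate of the forcing term and in passing from the energy to \<open>y\<close>. The bounds at points follow from
the integrals of \<open>Y * y\<close> and \<open>Y * u\<close>, which control the increments of \<open>y\<^sup>2\<close> and of \<open>Y\<^sup>2\<close>.\<close>

lemma cell_transformed_estimates:
  assumes \<epsilon>: "0 < \<epsilon>" and ab: "0 \<le> a" "a < b" "b \<le> d"
    and \<chi>: "continuous_on {a..b} u"
    and y: "ac a b y (\<lambda>t. Y t / (\<epsilon> * (q t)\<^sup>2))"
    and Y: "ac a b Y (\<lambda>t. y t / (\<epsilon> * (q t)\<^sup>2) - \<epsilon> * q2 t * u t)"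
    and y0: "y a = 0" "y b = 0"
    and \<mu>: "\<mu> = min \<epsilon> (b - a)" and D: "D = integral {a..b} (\<lambda>t. (u t)\<^sup>2)"
  shows "integral {a..b} (\<lambda>t. (Y t)\<^sup>2) \<le> K ^ 10 * \<epsilon>\<^sup>2 * \<mu>\<^sup>2 * D"
    and "integral {a..b} (\<lambda>t. (y t)\<^sup>2) \<le> K ^ 14 * \<mu> ^ 4 * D"
    and "\<And>t. t \<in> {a..b} \<Longrightarrow> (y t)\<^sup>2 \<le> 2 * K ^ 14 * \<mu> ^ 3 * D"
    and "\<And>t. t \<in> {a..b} \<Longrightarrow> (Y t)\<^sup>2 \<le> 5 * K ^ 14 * \<epsilon>\<^sup>2 * \<mu> * D"
proof -
  have sub: "t \<in> {0..d}" if "t \<in> {a..b}" for t using that ab by auto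
  note cy = ac_continuous[OF y] and cY = ac_continuous[OF Y]
  have cq: "continuous_on {a..b} q" using q_continuous by (rule continuous_on_subset) (use ab in auto)
  have qn: "q t \<noteq> 0" if "t \<in> {a..b}" for t using q_pos[OF sub[OF that]] by simp
  define A where "A = integral {a..b} (\<lambda>t. (Y t)\<^sup>2)"
  define B where "B = integral {a..b} (\<lambda>t. (y t)\<^sup>2)"
  have ints: "(\<lambda>t. (Y t)\<^sup>2) integrable_on {a..b}" "(\<lambda>t. (y t)\<^sup>2) integrable_on {a..b}" "(\<lambda>t. (u t)\<^sup>2) integrable_on {a..b}"
    by (intro integrable_continuous_real continuous_intros cy cY \<chi>)+
  have nn: "0 \<le> A" "0 \<le> B" "0 \<le> D" unfolding A_def B_def D using ints by (auto intro!: integral_nonneg)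
  have \<mu>0: "0 < \<mu>" "\<mu> \<le> \<epsilon>" "\<mu> \<le> b - a" using \<mu> \<epsilon> ab by auto
  have csYy: "(integral {a..b} (\<lambda>t. \<bar>Y t\<bar> * \<bar>y t\<bar>))\<^sup>2 \<le> A * B"
    unfolding A_def B_def by (rule Cauchy_Schwarz_integral[OF cY cy])
  have csuy: "(integral {a..b} (\<lambda>t. \<bar>u t\<bar> * \<bar>y t\<bar>))\<^sup>2 \<le> D * B"
    unfolding D B_def by (rule Cauchy_Schwarz_integral[OF \<chi> cy])
  have csYu: "(integral {a..b} (\<lambda>t. \<bar>Y t\<bar> * \<bar>u t\<bar>))\<^sup>2 \<le> A * D"
    unfolding D A_def by (rule Cauchy_Schwarz_integral[OF cY \<chi>])
  have i2: "(\<lambda>t. \<bar>Y t\<bar> * \<bar>y t\<bar>) integrable_on {a..b}" "(\<lambda>t. \<bar>u t\<bar> * \<bar>y t\<bar>) integrable_on {a..b}"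
     "(\<lambda>t. \<bar>Y t\<bar> * \<bar>u t\<bar>) integrable_on {a..b}"
    by (intro integrable_continuous_real continuous_intros cy cY \<chi>)+
  \<comment> \<open>The product \<open>y * Y\<close> vanishes at both ends, so its derivative has integral 0.\<close>
  have "A + B \<le> K ^ 3 * \<epsilon>\<^sup>2 * integral {a..b} (\<lambda>t. \<bar>u t\<bar> * \<bar>y t\<bar>)"
  proof -
    define e where "e = (\<lambda>t. Y t / (\<epsilon> * (q t)\<^sup>2) * Y t + y t * (y t / (\<epsilon> * (q t)\<^sup>2) - \<epsilon> * q2 t * u t))"
    have e0: "integral {a..b} e = 0"
      unfolding e_def using integral_by_parts_ac[OF y Y] ab y0 by simp
    have ei: "e integrable_on {a..b}"
      unfolding e_def by (rule abs_int_integrable[OF ac_integrable[OF ac_mult[OF y Y]]])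
    have low: "((Y t)\<^sup>2 + (y t)\<^sup>2) / (K\<^sup>2 * \<epsilon>) - \<epsilon> * K * (\<bar>u t\<bar> * \<bar>y t\<bar>) \<le> e t" if t: "t \<in> {a..b}" for t
    proof -
      have "e t = ((Y t)\<^sup>2 + (y t)\<^sup>2) / \<epsilon> * (1 / (q t)\<^sup>2) - \<epsilon> * (q2 t * u t * y t)"
        unfolding e_def using \<epsilon> qn[OF t] by (simp add: field_simps power2_eq_square)
      moreover have "((Y t)\<^sup>2 + (y t)\<^sup>2) / \<epsilon> * (1 / K\<^sup>2) \<le> ((Y t)\<^sup>2 + (y t)\<^sup>2) / \<epsilon> * (1 / (q t)\<^sup>2)"
        using s_bounds[OF sub[OF t]] \<epsilon> by (intro mult_left_mono) auto
      moreover have "\<epsilon> * (q2 t * u t * y t) \<le> \<epsilon> * (K * (\<bar>u t\<bar> * \<bar>y t\<bar>))"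
      proof (rule mult_left_mono)
        have "q2 t * u t * y t \<le> \<bar>q2 t\<bar> * (\<bar>u t\<bar> * \<bar>y t\<bar>)"
          by (metis abs_ge_self abs_mult mult.assoc)
        also have "\<dots> \<le> K * (\<bar>u t\<bar> * \<bar>y t\<bar>)" using q_bounds[OF sub[OF t]] by (intro mult_right_mono) auto
        finally show "q2 t * u t * y t \<le> K * (\<bar>u t\<bar> * \<bar>y t\<bar>)" .
      qed (use \<epsilon> in simp)
      ultimately show ?thesis by (simp add: mult_ac)
    qed
    have si: "(\<lambda>t. (Y t)\<^sup>2 + (y t)\<^sup>2) integrable_on {a..b}" using ints by (intro integrable_add)
    have "integral {a..b} (\<lambda>t. ((Y t)\<^sup>2 + (y t)\<^sup>2) / (K\<^sup>2 * \<epsilon>) - \<epsilon> * K * (\<bar>u t\<bar> * \<bar>y t\<bar>)) \<le> integral {a..b} e"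
      by (rule integral_le) (use low ei in \<open>auto intro!: integrable_diff integrable_on_divide si integrable_on_mult_right i2\<close>)
    then have "(A + B) / (K\<^sup>2 * \<epsilon>) - \<epsilon> * K * integral {a..b} (\<lambda>t. \<bar>u t\<bar> * \<bar>y t\<bar>) \<le> 0"
      unfolding e0 A_def B_def
      using HK_integral_diff[OF integrable_on_divide[OF si] integrable_on_mult_right[OF i2(2)], of "K\<^sup>2 * \<epsilon>" "\<epsilon> * K"]
        HK_integral_add[OF ints(1,2)] by simp
    then have "(A + B) / (K\<^sup>2 * \<epsilon>) \<le> \<epsilon> * K * integral {a..b} (\<lambda>t. \<bar>u t\<bar> * \<bar>y t\<bar>)" by simp
    then have "A + B \<le> \<epsilon> * K * integral {a..b} (\<lambda>t. \<bar>u t\<bar> * \<bar>y t\<bar>) * (K\<^sup>2 * \<epsilon>)"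
      using \<epsilon> K_pos by (subst (asm) pos_divide_le_eq) auto
    then show ?thesis by (simp add: power2_eq_square power3_eq_cube mult_ac)
  qed
  then have "(A + B)\<^sup>2 \<le> (K ^ 3 * \<epsilon>\<^sup>2 * integral {a..b} (\<lambda>t. \<bar>u t\<bar> * \<bar>y t\<bar>))\<^sup>2"
    using nn by (intro power_mono) auto
  also have "\<dots> \<le> K ^ 6 * \<epsilon> ^ 4 * (D * B)"
    using csuy K_pos by (auto simp: power_mult_distrib intro!: mult_left_mono)
  finally have N1: "(A + B)\<^sup>2 \<le> K ^ 6 * \<epsilon> ^ 4 * (D * B)" .
  have s_le: "\<bar>Y t / (\<epsilon> * (q t)\<^sup>2)\<bar> \<le> K\<^sup>2 / \<epsilon> * \<bar>Y t\<bar>" if t: "t \<in> {a..b}" for t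
  proof -
    have "\<bar>Y t / (\<epsilon> * (q t)\<^sup>2)\<bar> = \<bar>Y t\<bar> / \<epsilon> * (1 / (q t)\<^sup>2)" using \<epsilon> by (simp add: abs_mult)
    also have "\<dots> \<le> \<bar>Y t\<bar> / \<epsilon> * K\<^sup>2" using s_bounds[OF sub[OF t]] \<epsilon> by (intro mult_left_mono) auto
    finally show ?thesis by (simp add: mult_ac)
  qed
  have Yi: "(\<lambda>t. \<bar>Y t\<bar>) integrable_on {a..b}" by (intro integrable_continuous_real continuous_intros cY)
  \<comment> \<open>Poincare inequality: \<open>y\<close> is the integral of its derivative from \<open>a\<close>.\<close>
  have ysup: "(y t)\<^sup>2 \<le> K ^ 4 / \<epsilon>\<^sup>2 * ((b - a) * A)" if t: "t \<in> {a..b}" for t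
  proof -
    have "\<bar>y t - y a\<bar> \<le> integral {a..b} (\<lambda>t. K\<^sup>2 / \<epsilon> * \<bar>Y t\<bar>)"
      by (rule ac_increment_bound[OF y integrable_on_mult_right[OF Yi] s_le]) (use t ab in auto)
    then have "\<bar>y t\<bar>\<^sup>2 \<le> (K\<^sup>2 / \<epsilon> * integral {a..b} (\<lambda>t. \<bar>Y t\<bar>))\<^sup>2" using y0 by (intro power_mono) auto
    moreover have "(integral {a..b} (\<lambda>t. \<bar>Y t\<bar> * \<bar>1::real\<bar>))\<^sup>2 \<le> A * integral {a..b} (\<lambda>t. 1\<^sup>2)"
      unfolding A_def by (rule Cauchy_Schwarz_integral[OF cY]) simp
    then have "(integral {a..b} (\<lambda>t. \<bar>Y t\<bar>))\<^sup>2 \<le> (b - a) * A" using ab by (simp add: mult.commute)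
    then have "K ^ 4 / \<epsilon>\<^sup>2 * (integral {a..b} (\<lambda>t. \<bar>Y t\<bar>))\<^sup>2 \<le> K ^ 4 / \<epsilon>\<^sup>2 * ((b - a) * A)"
      by (intro mult_left_mono) auto
    ultimately show ?thesis by (simp add: power_mult_distrib power_divide)
  qed
  have "B \<le> integral {a..b} (\<lambda>t. K ^ 4 / \<epsilon>\<^sup>2 * ((b - a) * A))"
    unfolding B_def by (rule integral_le[OF ints(2)]) (use ysup in auto)
  then have P: "B \<le> K ^ 4 / \<epsilon>\<^sup>2 * (b - a)\<^sup>2 * A" using ab by (simp add: power2_eq_square mult_ac)
  have P2: "B \<le> K ^ 4 * \<mu>\<^sup>2 / \<epsilon>\<^sup>2 * (A + B)"
  proof (cases "\<epsilon> \<le> b - a")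
    case True
    have "1 * (A + B) \<le> K ^ 4 * (A + B)" using K_ge nn by (intro mult_right_mono) auto
    then show ?thesis using True \<mu> \<epsilon> nn by simp
  next
    case False
    have "K ^ 4 / \<epsilon>\<^sup>2 * (b - a)\<^sup>2 * A \<le> K ^ 4 / \<epsilon>\<^sup>2 * (b - a)\<^sup>2 * (A + B)" using nn by (intro mult_left_mono) auto
    then show ?thesis using P False \<mu> by simp
  qed
  have N: "A + B \<le> K ^ 10 * \<epsilon>\<^sup>2 * \<mu>\<^sup>2 * D"
  proof (rule square_le_mult_imp_le)
    have "K ^ 6 * \<epsilon> ^ 4 * (D * B) \<le> K ^ 6 * \<epsilon> ^ 4 * (D * (K ^ 4 * \<mu>\<^sup>2 / \<epsilon>\<^sup>2 * (A + B)))"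
      using P2 nn by (intro mult_left_mono) auto
    also have "\<dots> = K ^ 10 * \<epsilon>\<^sup>2 * \<mu>\<^sup>2 * D * (A + B)"
    proof -
      have "k * (e * e) * (D * (k' * x / e * z)) = k * k' * e * x * D * z" if "e \<noteq> 0" for k k' e x z :: real
        using that by (simp add: field_simps)
      from this[of "\<epsilon>\<^sup>2" "K ^ 6" "K ^ 4" "\<mu>\<^sup>2" "A + B"] show ?thesis
        using \<epsilon> by (simp flip: power_add)
    qed
    finally show "(A + B)\<^sup>2 \<le> K ^ 10 * \<epsilon>\<^sup>2 * \<mu>\<^sup>2 * D * (A + B)" using N1 by simp
  qed (use nn in auto)
  then show A: "integral {a..b} (\<lambda>t. (Y t)\<^sup>2) \<le> K ^ 10 * \<epsilon>\<^sup>2 * \<mu>\<^sup>2 * D"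
    using nn unfolding A_def by simp
  have "B \<le> K ^ 4 * \<mu>\<^sup>2 / \<epsilon>\<^sup>2 * (K ^ 10 * \<epsilon>\<^sup>2 * \<mu>\<^sup>2 * D)"
    using P2 mult_left_mono[OF N, of "K ^ 4 * \<mu>\<^sup>2 / \<epsilon>\<^sup>2"] by simp
  also have "\<dots> = K ^ 14 * \<mu> ^ 4 * D"
  proof -
    have "K ^ 4 * (\<mu>\<^sup>2 * (K ^ 10 * \<mu>\<^sup>2)) = K ^ 14 * \<mu> ^ 4" by (simp add: eval_nat_numeral mult_ac)
    then show ?thesis using \<epsilon> by simp
  qed
  finally have B: "B \<le> K ^ 14 * \<mu> ^ 4 * D" .
  then show "integral {a..b} (\<lambda>t. (y t)\<^sup>2) \<le> K ^ 14 * \<mu> ^ 4 * D" by (simp add: B_def)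
  have Ay: "A \<le> K ^ 10 * \<epsilon>\<^sup>2 * \<mu>\<^sup>2 * D" using A by (simp add: A_def)
  have YyI: "integral {a..b} (\<lambda>t. \<bar>Y t\<bar> * \<bar>y t\<bar>) \<le> K ^ 12 * \<epsilon> * \<mu> ^ 3 * D"
  proof (rule power2_le_imp_le)
    have "A * B \<le> (K ^ 10 * \<epsilon>\<^sup>2 * \<mu>\<^sup>2 * D) * (K ^ 14 * \<mu> ^ 4 * D)"
      using Ay B nn by (intro mult_mono) auto
    also have "\<dots> = (K ^ 12 * \<epsilon> * \<mu> ^ 3 * D)\<^sup>2"
      by (simp add: eval_nat_numeral mult_ac)
    finally show "(integral {a..b} (\<lambda>t. \<bar>Y t\<bar> * \<bar>y t\<bar>))\<^sup>2 \<le> (K ^ 12 * \<epsilon> * \<mu> ^ 3 * D)\<^sup>2"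
      using csYy by simp
    show "0 \<le> K ^ 12 * \<epsilon> * \<mu> ^ 3 * D" using nn \<epsilon> \<mu>0 by simp
  qed
  have YuI: "integral {a..b} (\<lambda>t. \<bar>Y t\<bar> * \<bar>u t\<bar>) \<le> K ^ 5 * \<epsilon> * \<mu> * D"
  proof (rule power2_le_imp_le)
    have "A * D \<le> (K ^ 10 * \<epsilon>\<^sup>2 * \<mu>\<^sup>2 * D) * D"
      using Ay nn by (intro mult_mono) auto
    also have "\<dots> = (K ^ 5 * \<epsilon> * \<mu> * D)\<^sup>2"
      by (simp add: eval_nat_numeral mult_ac)
    finally show "(integral {a..b} (\<lambda>t. \<bar>Y t\<bar> * \<bar>u t\<bar>))\<^sup>2 \<le> (K ^ 5 * \<epsilon> * \<mu> * D)\<^sup>2"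
      using csYu by simp
    show "0 \<le> K ^ 5 * \<epsilon> * \<mu> * D" using nn \<epsilon> \<mu>0 K_pos by simp
  qed
  show "(y t)\<^sup>2 \<le> 2 * K ^ 14 * \<mu> ^ 3 * D" if t: "t \<in> {a..b}" for t
  proof -
    have "\<bar>y t * y t - y a * y a\<bar> \<le> integral {a..b} (\<lambda>t. 2 * K\<^sup>2 / \<epsilon> * (\<bar>Y t\<bar> * \<bar>y t\<bar>))"
    proof (rule ac_increment_bound[OF ac_mult[OF y y] integrable_on_mult_right[OF i2(1)]])
      fix t assume t: "t \<in> {a..b}"
      have "\<bar>v * z + z * v\<bar> = 2 * (\<bar>v\<bar> * \<bar>z\<bar>)" for v z :: real
        using abs_mult[of 2 "v * z"] abs_mult[of v z] by (simp add: mult.commute)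
      then have "\<bar>Y t / (\<epsilon> * (q t)\<^sup>2) * y t + y t * (Y t / (\<epsilon> * (q t)\<^sup>2))\<bar> = 2 * (\<bar>Y t / (\<epsilon> * (q t)\<^sup>2)\<bar> * \<bar>y t\<bar>)"
        by blast
      also have "\<dots> \<le> 2 * (K\<^sup>2 / \<epsilon> * \<bar>Y t\<bar> * \<bar>y t\<bar>)" using s_le[OF t] by (intro mult_left_mono mult_right_mono) auto
      finally show "\<bar>Y t / (\<epsilon> * (q t)\<^sup>2) * y t + y t * (Y t / (\<epsilon> * (q t)\<^sup>2))\<bar> \<le> 2 * K\<^sup>2 / \<epsilon> * (\<bar>Y t\<bar> * \<bar>y t\<bar>)"
        by (simp add: mult_ac)
    qed (use t ab in auto)
    then have "(y t)\<^sup>2 \<le> 2 * K\<^sup>2 / \<epsilon> * integral {a..b} (\<lambda>t. \<bar>Y t\<bar> * \<bar>y t\<bar>)"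
      using y0 by (simp add: power2_eq_square)
    also have "\<dots> \<le> 2 * K\<^sup>2 / \<epsilon> * (K ^ 12 * \<epsilon> * \<mu> ^ 3 * D)"
      using YyI \<epsilon> by (intro mult_left_mono) auto
    also have "\<dots> = 2 * K ^ 14 * \<mu> ^ 3 * D"
    proof -
      have "K ^ 14 = K\<^sup>2 * K ^ 12" by (simp flip: power_add)
      then show ?thesis using \<epsilon> by simp
    qed
    finally show ?thesis .
  qed
  show "(Y t)\<^sup>2 \<le> 5 * K ^ 14 * \<epsilon>\<^sup>2 * \<mu> * D" if t: "t \<in> {a..b}" for t
  proof -
    define X where "X = 4 * K ^ 14 * \<epsilon>\<^sup>2 * \<mu> * D"
    \<comment> \<open>\<open>Y\<close> has no boundary values; the increments are compared with the mean of \<open>Y\<^sup>2\<close> instead.\<close>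
    have inc: "(Y t)\<^sup>2 \<le> (Y s)\<^sup>2 + X" if s: "s \<in> {a..b}" for s
    proof -
      let ?G = "\<lambda>t. 2 * K\<^sup>2 / \<epsilon> * (\<bar>Y t\<bar> * \<bar>y t\<bar>) + 2 * \<epsilon> * K * (\<bar>Y t\<bar> * \<bar>u t\<bar>)"
      have Gi: "?G integrable_on {a..b}" by (intro integrable_add integrable_on_mult_right i2)
      have "\<bar>Y t * Y t - Y s * Y s\<bar> \<le> integral {a..b} ?G"
      proof (rule ac_increment_bound[OF ac_mult[OF Y Y] Gi _ s t])
        fix t assume t: "t \<in> {a..b}"
        have "\<bar>y t / (\<epsilon> * (q t)\<^sup>2)\<bar> = \<bar>y t\<bar> / \<epsilon> * (1 / (q t)\<^sup>2)" using \<epsilon> by (simp add: abs_mult)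
        also have "\<dots> \<le> \<bar>y t\<bar> / \<epsilon> * K\<^sup>2" using s_bounds[OF sub[OF t]] \<epsilon> by (intro mult_left_mono) auto
        finally have 1: "\<bar>y t / (\<epsilon> * (q t)\<^sup>2)\<bar> \<le> \<bar>y t\<bar> / \<epsilon> * K\<^sup>2" .
        have "\<bar>\<epsilon> * q2 t * u t\<bar> = \<epsilon> * (\<bar>q2 t\<bar> * \<bar>u t\<bar>)" using \<epsilon> by (simp add: abs_mult)
        also have "\<dots> \<le> \<epsilon> * (K * \<bar>u t\<bar>)"
          using q_bounds[OF sub[OF t]] \<epsilon> by (intro mult_left_mono mult_right_mono) auto
        finally have "\<bar>y t / (\<epsilon> * (q t)\<^sup>2) - \<epsilon> * q2 t * u t\<bar> \<le> \<bar>y t\<bar> / \<epsilon> * K\<^sup>2 + \<epsilon> * (K * \<bar>u t\<bar>)"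
          using 1 by linarith
        then have "2 * \<bar>Y t\<bar> * \<bar>y t / (\<epsilon> * (q t)\<^sup>2) - \<epsilon> * q2 t * u t\<bar> \<le> 2 * \<bar>Y t\<bar> * (\<bar>y t\<bar> / \<epsilon> * K\<^sup>2 + \<epsilon> * (K * \<bar>u t\<bar>))"
          by (intro mult_left_mono) auto
        moreover have "(y t / (\<epsilon> * (q t)\<^sup>2) - \<epsilon> * q2 t * u t) * Y t + Y t * (y t / (\<epsilon> * (q t)\<^sup>2) - \<epsilon> * q2 t * u t)
            = 2 * (Y t * (y t / (\<epsilon> * (q t)\<^sup>2) - \<epsilon> * q2 t * u t))" by simp
        ultimately show "\<bar>(y t / (\<epsilon> * (q t)\<^sup>2) - \<epsilon> * q2 t * u t) * Y t + Y t * (y t / (\<epsilon> * (q t)\<^sup>2) - \<epsilon> * q2 t * u t)\<bar> \<le> ?G t"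
          by (simp only: abs_mult) (simp add: algebra_simps)
      qed
      also have "integral {a..b} ?G = 2 * K\<^sup>2 / \<epsilon> * integral {a..b} (\<lambda>t. \<bar>Y t\<bar> * \<bar>y t\<bar>) + 2 * \<epsilon> * K * integral {a..b} (\<lambda>t. \<bar>Y t\<bar> * \<bar>u t\<bar>)"
        using HK_integral_add[OF integrable_on_mult_right[OF i2(1)] integrable_on_mult_right[OF i2(3)], of "2 * K\<^sup>2 / \<epsilon>" "2 * \<epsilon> * K"] by simp
      also have "\<dots> \<le> 2 * K\<^sup>2 / \<epsilon> * (K ^ 12 * \<epsilon> * \<mu> ^ 3 * D) + 2 * \<epsilon> * K * (K ^ 5 * \<epsilon> * \<mu> * D)"
        using YyI YuI \<epsilon> K_pos by (intro add_mono mult_left_mono) auto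
      also have "\<dots> = 2 * K ^ 14 * \<mu>\<^sup>2 * (\<mu> * D) + 2 * K ^ 6 * \<epsilon>\<^sup>2 * (\<mu> * D)"
      proof -
        have "K ^ 14 = K\<^sup>2 * K ^ 12" "K ^ 6 = K * K ^ 5" by (simp_all add: eval_nat_numeral)
        then show ?thesis using \<epsilon> by (simp add: power2_eq_square power3_eq_cube)
      qed
      also have "\<dots> \<le> 2 * K ^ 14 * \<epsilon>\<^sup>2 * (\<mu> * D) + 2 * K ^ 14 * \<epsilon>\<^sup>2 * (\<mu> * D)"
        using \<mu>0 nn K_ge power_increasing[of 6 14 K] K_pos
        by (intro add_mono mult_right_mono mult_left_mono power_mono) auto
      finally show ?thesis by (simp add: X_def power2_eq_square mult_ac)
    qed
    have "(b - a) * (Y t)\<^sup>2 \<le> A + (b - a) * X"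
      unfolding A_def by (rule average_bound[OF ab(2) ints(1) inc])
    also have "A \<le> (b - a) * (K ^ 14 * \<epsilon>\<^sup>2 * \<mu> * D)"
    proof -
      have "K ^ 10 * \<epsilon>\<^sup>2 * \<mu>\<^sup>2 * D = K ^ 10 * (\<epsilon>\<^sup>2 * \<mu> * D * \<mu>)" by (simp add: power2_eq_square)
      also have "\<dots> \<le> K ^ 14 * (\<epsilon>\<^sup>2 * \<mu> * D * (b - a))"
        by (rule mult_mono[OF power_increasing mult_left_mono]) (use \<mu>0 nn K_ge in auto)
      finally show ?thesis using Ay by (simp add: mult_ac)
    qed
    finally have "(b - a) * (Y t)\<^sup>2 \<le> (b - a) * (5 * K ^ 14 * \<epsilon>\<^sup>2 * \<mu> * D)"
      by (simp add: X_def algebra_simps)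
    then show ?thesis using ab by simp
  qed
qed

text \<open>The interpolation error \<open>\<eta>\<close> of \<open>u\<close> satisfies the stated equation because its discrete part
satisfies the WKB equation. In terms of \<open>y = \<eta> / q\<close> and
\<open>Y = \<epsilon> * (q * \<eta>1 - q1 * \<eta>)\<close> the defect \<open>r\<close> acts on \<open>u\<close> alone and not on the
interpolant, so the bound needs nothing but the norm of \<open>u\<close> on the cell.\<close>

lemma cell_interpolation_estimates:
  assumes \<epsilon>: "0 < \<epsilon>" "\<epsilon> < 1" and ab: "0 \<le> a" "a < b" "b \<le> d"
    and u: "continuous_on {a..b} u"
    and \<eta>: "ac a b \<eta> \<eta>1" and \<eta>1: "ac a b \<eta>1 (\<lambda>t. p t / \<epsilon>\<^sup>2 * \<eta> t - r t * (u t - \<eta> t))"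
    and \<eta>0: "\<eta> a = 0" "\<eta> b = 0"
    and \<mu>: "\<mu> = min \<epsilon> (b - a)" and D: "D = integral {a..b} (\<lambda>t. (u t)\<^sup>2)"
  shows "integral {a..b} (\<lambda>t. (\<eta> t)\<^sup>2) \<le> K ^ 16 * \<mu> ^ 4 * D"
    and "integral {a..b} (\<lambda>t. (\<epsilon> * \<eta>1 t)\<^sup>2) \<le> 4 * K ^ 16 * \<epsilon>\<^sup>2 * \<mu>\<^sup>2 * D"
    and "\<And>t. t \<in> {a..b} \<Longrightarrow> (\<eta> t)\<^sup>2 \<le> 2 * K ^ 16 * \<mu> ^ 3 * D"
    and "\<And>t. t \<in> {a..b} \<Longrightarrow> (\<epsilon> * \<eta>1 t)\<^sup>2 \<le> 14 * K ^ 16 * \<epsilon>\<^sup>2 * \<mu> * D"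
proof -
  define y where "y = (\<lambda>t. \<eta> t * (1 / q t))"
  define Y where "Y = (\<lambda>t. \<epsilon> * (q t * \<eta>1 t - q1 t * \<eta> t))"
  have sub: "t \<in> {0..d}" if "t \<in> {a..b}" for t using that ab by auto
  have qn: "q t \<noteq> 0" if "t \<in> {a..b}" for t using q_pos[OF sub[OF that]] by simp
  note aq = ac_subinterval[OF ac_q ab(1,3)] and aq1 = ac_subinterval[OF ac_q1 ab(1,3)]
    and aiq = ac_subinterval[OF ac_inverse_q ab(1,3)]
  have y: "ac a b y (\<lambda>t. Y t / (\<epsilon> * (q t)\<^sup>2))"
    unfolding y_def
    by (rule ac_cong[OF ac_mult[OF \<eta> aiq]]) (use qn \<epsilon> in \<open>auto simp: Y_def field_simps power2_eq_square\<close>)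
  have Y: "ac a b Y (\<lambda>t. y t / (\<epsilon> * (q t)\<^sup>2) - \<epsilon> * q2 t * u t)"
    unfolding Y_def
  proof (rule ac_cong[OF ac_cmult[OF ac_diff[OF ac_mult[OF aq \<eta>1] ac_mult[OF aq1 \<eta>]], of \<epsilon>]])
    fix t assume t: "t \<in> {a..b}"
    show "\<epsilon> * (q1 t * \<eta>1 t + q t * (p t / \<epsilon>\<^sup>2 * \<eta> t - r t * (u t - \<eta> t)) - (q2 t * \<eta> t + q1 t * \<eta>1 t)) =
         y t / (\<epsilon> * (q t)\<^sup>2) - \<epsilon> * q2 t * u t"
      using qn[OF t] \<epsilon> by (simp add: y_def p_def r_def field_simps power2_eq_square power4_eq_xxxx)
  qed simp
  have y0: "y a = 0" "y b = 0" using \<eta>0 by (simp_all add: y_def)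
  note E = cell_transformed_estimates[OF \<epsilon>(1) ab u y Y y0 \<mu> D]
  note cy = ac_continuous[OF y] and cY = ac_continuous[OF Y]
  have ints: "(\<lambda>t. (Y t)\<^sup>2) integrable_on {a..b}" "(\<lambda>t. (y t)\<^sup>2) integrable_on {a..b}" "(\<lambda>t. (u t)\<^sup>2) integrable_on {a..b}"
      "(\<lambda>t. (\<eta> t)\<^sup>2) integrable_on {a..b}" "(\<lambda>t. (\<epsilon> * \<eta>1 t)\<^sup>2) integrable_on {a..b}"
    by (intro integrable_continuous_real continuous_intros cy cY u ac_continuous[OF \<eta>] ac_continuous[OF \<eta>1])+
  have D0: "0 \<le> D" unfolding D using ints by (auto intro!: integral_nonneg)
  have \<mu>0: "0 < \<mu>" "\<mu> < 1" using \<mu> \<epsilon> ab by auto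
  have \<eta>y: "(\<eta> t)\<^sup>2 \<le> K\<^sup>2 * (y t)\<^sup>2" if t: "t \<in> {a..b}" for t
  proof -
    have "\<eta> t = q t * y t" using qn[OF t] by (simp add: y_def)
    then have "(\<eta> t)\<^sup>2 = (q t)\<^sup>2 * (y t)\<^sup>2" by (simp add: power_mult_distrib)
    also have "\<dots> \<le> K\<^sup>2 * (y t)\<^sup>2"
      using q_bounds[OF sub[OF t]] q_pos[OF sub[OF t]] by (intro mult_right_mono power_mono) auto
    finally show ?thesis .
  qed
  have \<eta>1y: "(\<epsilon> * \<eta>1 t)\<^sup>2 \<le> 2 * K\<^sup>2 * (Y t)\<^sup>2 + 2 * K\<^sup>2 * \<epsilon>\<^sup>2 * (y t)\<^sup>2" if t: "t \<in> {a..b}" for t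
  proof -
    have "\<epsilon> * \<eta>1 t = Y t * (1 / q t) + \<epsilon> * q1 t * y t"
      using qn[OF t] by (simp add: y_def Y_def field_simps)
    then have "(\<epsilon> * \<eta>1 t)\<^sup>2 \<le> 2 * (Y t * (1 / q t))\<^sup>2 + 2 * (\<epsilon> * q1 t * y t)\<^sup>2"
      using sum_squares_bound[of "Y t * (1 / q t)" "\<epsilon> * q1 t * y t"] by (simp add: power2_sum)
    also have "(Y t * (1 / q t))\<^sup>2 \<le> K\<^sup>2 * (Y t)\<^sup>2"
      using s_bounds[OF sub[OF t]] mult_right_mono[of "1 / (q t)\<^sup>2" "K\<^sup>2" "(Y t)\<^sup>2"]
      by (simp add: power_mult_distrib power_divide)
    also have "(\<epsilon> * q1 t * y t)\<^sup>2 \<le> K\<^sup>2 * (\<epsilon>\<^sup>2 * (y t)\<^sup>2)"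
    proof -
      have "(q1 t)\<^sup>2 \<le> K\<^sup>2" using q_bounds[OF sub[OF t]] K_pos by (intro abs_le_square_iff[THEN iffD1]) auto
      then have "(q1 t)\<^sup>2 * (\<epsilon>\<^sup>2 * (y t)\<^sup>2) \<le> K\<^sup>2 * (\<epsilon>\<^sup>2 * (y t)\<^sup>2)" by (intro mult_right_mono) auto
      then show ?thesis by (simp add: power_mult_distrib mult_ac)
    qed
    finally show ?thesis by (simp add: mult_ac)
  qed
  have "integral {a..b} (\<lambda>t. (\<eta> t)\<^sup>2) \<le> integral {a..b} (\<lambda>t. K\<^sup>2 * (y t)\<^sup>2)"
    by (intro integral_le ints integrable_on_mult_right) (use \<eta>y in auto)
  also have "\<dots> \<le> K\<^sup>2 * (K ^ 14 * \<mu> ^ 4 * D)" using E(2) by (simp add: mult_left_mono)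
  finally show "integral {a..b} (\<lambda>t. (\<eta> t)\<^sup>2) \<le> K ^ 16 * \<mu> ^ 4 * D"
    by (simp only: mult.assoc[symmetric] power_add[symmetric]) simp
  have "integral {a..b} (\<lambda>t. (\<epsilon> * \<eta>1 t)\<^sup>2) \<le> integral {a..b} (\<lambda>t. 2 * K\<^sup>2 * (Y t)\<^sup>2 + 2 * K\<^sup>2 * \<epsilon>\<^sup>2 * (y t)\<^sup>2)"
    by (intro integral_le ints integrable_on_mult_right integrable_add) (use \<eta>1y in auto)
  also have "\<dots> = 2 * K\<^sup>2 * integral {a..b} (\<lambda>t. (Y t)\<^sup>2) + 2 * K\<^sup>2 * \<epsilon>\<^sup>2 * integral {a..b} (\<lambda>t. (y t)\<^sup>2)"
    using HK_integral_add[OF integrable_on_mult_right[OF ints(1)] integrable_on_mult_right[OF ints(2)], of "2 * K\<^sup>2" "2 * K\<^sup>2 * \<epsilon>\<^sup>2"] by simp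
  also have "\<dots> \<le> 2 * K\<^sup>2 * (K ^ 14 * \<epsilon>\<^sup>2 * \<mu>\<^sup>2 * D) + 2 * K\<^sup>2 * \<epsilon>\<^sup>2 * (K ^ 14 * (\<mu>\<^sup>2 * D))"
  proof (intro add_mono mult_left_mono)
    show "integral {a..b} (\<lambda>t. (Y t)\<^sup>2) \<le> K ^ 14 * \<epsilon>\<^sup>2 * \<mu>\<^sup>2 * D"
      using E(1) mult_right_mono[OF power_increasing[of 10 14 K], of "\<epsilon>\<^sup>2 * \<mu>\<^sup>2 * D"] K_ge D0
      by (simp add: mult_ac)
    have "\<mu> ^ 4 * D \<le> \<mu>\<^sup>2 * D" using \<mu>0 D0 by (intro mult_right_mono power_decreasing) auto
    then show "integral {a..b} (\<lambda>t. (y t)\<^sup>2) \<le> K ^ 14 * (\<mu>\<^sup>2 * D)"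
      using E(2) mult_left_mono[of "\<mu> ^ 4 * D" "\<mu>\<^sup>2 * D" "K ^ 14"] K_pos by (simp add: mult_ac)
  qed (use K_pos in auto)
  also have "\<dots> = 4 * K ^ 16 * \<epsilon>\<^sup>2 * \<mu>\<^sup>2 * D" by (simp add: eval_nat_numeral mult_ac)
  finally show "integral {a..b} (\<lambda>t. (\<epsilon> * \<eta>1 t)\<^sup>2) \<le> 4 * K ^ 16 * \<epsilon>\<^sup>2 * \<mu>\<^sup>2 * D" .
  show "(\<eta> t)\<^sup>2 \<le> 2 * K ^ 16 * \<mu> ^ 3 * D" if t: "t \<in> {a..b}" for t
  proof -
    have "(\<eta> t)\<^sup>2 \<le> K\<^sup>2 * (2 * K ^ 14 * \<mu> ^ 3 * D)"
      using \<eta>y[OF t] mult_left_mono[OF E(3)[OF t], of "K\<^sup>2"] by simp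
    also have "\<dots> = 2 * K ^ 16 * \<mu> ^ 3 * D" by (simp add: eval_nat_numeral mult_ac)
    finally show ?thesis .
  qed
  show "(\<epsilon> * \<eta>1 t)\<^sup>2 \<le> 14 * K ^ 16 * \<epsilon>\<^sup>2 * \<mu> * D" if t: "t \<in> {a..b}" for t
  proof -
    have "2 * K\<^sup>2 * (Y t)\<^sup>2 \<le> 2 * K\<^sup>2 * (5 * K ^ 14 * \<epsilon>\<^sup>2 * \<mu> * D)" using E(4)[OF t] by (intro mult_left_mono) auto
    moreover have "2 * K\<^sup>2 * \<epsilon>\<^sup>2 * (y t)\<^sup>2 \<le> 2 * K\<^sup>2 * \<epsilon>\<^sup>2 * (2 * K ^ 14 * (\<mu> * D))"
    proof (rule mult_left_mono)
      have "\<mu> ^ 3 * D \<le> \<mu> ^ 1 * D" using \<mu>0 D0 by (intro mult_right_mono power_decreasing) auto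
      then show "(y t)\<^sup>2 \<le> 2 * K ^ 14 * (\<mu> * D)"
        using E(3)[OF t] mult_left_mono[of "\<mu> ^ 3 * D" "\<mu> * D" "2 * K ^ 14"] K_pos by (simp add: mult_ac)
    qed simp
    ultimately have "(\<epsilon> * \<eta>1 t)\<^sup>2 \<le> 2 * K\<^sup>2 * (5 * K ^ 14 * \<epsilon>\<^sup>2 * \<mu> * D) + 2 * K\<^sup>2 * \<epsilon>\<^sup>2 * (2 * K ^ 14 * (\<mu> * D))"
      using \<eta>1y[OF t] by linarith
    also have "\<dots> = 14 * K ^ 16 * \<epsilon>\<^sup>2 * \<mu> * D" by (simp add: eval_nat_numeral mult_ac)
    finally show ?thesis .
  qed
qed

text \<open>A trace inequality: the derivative of \<open>u\<^sup>2\<close> is bounded by the energy density over \<open>\<epsilon>\<close>, and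
some value of \<open>u\<^sup>2\<close> is at most its mean.\<close>

lemma sup_energy_bound:
  assumes \<epsilon>: "0 < \<epsilon>" "\<epsilon> < 1" and u: "ac 0 d u u1" and i: "(\<lambda>t. (u1 t)\<^sup>2) integrable_on {0..d}" and t: "t \<in> {0..d}"
  shows "(u t)\<^sup>2 \<le> 2 * K / \<epsilon> * (integral {0..d} (\<lambda>t. (u t)\<^sup>2) + \<epsilon>\<^sup>2 * integral {0..d} (\<lambda>t. (u1 t)\<^sup>2))"
proof -
  have ui: "(\<lambda>t. (u t)\<^sup>2) integrable_on {0..d}"
    by (intro integrable_continuous_real continuous_intros ac_continuous[OF u])
  define X where "X = integral {0..d} (\<lambda>t. (u t)\<^sup>2) + \<epsilon>\<^sup>2 * integral {0..d} (\<lambda>t. (u1 t)\<^sup>2)"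
  have i0: "0 \<le> integral {0..d} (\<lambda>t. (u t)\<^sup>2)" "0 \<le> integral {0..d} (\<lambda>t. (u1 t)\<^sup>2)"
    using ui i by (auto intro: integral_nonneg)
  have gi: "(\<lambda>t. (u t)\<^sup>2 + \<epsilon>\<^sup>2 * (u1 t)\<^sup>2) integrable_on {0..d}"
    by (intro integrable_add ui integrable_on_mult_right i)
  have inc: "(u t)\<^sup>2 \<le> (u s)\<^sup>2 + X / \<epsilon>" if s: "s \<in> {0..d}" for s
  proof -
    have "\<bar>u t * u t - u s * u s\<bar> \<le> integral {0..d} (\<lambda>t. ((u t)\<^sup>2 + \<epsilon>\<^sup>2 * (u1 t)\<^sup>2) / \<epsilon>)"
    proof (rule ac_increment_bound[OF ac_mult[OF u u] integrable_on_divide[OF gi] _ s t])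
      fix t
      have "2 * \<bar>u t\<bar> * \<bar>\<epsilon> * u1 t\<bar> \<le> (u t)\<^sup>2 + \<epsilon>\<^sup>2 * (u1 t)\<^sup>2"
        using sum_squares_bound[of "\<bar>u t\<bar>" "\<bar>\<epsilon> * u1 t\<bar>"] by (simp add: power_mult_distrib)
      then show "\<bar>u1 t * u t + u t * u1 t\<bar> \<le> ((u t)\<^sup>2 + \<epsilon>\<^sup>2 * (u1 t)\<^sup>2) / \<epsilon>"
        using \<epsilon> by (simp add: pos_le_divide_eq abs_mult mult_ac)
    qed
    also have "\<dots> = X / \<epsilon>"
      unfolding X_def using HK_integral_add[OF ui integrable_on_mult_right[OF i]] by simp
    finally show ?thesis by (simp add: power2_eq_square)
  qed
  have "(d - 0) * (u t)\<^sup>2 \<le> integral {0..d} (\<lambda>t. (u t)\<^sup>2) + (d - 0) * (X / \<epsilon>)"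
    by (rule average_bound[OF d_pos ui inc])
  then have "(u t)\<^sup>2 \<le> integral {0..d} (\<lambda>t. (u t)\<^sup>2) / d + X / \<epsilon>"
    using d_pos by (simp add: field_simps)
  also have "integral {0..d} (\<lambda>t. (u t)\<^sup>2) / d \<le> X * K"
    using K_d i0 mult_mono[of "integral {0..d} (\<lambda>t. (u t)\<^sup>2)" X "1 / d" K] d_pos by (simp add: X_def)
  also have "X * K \<le> X * K / \<epsilon>"
    using \<epsilon> i0 K_pos by (simp add: X_def pos_le_divide_eq mult_left_le)
  also have "X / \<epsilon> \<le> X * K / \<epsilon>"
    using \<epsilon> i0 K_ge by (intro divide_right_mono) (auto simp: X_def intro: mult_left_mono[of 1 K, simplified])
  finally show ?thesis by (simp add: X_def mult_ac)
qed

text \<open>Testing the equation with \<open>u\<close> bounds the energy by \<open>\<epsilon> * \<bar>u d\<bar>\<close>, and the trace inequality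
bounds \<open>(u d)\<^sup>2\<close> by the energy over \<open>\<epsilon>\<close>. Together they give an energy of order
\<open>\<epsilon>\<close>, which reflects the boundary layer of width \<open>\<epsilon>\<close> at \<open>d\<close>, and bounded values.\<close>

lemma exact_solution_bounds:
  assumes \<epsilon>: "0 < \<epsilon>" "\<epsilon> < 1" and u: "ac 0 d u u1" and u1: "ac 0 d u1 (\<lambda>t. p t / \<epsilon>\<^sup>2 * u t)"
    and bc: "\<epsilon> * u1 0 = \<kappa> * u 0" "\<epsilon> * u1 d = l" and \<kappa>: "0 \<le> \<kappa>" and l: "\<bar>l\<bar> \<le> 1"
  shows "integral {0..d} (\<lambda>t. (u t)\<^sup>2) \<le> 2 * K ^ 9 * \<epsilon>"
    and "\<And>t. t \<in> {0..d} \<Longrightarrow> (u t)\<^sup>2 \<le> 4 * K ^ 10"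
proof -
  note cu = ac_continuous[OF u] and cu1 = ac_continuous[OF u1]
  have ui: "(\<lambda>t. (u t)\<^sup>2) integrable_on {0..d}" and u1i: "(\<lambda>t. (u1 t)\<^sup>2) integrable_on {0..d}"
    by (intro integrable_continuous_real continuous_intros cu cu1)+
  define X where "X = integral {0..d} (\<lambda>t. (u t)\<^sup>2) + \<epsilon>\<^sup>2 * integral {0..d} (\<lambda>t. (u1 t)\<^sup>2)"
  have i0: "0 \<le> integral {0..d} (\<lambda>t. (u t)\<^sup>2)" "0 \<le> integral {0..d} (\<lambda>t. (u1 t)\<^sup>2)"
    using ui u1i by (auto intro: integral_nonneg)
  then have X0: "0 \<le> X" by (simp add: X_def)
  have "X / K ^ 4 = integral {0..d} (\<lambda>t. ((u t)\<^sup>2 + \<epsilon>\<^sup>2 * (u1 t)\<^sup>2) / K ^ 4)"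
    unfolding X_def using HK_integral_add[OF ui integrable_on_mult_right[OF u1i]] by simp
  also have "\<dots> \<le> integral {0..d} (\<lambda>t. \<epsilon>\<^sup>2 * (u1 t * u1 t + u t * (p t / \<epsilon>\<^sup>2 * u t)))"
  proof (intro integral_le integrable_on_divide integrable_add ui integrable_on_mult_right u1i)
    show "(\<lambda>t. u1 t * u1 t) integrable_on {0..d}" using u1i by (simp add: power2_eq_square)
    show "(\<lambda>t. u t * (p t / \<epsilon>\<^sup>2 * u t)) integrable_on {0..d}"
      by (rule abs_int_integrable[OF abs_int_mult_continuous(2)[OF ac_integrable[OF u1] cu]])
    fix t assume t: "t \<in> {0..d}"
    have "(u t)\<^sup>2 * (1 / K ^ 4) \<le> (u t)\<^sup>2 * p t" using p_bounds[OF t] by (intro mult_left_mono) auto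
    moreover have "\<epsilon>\<^sup>2 * (u1 t)\<^sup>2 * (1 / K ^ 4) \<le> \<epsilon>\<^sup>2 * (u1 t)\<^sup>2 * 1"
      using K_ge by (intro mult_left_mono) auto
    ultimately have "((u t)\<^sup>2 + \<epsilon>\<^sup>2 * (u1 t)\<^sup>2) / K ^ 4 \<le> (u t)\<^sup>2 * p t + \<epsilon>\<^sup>2 * (u1 t)\<^sup>2"
      by (simp add: add_divide_distrib)
    also have "\<dots> = \<epsilon>\<^sup>2 * (u1 t * u1 t + u t * (p t / \<epsilon>\<^sup>2 * u t))"
      using \<epsilon> by (simp add: field_simps power2_eq_square)
    finally show "((u t)\<^sup>2 + \<epsilon>\<^sup>2 * (u1 t)\<^sup>2) / K ^ 4 \<le> \<epsilon>\<^sup>2 * (u1 t * u1 t + u t * (p t / \<epsilon>\<^sup>2 * u t))" .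
  qed
  also have "\<dots> = \<epsilon>\<^sup>2 * (u d * u1 d - u 0 * u1 0)"
    using integral_by_parts_ac[OF u u1] d_pos by simp
  also have "\<dots> = \<epsilon> * (u d * (\<epsilon> * u1 d)) - \<epsilon> * (u 0 * (\<epsilon> * u1 0))"
    by (simp add: power2_eq_square algebra_simps)
  also have "\<dots> = \<epsilon> * (u d * l) - \<epsilon> * (\<kappa> * (u 0)\<^sup>2)"
    unfolding bc by (simp add: power2_eq_square mult_ac)
  also have "\<dots> \<le> \<epsilon> * \<bar>u d\<bar>"
  proof -
    have "u d * l \<le> \<bar>u d\<bar> * 1" 
      using abs_ge_self[of "u d * l"] mult_left_mono[OF l abs_ge_zero[of "u d"]] by (simp add: abs_mult)
    then have "\<epsilon> * (u d * l) \<le> \<epsilon> * \<bar>u d\<bar>" using \<epsilon> by (intro mult_left_mono) auto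
    moreover have "0 \<le> \<epsilon> * (\<kappa> * (u 0)\<^sup>2)" using \<epsilon> \<kappa> by simp
    ultimately show ?thesis by linarith
  qed
  finally have 1: "X \<le> K ^ 4 * (\<epsilon> * \<bar>u d\<bar>)" using K_pos by (simp add: pos_divide_le_eq mult.commute)
  have S: "(u t)\<^sup>2 \<le> 2 * K / \<epsilon> * X" if "t \<in> {0..d}" for t
    unfolding X_def by (rule sup_energy_bound[OF \<epsilon> u u1i that])
  have "X\<^sup>2 \<le> (K ^ 4 * (\<epsilon> * \<bar>u d\<bar>))\<^sup>2" by (rule power_mono[OF 1 X0])
  also have "\<dots> = K ^ 8 * \<epsilon>\<^sup>2 * (u d)\<^sup>2" by (simp add: power_mult_distrib flip: power_mult)
  also have "\<dots> \<le> K ^ 8 * \<epsilon>\<^sup>2 * (2 * K / \<epsilon> * X)" using S[of d] d_pos by (intro mult_left_mono) auto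
  also have "\<dots> = 2 * K ^ 9 * \<epsilon> * X"
  proof -
    have "K ^ 9 = K ^ 8 * K" using power_Suc2[of K 8] by simp
    then show ?thesis using \<epsilon> by (simp add: power2_eq_square)
  qed
  finally have "X\<^sup>2 \<le> 2 * K ^ 9 * \<epsilon> * X" .
  moreover have "0 \<le> 2 * K ^ 9 * \<epsilon>" using \<epsilon> K_pos by simp
  ultimately have X: "X \<le> 2 * K ^ 9 * \<epsilon>" by (intro square_le_mult_imp_le[OF _ X0])
  then show "integral {0..d} (\<lambda>t. (u t)\<^sup>2) \<le> 2 * K ^ 9 * \<epsilon>"
    using mult_nonneg_nonneg[OF zero_le_power2[of \<epsilon>] i0(2)] unfolding X_def by linarith
  fix t assume t: "t \<in> {0..d}"
  have "(u t)\<^sup>2 \<le> 2 * K / \<epsilon> * (2 * K ^ 9 * \<epsilon>)"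
    using S[OF t] mult_left_mono[OF X, of "2 * K / \<epsilon>"] \<epsilon> K_pos by simp
  also have "\<dots> = 4 * K ^ 10"
  proof -
    have "K ^ 10 = K * K ^ 9" using power_Suc[of K 9] by simp
    then show ?thesis using \<epsilon> by simp
  qed
  finally show "(u t)\<^sup>2 \<le> 4 * K ^ 10" .
qed

end

section \<open>The finite element space\<close>

locale wkb_grid = wkb_coefficient +
  fixes \<epsilon> :: real and N :: nat and x :: "nat \<Rightarrow> real"
  assumes eps: "0 < \<epsilon>" "\<epsilon> < 1" and grid: "is_grid d N x"
begin

lemma grid_ends: "2 \<le> N" "x 1 = 0" "x N = d"
  using grid by (auto simp: is_grid_def)

lemma grid_step: "n \<in> {1..<N} \<Longrightarrow> x n < x (n + 1)"
  using grid by (auto simp: is_grid_def)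

lemma grid_mono:
  assumes "1 \<le> m" "m \<le> n" "n \<le> N"
  shows "x m \<le> x n"
  using assms(2,3)
proof (induction n rule: dec_induct)
  case (step n)
  then show ?case using grid_step[of n] assms(1) by simp
qed simp

lemma grid_range: "n \<in> {1..N} \<Longrightarrow> x n \<in> {0..d}"
  using grid_mono[of 1 n] grid_mono[of n N] grid_ends by auto

lemma cell_range:
  assumes "n \<in> {1..<N}"
  shows "0 \<le> x n" "x n < x (n + 1)" "x (n + 1) \<le> d"
  using grid_range[of n] grid_range[of "n + 1"] grid_step[OF assms] assms by auto

lemma cell_subset: "n \<in> {1..<N} \<Longrightarrow> t \<in> {x n..x (n + 1)} \<Longrightarrow> t \<in> {0..d}"
  using cell_range[of n] by auto

abbreviation h :: real where "h \<equiv> mesh_size N x"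

lemma cell_length_le: "n \<in> {1..<N} \<Longrightarrow> x (n + 1) - x n \<le> h"
  unfolding mesh_size_def by (rule Max_ge) auto

lemma mesh_bounds: "0 < h" "h < 1"
proof -
  show "0 < h" using cell_length_le[of 1] grid_step[of 1] grid_ends by auto
  have "h \<in> (\<lambda>n. x (n + 1) - x n) ` {1..<N}"
    unfolding mesh_size_def by (rule Max_in) (use grid_ends in auto)
  then obtain n where n: "n \<in> {1..<N}" "h = x (n + 1) - x n" by auto
  then show "h < 1" using cell_range[OF n(1)] d_less by linarith
qed

lemma integral_cells:
  fixes g :: "real \<Rightarrow> real"
  assumes "g integrable_on {0..d}"
  shows "integral {0..d} g = (\<Sum>n\<in>{1..<N}. integral {x n..x (n + 1)} g)"
proof -
  have "integral {0..x k} g = (\<Sum>n\<in>{1..<k}. integral {x n..x (n + 1)} g)" if "1 \<le> k" "k \<le> N" for k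
    using that
  proof (induction k rule: dec_induct)
    case base
    then show ?case using grid_ends by simp
  next
    case (step k)
    have "integral {0..x k} g + integral {x k..x (k + 1)} g = integral {0..x (k + 1)} g"
      using step cell_range[of k]
      by (intro HK_integral_combine integrable_subinterval_real[OF assms]) auto
    then show ?case using step by simp
  qed
  from this[of N] show ?thesis using grid_ends by simp
qed

text \<open>The function that is \<open>f n\<close> on cell \<open>n\<close>. Cells are taken half-open so that they are disjoint; the value
at the last node is 0, which changes no integral.\<close>

definition pw :: "(nat \<Rightarrow> real \<Rightarrow> real) \<Rightarrow> real \<Rightarrow> real" where
  "pw f t = (\<Sum>n\<in>{1..<N}. if x n \<le> t \<and> t < x (n + 1) then f n t else 0)"

lemma pw_cell:
  assumes n: "n \<in> {1..<N}" and t: "x n \<le> t" "t < x (n + 1)"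
  shows "pw f t = f n t"
proof -
  have "x m \<le> t \<and> t < x (m + 1) \<longleftrightarrow> m = n" if m: "m \<in> {1..<N}" for m
  proof
    assume *: "x m \<le> t \<and> t < x (m + 1)"
    have "\<not> m < n" using grid_mono[of "m + 1" n] m n * t by auto
    moreover have "\<not> n < m" using grid_mono[of "n + 1" m] m n * t by auto
    ultimately show "m = n" by simp
  qed (use t in simp)
  then have "pw f t = (\<Sum>m\<in>{1..<N}. if m = n then f m t else 0)"
    unfolding pw_def by (intro sum.cong) auto
  then show ?thesis using n by (simp add: sum.delta)
qed

lemma cell_cases:
  assumes "0 \<le> t" "t < d"
  obtains n where "n \<in> {1..<N}" "x n \<le> t" "t < x (n + 1)"
proof -
  define n where "n = Max {k \<in> {1..N}. x k \<le> t}"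
  have "1 \<in> {k \<in> {1..N}. x k \<le> t}" using grid_ends assms by auto
  then have n: "n \<in> {k \<in> {1..N}. x k \<le> t}" unfolding n_def by (intro Max_in) auto
  then have "n \<noteq> N" using grid_ends assms by auto
  moreover have "\<not> x (n + 1) \<le> t"
  proof
    assume "x (n + 1) \<le> t"
    then have "n + 1 \<in> {k \<in> {1..N}. x k \<le> t}" using n \<open>n \<noteq> N\<close> by auto
    then have "n + 1 \<le> n" unfolding n_def by (intro Max_ge) auto
    then show False by simp
  qed
  ultimately show ?thesis using n by (intro that[of n]) auto
qed

lemma pw_end: "pw f d = 0"
proof -
  have "\<not> d < x (n + 1)" if "n \<in> {1..<N}" for n using cell_range(3)[OF that] by simp
  then show ?thesis unfolding pw_def by (intro sum.neutral) auto
qed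

lemma pw_in_range:
  assumes "t \<in> {0..d}" "P 0" "\<And>n t. n \<in> {1..<N} \<Longrightarrow> t \<in> {x n..x (n + 1)} \<Longrightarrow> P (f n t)"
  shows "P (pw f t)"
proof (cases "t < d")
  case True
  then obtain n where "n \<in> {1..<N}" "x n \<le> t" "t < x (n + 1)" using assms(1) by (auto elim: cell_cases)
  then show ?thesis using assms(3)[of n t] pw_cell[of n t f] by simp
next
  case False
  then show ?thesis using assms pw_end[of f] by simp
qed

lemma pw_integral_cell:
  assumes "n \<in> {1..<N}"
  shows "integral {x n..x (n + 1)} (pw f) = integral {x n..x (n + 1)} (f n)"
  by (rule integral_spike[of "{x (n + 1)}"]) (use assms pw_cell[of n _ f] in auto)

lemma pw_cell_ac:
  assumes "\<And>n. n \<in> {1..<N} \<Longrightarrow> ac (x n) (x (n + 1)) F (f n)"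
  shows "ac 0 d F (pw f)"
proof -
  have "ac 0 (x k) F (pw f)" if "2 \<le> k" "k \<le> N" for k
    using that
  proof (induction k rule: dec_induct)
    case base
    have "1 \<in> {1..<N}" using base by auto
    from ac_spike[OF assms[OF this], of "{x 2}" "pw f" F] show ?case
      using pw_cell[OF \<open>1 \<in> {1..<N}\<close>] grid_ends by (auto simp: numeral_2_eq_2)
  next
    case (step k)
    then have k: "k \<in> {1..<N}" by auto
    have "ac (x k) (x (k + 1)) F (pw f)"
      by (rule ac_spike[OF assms[OF k], of "{x (k + 1)}"]) (use pw_cell[OF k] in auto)
    then show ?case using ac_combine[of 0 "x k" F "pw f" "x (k + 1)"] step cell_range[OF k] by simp
  qed
  from this[of N] show ?thesis using grid_ends by simp
qed

lemma pw_abs_int: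
  assumes "\<And>n. n \<in> {1..<N} \<Longrightarrow> continuous_on {x n..x (n + 1)} (f n)"
  shows "pw f absolutely_integrable_on {0..d}"
proof -
  have "pw f absolutely_integrable_on {0..x k}" if "1 \<le> k" "k \<le> N" for k
    using that
  proof (induction k rule: dec_induct)
    case base
    have "negligible {0..x 1}" using grid_ends by simp
    then show ?case by (rule absolutely_integrable_negligible)
  next
    case (step k)
    then have k: "k \<in> {1..<N}" by auto
    have "pw f absolutely_integrable_on {x k..x (k + 1)}"
      by (rule absolutely_integrable_spike[OF absolutely_integrable_continuous_real[OF assms[OF k]], of "{x (k + 1)}"])
         (use pw_cell[OF k] in auto)
    moreover have "{0..x k} \<union> {x k..x (k + 1)} = {0..x (k + 1)}" using cell_range[OF k] by auto
    ultimately show ?case using step set_integrable_Un[of lebesgue "{0..x k}" "pw f" "{x k..x (k + 1)}"] by simp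
  qed
  from this[of N] show ?thesis using grid_ends by simp
qed

lemma pw_mult:
  assumes "t \<in> {0..d}"
  shows "pw f t * pw g t = pw (\<lambda>n t. f n t * g n t) t"
proof (cases "t < d")
  case True
  then obtain n where "n \<in> {1..<N}" "x n \<le> t" "t < x (n + 1)" using assms by (auto elim: cell_cases)
  then show ?thesis by (simp add: pw_cell)
next
  case False
  then show ?thesis using assms pw_end by simp
qed

lemma pw_mult_integral:
  assumes f: "\<And>n. n \<in> {1..<N} \<Longrightarrow> continuous_on {x n..x (n + 1)} (f n)"
    and g: "\<And>n. n \<in> {1..<N} \<Longrightarrow> continuous_on {x n..x (n + 1)} (g n)"
  shows "(\<lambda>t. pw f t * pw g t) absolutely_integrable_on {0..d}"
    and "integral {0..d} (\<lambda>t. pw f t * pw g t) = (\<Sum>n\<in>{1..<N}. integral {x n..x (n + 1)} (\<lambda>t. f n t * g n t))"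
proof -
  have i: "pw (\<lambda>n t. f n t * g n t) absolutely_integrable_on {0..d}"
    by (rule pw_abs_int) (intro continuous_intros f g)
  show "(\<lambda>t. pw f t * pw g t) absolutely_integrable_on {0..d}"
    by (rule absolutely_integrable_spike[OF i negligible_empty]) (use pw_mult in auto)
  have "integral {0..d} (\<lambda>t. pw f t * pw g t) = integral {0..d} (pw (\<lambda>n t. f n t * g n t))"
    by (rule HK_integral_cong) (rule pw_mult)
  also have "\<dots> = (\<Sum>n\<in>{1..<N}. integral {x n..x (n + 1)} (\<lambda>t. f n t * g n t))"
    unfolding integral_cells[OF abs_int_integrable[OF i]] by (intro sum.cong pw_integral_cell) auto
  finally show "integral {0..d} (\<lambda>t. pw f t * pw g t) = (\<Sum>n\<in>{1..<N}. integral {x n..x (n + 1)} (\<lambda>t. f n t * g n t))" .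
qed

subsection \<open>Hat functions\<close>

definition \<gamma> :: "nat \<Rightarrow> real" where "\<gamma> n = (S (x (n + 1)) - S (x n)) / \<epsilon>"

text \<open>The two restrictions of hat functions to cell \<open>n\<close>, written as multiples of
\<open>q * sinh ((S - c) / \<epsilon>)\<close> for two values of \<open>c\<close>.\<close>

definition falling :: "nat \<Rightarrow> real \<Rightarrow> real" where
  "falling n t = - 1 / (q (x n) * sinh (\<gamma> n)) * (q t * sinh ((S t - S (x (n + 1))) / \<epsilon>))"

definition rising :: "nat \<Rightarrow> real \<Rightarrow> real" where
  "rising n t = 1 / (q (x (n + 1)) * sinh (\<gamma> n)) * (q t * sinh ((S t - S (x n)) / \<epsilon>))"

definition hat :: "nat \<Rightarrow> real \<Rightarrow> real" where
  "hat n t = (if 1 < n \<and> t \<in> {x (n - 1)..x n} then rising (n - 1) t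
      else if n < N \<and> t \<in> {x n..x (n + 1)} then falling n t else 0)"

definition base_deriv :: "real \<Rightarrow> real \<Rightarrow> real" where
  "base_deriv c t = q1 t * sinh ((S t - c) / \<epsilon>) + 1 / q t * (cosh ((S t - c) / \<epsilon>) / \<epsilon>)"

definition fem :: "(nat \<Rightarrow> real) \<Rightarrow> real \<Rightarrow> real" where
  "fem z t = (\<Sum>n=1..N. z n * hat n t)"

text \<open>The derivative on cell \<open>n\<close>. It has jumps at the nodes, hence one function for each cell.\<close>

definition fem_deriv :: "(nat \<Rightarrow> real) \<Rightarrow> nat \<Rightarrow> real \<Rightarrow> real" where
  "fem_deriv z n t = z n * (- 1 / (q (x n) * sinh (\<gamma> n)) * base_deriv (S (x (n + 1))) t)
     + z (n + 1) * (1 / (q (x (n + 1)) * sinh (\<gamma> n)) * base_deriv (S (x n)) t)"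

lemma gamma_pos: "n \<in> {1..<N} \<Longrightarrow> 0 < \<gamma> n"
  using S_strict_mono[of "x n" "x (n + 1)"] cell_range[of n] eps by (simp add: \<gamma>_def)

lemma node_q_pos: "n \<in> {1..N} \<Longrightarrow> 0 < q (x n)"
  using q_pos grid_range by blast

lemma local_nodes:
  assumes n: "n \<in> {1..<N}"
  shows "falling n (x n) = 1" "falling n (x (n + 1)) = 0" "rising n (x n) = 0" "rising n (x (n + 1)) = 1"
proof -
  have "n \<in> {1..N}" "n + 1 \<in> {1..N}" using n by auto
  then have "0 < q (x n)" "0 < q (x (n + 1))" using node_q_pos by blast+
  then have nz: "q (x n) \<noteq> 0" "q (x (n + 1)) \<noteq> 0" "sinh (\<gamma> n) \<noteq> 0"
    using gamma_pos[OF n] by (auto dest: less_imp_neq)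
  have g: "(S (x n) - S (x (n + 1))) / \<epsilon> = - \<gamma> n" "(S (x (n + 1)) - S (x n)) / \<epsilon> = \<gamma> n"
    by (simp_all add: \<gamma>_def minus_divide_left)
  show "falling n (x n) = 1" "rising n (x (n + 1)) = 1"
    unfolding falling_def rising_def g sinh_minus using nz by (simp_all only: field_simps) simp_all
  show "falling n (x (n + 1)) = 0" "rising n (x n) = 0"
    unfolding falling_def rising_def by (simp_all only: diff_self) simp_all
qed

lemma S_mono: "a \<in> {0..d} \<Longrightarrow> b \<in> {0..d} \<Longrightarrow> a \<le> b \<Longrightarrow> S a \<le> S b"
  using S_strict_mono[of a b] by (cases "a = b") auto

lemma local_bounds:
  assumes n: "n \<in> {1..<N}" and t: "t \<in> {x n..x (n + 1)}"
  shows "\<bar>falling n t\<bar> \<le> K\<^sup>2" "\<bar>rising n t\<bar> \<le> K\<^sup>2"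
proof -
  have t0: "t \<in> {0..d}" by (rule cell_subset[OF n t])
  have xs: "x n \<in> {0..d}" "x (n + 1) \<in> {0..d}" using grid_range n by auto
  note g = gamma_pos[OF n]
  have St: "S (x n) \<le> S t" "S t \<le> S (x (n + 1))" using S_mono xs t0 t by auto
  have qq: "\<bar>1 / q s * q t\<bar> \<le> K\<^sup>2" if "s \<in> {0..d}" for s
    using mult_mono[of "1 / q s" K "q t" K] inverse_q_le[OF that] q_pos[OF that] q_bounds[OF t0] q_pos[OF t0] K_pos
    by (simp add: power2_eq_square)
  have bound: "\<bar>1 / q s * q t\<bar> * \<bar>y / sinh (\<gamma> n)\<bar> \<le> K\<^sup>2" if "s \<in> {0..d}" "\<bar>y\<bar> \<le> sinh (\<gamma> n)" for s y
  proof -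
    have "\<bar>y / sinh (\<gamma> n)\<bar> \<le> 1" using that(2) g by (simp add: abs_divide)
    then show ?thesis using mult_mono[OF qq[OF that(1)], of "\<bar>y / sinh (\<gamma> n)\<bar>" 1] by simp
  qed
  have m: "\<bar>sinh y\<bar> \<le> sinh (\<gamma> n)" if "\<bar>y\<bar> \<le> \<gamma> n" for y
  proof -
    have "sinh (- \<gamma> n) \<le> sinh y" "sinh y \<le> sinh (\<gamma> n)"
      using that unfolding sinh_real_le_iff by auto
    then show ?thesis unfolding sinh_minus by linarith
  qed
  have "\<bar>(S t - S (x (n + 1))) / \<epsilon>\<bar> \<le> \<gamma> n" "\<bar>(S t - S (x n)) / \<epsilon>\<bar> \<le> \<gamma> n"
    unfolding \<gamma>_def abs_divide using St eps by (auto simp: abs_if intro!: divide_right_mono)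
  note b = m[OF this(1)] m[OF this(2)]
  have "\<bar>falling n t\<bar> = \<bar>1 / q (x n) * q t\<bar> * \<bar>sinh ((S t - S (x (n + 1))) / \<epsilon>) / sinh (\<gamma> n)\<bar>"
    unfolding falling_def by (simp add: abs_mult)
  also have "\<dots> \<le> K\<^sup>2" by (rule bound[OF xs(1) b(1)])
  finally show "\<bar>falling n t\<bar> \<le> K\<^sup>2" .
  have "\<bar>rising n t\<bar> = \<bar>1 / q (x (n + 1)) * q t\<bar> * \<bar>sinh ((S t - S (x n)) / \<epsilon>) / sinh (\<gamma> n)\<bar>"
    unfolding rising_def by (simp add: abs_mult)
  also have "\<dots> \<le> K\<^sup>2" by (rule bound[OF xs(2) b(2)])
  finally show "\<bar>rising n t\<bar> \<le> K\<^sup>2" .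
qed

text \<open>At a node two branches of the definition of a hat function apply to the same point; their values
agree there by the nodal values.\<close>

lemma hat_cell:
  assumes n: "n \<in> {1..<N}" and t: "t \<in> {x n..x (n + 1)}" and m: "m \<in> {1..N}"
  shows "hat m t = (if m = n then falling n t else if m = n + 1 then rising n t else 0)"
proof -
  consider "m < n" | "m = n" | "m = n + 1" | "n + 1 < m" by linarith
  then show ?thesis
  proof cases
    case 1
    have "x m < x (m + 1)" "x (m + 1) \<le> x n" using 1 m n grid_step[of m] grid_mono[of "m + 1" n] by auto
    moreover have "falling m (x (m + 1)) = 0" using local_nodes(2)[of m] 1 m n by auto
    moreover have "falling m t = 0" if "t \<le> x (m + 1)"
    proof -
      have "t = x (m + 1)" using that calculation t by auto
      then show ?thesis using calculation by simp
    qed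
    ultimately show ?thesis using 1 t by (auto simp: hat_def)
  next
    case 2
    show ?thesis
    proof (cases "1 < n \<and> t \<in> {x (n - 1)..x n}")
      case True
      then have "t = x n" using t by auto
      moreover have "rising (n - 1) (x n) = 1"
      proof -
        have "n - 1 \<in> {1..<N}" "n - 1 + 1 = n" using True n by auto
        then show ?thesis using local_nodes(4)[of "n - 1"] by simp
      qed
      ultimately show ?thesis using True 2 local_nodes(1)[OF n] by (simp add: hat_def)
    next
      case False
      then show ?thesis using 2 n t by (auto simp: hat_def)
    qed
  next
    case 3
    then show ?thesis using n t by (simp add: hat_def)
  next
    case 4
    have m1: "m - 1 \<in> {1..<N}" using 4 m n by auto
    have "x (n + 1) \<le> x (m - 1)" "x (m - 1) < x m" using 4 m n grid_step[OF m1] grid_mono[of "n + 1" "m - 1"] by auto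
    moreover have "rising (m - 1) (x (m - 1)) = 0" by (rule local_nodes(3)[OF m1])
    moreover have "rising (m - 1) t = 0" if "x (m - 1) \<le> t"
    proof -
      have "t = x (m - 1)" using that calculation t by auto
      then show ?thesis using calculation by simp
    qed
    ultimately show ?thesis using 4 t by (auto simp: hat_def)
  qed
qed

lemma fem_cell:
  assumes n: "n \<in> {1..<N}" and t: "t \<in> {x n..x (n + 1)}"
  shows "fem z t = z n * falling n t + z (n + 1) * rising n t"
proof -
  have "fem z t = (\<Sum>m=1..N. (if m = n then z n * falling n t else 0) + (if m = n + 1 then z (n + 1) * rising n t else 0))"
    unfolding fem_def by (intro sum.cong) (auto simp: hat_cell[OF n t])
  also have "\<dots> = z n * falling n t + z (n + 1) * rising n t"
    using n by (subst sum.distrib) (auto simp: sum.delta)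
  finally show ?thesis .
qed

lemma fem_node: "n \<in> {1..N} \<Longrightarrow> fem z (x n) = z n"
proof (cases "n < N")
  case True
  assume "n \<in> {1..N}"
  then have "n \<in> {1..<N}" using True by auto
  then show ?thesis using fem_cell[of n "x n" z] local_nodes cell_range[of n] by auto
next
  case False
  assume "n \<in> {1..N}"
  then have n: "n = N" "n - 1 \<in> {1..<N}" "n - 1 + 1 = n" using False grid_ends by auto
  show ?thesis using fem_cell[OF n(2), of "x n" z] local_nodes[OF n(2)] cell_range[OF n(2)] unfolding n(3) by auto
qed

lemma fem_wkb_sol:
  assumes n: "n \<in> {1..<N}"
  shows "wkb_sol \<epsilon> (x n) (x (n + 1)) (fem z) (fem_deriv z n)"
proof -
  have "wkb_sol \<epsilon> 0 d (\<lambda>t. z n * falling n t + z (n + 1) * rising n t) (fem_deriv z n)"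
    unfolding falling_def rising_def fem_deriv_def base_deriv_def
    by (intro wkb_sol_add wkb_sol_cmult wkb_sol_sinh eps)
  then have "wkb_sol \<epsilon> (x n) (x (n + 1)) (\<lambda>t. z n * falling n t + z (n + 1) * rising n t) (fem_deriv z n)"
    by (rule wkb_sol_subinterval) (use cell_range[OF n] in auto)
  then show ?thesis by (rule wkb_sol_cong) (simp add: fem_cell[OF n])
qed

lemma fem_cell_ac:
  assumes "n \<in> {1..<N}"
  shows "ac (x n) (x (n + 1)) (fem z) (fem_deriv z n)"
    "ac (x n) (x (n + 1)) (fem_deriv z n) (\<lambda>t. (p t / \<epsilon>\<^sup>2 + r t) * fem z t)"
  using fem_wkb_sol[OF assms] by (auto simp: wkb_sol_def)

lemma fem_ac: "ac 0 d (fem z) (pw (fem_deriv z))"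
  by (rule pw_cell_ac) (rule fem_cell_ac)

lemma fem_deriv_continuous: "n \<in> {1..<N} \<Longrightarrow> continuous_on {x n..x (n + 1)} (fem_deriv z n)"
  using fem_cell_ac(2) by (rule ac_continuous)

lemma fem_diff: "fem (\<lambda>n. z n - w n) t = fem z t - fem w t"
  by (simp add: fem_def left_diff_distrib sum_subtractf)

lemma fem_deriv_diff: "fem_deriv (\<lambda>n. z n - w n) n t = fem_deriv z n t - fem_deriv w n t"
  unfolding fem_deriv_def by (simp add: left_diff_distrib diff_divide_distrib)

subsection \<open>Functions that vanish at the nodes\<close>

lemma r_abs_int: "r absolutely_integrable_on {0..d}"
proof -
  have "(\<lambda>t. q2 t * (1 / q t)) absolutely_integrable_on {0..d}"
    by (rule abs_int_mult_continuous(1)[OF ac_integrable[OF ac_q1] ac_continuous[OF ac_inverse_q]])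
  then show ?thesis by (simp add: r_def[abs_def])
qed

lemma zero_order_abs_int:
  assumes "continuous_on {0..d} v"
  shows "(\<lambda>t. p t * v t) integrable_on {0..d}" "(\<lambda>t. r t * v t) integrable_on {0..d}"
    "integral {0..d} (\<lambda>t. (p t / \<epsilon>\<^sup>2 + r t) * v t)
      = 1 / \<epsilon>\<^sup>2 * integral {0..d} (\<lambda>t. p t * v t) + integral {0..d} (\<lambda>t. r t * v t)"
    "(\<lambda>t. (p t / \<epsilon>\<^sup>2 + r t) * v t) integrable_on {0..d}"
proof -
  show p: "(\<lambda>t. p t * v t) integrable_on {0..d}"
    by (intro integrable_continuous_real continuous_intros p_continuous assms)
  show r: "(\<lambda>t. r t * v t) integrable_on {0..d}"
    by (rule abs_int_integrable[OF abs_int_mult_continuous(1)[OF r_abs_int assms]])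
  have eq: "(\<lambda>t. (p t / \<epsilon>\<^sup>2 + r t) * v t) = (\<lambda>t. 1 / \<epsilon>\<^sup>2 * (p t * v t) + r t * v t)"
    by (auto simp: algebra_simps)
  show "integral {0..d} (\<lambda>t. (p t / \<epsilon>\<^sup>2 + r t) * v t)
      = 1 / \<epsilon>\<^sup>2 * integral {0..d} (\<lambda>t. p t * v t) + integral {0..d} (\<lambda>t. r t * v t)"
    unfolding eq using HK_integral_add[OF integrable_on_mult_right[OF p, of "1 / \<epsilon>\<^sup>2"] r]
    by (simp only: integral_mult_right)
  show "(\<lambda>t. (p t / \<epsilon>\<^sup>2 + r t) * v t) integrable_on {0..d}"
    unfolding eq by (intro integrable_add integrable_on_mult_right p r)
qed

lemma fem_continuous: "continuous_on {0..d} (fem z)" by (rule ac_continuous[OF fem_ac])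

text \<open>Integrating by parts on each cell moves the derivative from \<open>\<eta>\<close> to the discrete function. No
boundary terms arise, as \<open>\<eta>\<close> vanishes at the nodes, and the WKB equation cancels everything except
the defect. So the form is small of order \<open>\<epsilon>\<^sup>2\<close> on such pairs.\<close>

lemma nodal_zero_consistency:
  assumes \<eta>: "\<And>n. n \<in> {1..<N} \<Longrightarrow> ac (x n) (x (n + 1)) \<eta> (\<eta>1 n)" and \<eta>c: "continuous_on {0..d} \<eta>"
    and \<eta>1c: "\<And>n. n \<in> {1..<N} \<Longrightarrow> continuous_on {x n..x (n + 1)} (\<eta>1 n)"
    and \<eta>0: "\<And>n. n \<in> {1..N} \<Longrightarrow> \<eta> (x n) = 0"
  shows "b_real d \<epsilon> p \<kappa> \<eta> (pw \<eta>1) (fem z) (pw (fem_deriv z)) = - \<epsilon>\<^sup>2 * integral {0..d} (\<lambda>t. r t * (\<eta> t * fem z t))"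
proof -
  have c: "continuous_on {0..d} (\<lambda>t. \<eta> t * fem z t)" by (intro continuous_intros \<eta>c fem_continuous)
  have "integral {x n..x (n + 1)} (\<lambda>t. \<eta>1 n t * fem_deriv z n t) = - integral {x n..x (n + 1)} (\<lambda>t. (p t / \<epsilon>\<^sup>2 + r t) * (\<eta> t * fem z t))"
    if n: "n \<in> {1..<N}" for n
  proof -
    have i1: "(\<lambda>t. \<eta>1 n t * fem_deriv z n t) integrable_on {x n..x (n + 1)}"
      by (intro integrable_continuous_real continuous_intros \<eta>1c fem_deriv_continuous n)
    have i2: "(\<lambda>t. (p t / \<epsilon>\<^sup>2 + r t) * (\<eta> t * fem z t)) integrable_on {x n..x (n + 1)}"
      by (rule integrable_subinterval_real[OF zero_order_abs_int(4)[OF c]]) (use cell_range[OF n] in auto)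
    have "integral {x n..x (n + 1)} (\<lambda>t. \<eta>1 n t * fem_deriv z n t + \<eta> t * ((p t / \<epsilon>\<^sup>2 + r t) * fem z t)) = 0"
      using integral_by_parts_ac[OF \<eta>[OF n] fem_cell_ac(2)[OF n]] cell_range[OF n] \<eta>0[of n] \<eta>0[of "n + 1"] n by simp
    moreover have "\<eta> t * ((p t / \<epsilon>\<^sup>2 + r t) * fem z t) = (p t / \<epsilon>\<^sup>2 + r t) * (\<eta> t * fem z t)" for t by simp
    ultimately show ?thesis
      using HK_integral_add[OF i1 i2] by (simp del: distrib_left)
  qed
  then have "(\<Sum>n\<in>{1..<N}. integral {x n..x (n + 1)} (\<lambda>t. \<eta>1 n t * fem_deriv z n t))
      = - (\<Sum>n\<in>{1..<N}. integral {x n..x (n + 1)} (\<lambda>t. (p t / \<epsilon>\<^sup>2 + r t) * (\<eta> t * fem z t)))"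
    by (simp add: sum_negf)
  then have I: "integral {0..d} (\<lambda>t. pw \<eta>1 t * pw (fem_deriv z) t)
      = - (1 / \<epsilon>\<^sup>2 * integral {0..d} (\<lambda>t. p t * (\<eta> t * fem z t)) + integral {0..d} (\<lambda>t. r t * (\<eta> t * fem z t)))"
    using pw_mult_integral(2)[OF \<eta>1c fem_deriv_continuous[of _ z]] zero_order_abs_int(3)[OF c]
      integral_cells[OF zero_order_abs_int(4)[OF c]] by simp
  have "\<eta> 0 = 0" using \<eta>0[of 1] grid_ends by simp
  then show ?thesis
    unfolding b_real_def I using eps by (simp add: algebra_simps)
qed

end

section \<open>The error of the Galerkin solution\<close>

text \<open>A real load \<open>l\<close> and a real solution \<open>u\<close>; the real and the imaginary part of a complex solution are the
cases \<open>l = 1\<close> and \<open>l = 0\<close>. The numbers \<open>c\<close> are the nodal values of the Galerkin solution.\<close>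

locale wkb_galerkin = wkb_grid +
  fixes u u1 :: "real \<Rightarrow> real" and \<kappa> l :: real and c :: "nat \<Rightarrow> real"
  assumes ac_u: "ac 0 d u u1" and ac_u1: "ac 0 d u1 (\<lambda>t. p t / \<epsilon>\<^sup>2 * u t)"
    and bc: "\<epsilon> * u1 0 = \<kappa> * u 0" "\<epsilon> * u1 d = l"
    and \<kappa>: "0 \<le> \<kappa>" "\<kappa> \<le> K" and l: "\<bar>l\<bar> \<le> 1"
    and galerkin: "\<And>z. b_real d \<epsilon> p \<kappa> (fem c) (pw (fem_deriv c)) (fem z) (pw (fem_deriv z)) = \<epsilon> * l * fem z d"
begin

text \<open>The error is \<open>\<eta> + \<delta>\<close>: the interpolation error \<open>\<eta>\<close>, and the discrete function
\<open>\<delta>\<close> that is the difference between the interpolant and the Galerkin solution.\<close>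

definition \<eta> :: "real \<Rightarrow> real" where "\<eta> t = u t - fem (\<lambda>n. u (x n)) t"
definition \<eta>1 :: "nat \<Rightarrow> real \<Rightarrow> real" where "\<eta>1 n t = u1 t - fem_deriv (\<lambda>n. u (x n)) n t"
definition w :: "nat \<Rightarrow> real" where "w n = u (x n) - c n"
abbreviation \<delta> :: "real \<Rightarrow> real" where "\<delta> \<equiv> fem w"
abbreviation \<delta>1 :: "nat \<Rightarrow> real \<Rightarrow> real" where "\<delta>1 \<equiv> fem_deriv w"
definition m :: real where "m = min \<epsilon> h"

lemma m_bounds: "0 < m" "m \<le> \<epsilon>" "m \<le> h" "m < 1"
  using eps mesh_bounds by (auto simp: m_def)

lemma u_continuous: "continuous_on {0..d} u" and u1_continuous: "continuous_on {0..d} u1"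
  using ac_continuous ac_u ac_u1 by blast+

lemma continuous_cell: "continuous_on {0..d} f \<Longrightarrow> n \<in> {1..<N} \<Longrightarrow> continuous_on {x n..x (n + 1)} f"
  using continuous_on_subset cell_subset by blast

lemma \<eta>_continuous: "continuous_on {0..d} \<eta>"
  unfolding \<eta>_def[abs_def] by (intro continuous_intros u_continuous fem_continuous)

lemma \<eta>1_continuous: "n \<in> {1..<N} \<Longrightarrow> continuous_on {x n..x (n + 1)} (\<eta>1 n)"
  unfolding \<eta>1_def[abs_def] by (intro continuous_intros continuous_cell[OF u1_continuous] fem_deriv_continuous)

lemma \<eta>_cell:
  assumes n: "n \<in> {1..<N}"
  shows "ac (x n) (x (n + 1)) \<eta> (\<eta>1 n)"
    and "ac (x n) (x (n + 1)) (\<eta>1 n) (\<lambda>t. p t / \<epsilon>\<^sup>2 * \<eta> t - r t * (u t - \<eta> t))"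
proof -
  note a = ac_subinterval[OF ac_u cell_range(1,3)[OF n]] ac_subinterval[OF ac_u1 cell_range(1,3)[OF n]]
  show "ac (x n) (x (n + 1)) \<eta> (\<eta>1 n)"
    unfolding \<eta>_def[abs_def] \<eta>1_def[abs_def] by (rule ac_diff[OF a(1) fem_cell_ac(1)[OF n]])
  show "ac (x n) (x (n + 1)) (\<eta>1 n) (\<lambda>t. p t / \<epsilon>\<^sup>2 * \<eta> t - r t * (u t - \<eta> t))"
    by (rule ac_cong[OF ac_diff[OF a(2) fem_cell_ac(2)[OF n, of "\<lambda>n. u (x n)"]]])
       (simp_all add: \<eta>_def \<eta>1_def algebra_simps)
qed

lemma \<eta>_node: "n \<in> {1..N} \<Longrightarrow> \<eta> (x n) = 0"
  by (simp add: \<eta>_def fem_node)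

lemma u_bounds: "integral {0..d} (\<lambda>t. (u t)\<^sup>2) \<le> 2 * K ^ 9 * \<epsilon>" "t \<in> {0..d} \<Longrightarrow> (u t)\<^sup>2 \<le> 4 * K ^ 10"
  using exact_solution_bounds[OF eps ac_u ac_u1 bc \<kappa>(1) l] by auto

lemma u2_integrable: "(\<lambda>t. (u t)\<^sup>2) integrable_on {0..d}"
  by (intro integrable_continuous_real continuous_intros u_continuous)

lemma u2_cell_integrable: "n \<in> {1..<N} \<Longrightarrow> (\<lambda>t. (u t)\<^sup>2) integrable_on {x n..x (n + 1)}"
  by (intro integrable_continuous_real continuous_intros continuous_cell u_continuous)

lemma cell_energy_nonneg: "n \<in> {1..<N} \<Longrightarrow> 0 \<le> integral {x n..x (n + 1)} (\<lambda>t. (u t)\<^sup>2)"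
  by (rule integral_nonneg[OF u2_cell_integrable]) auto

lemma cell_energy_le:
  assumes n: "n \<in> {1..<N}"
  shows "integral {x n..x (n + 1)} (\<lambda>t. (u t)\<^sup>2) \<le> 4 * K ^ 10 * h"
proof -
  have "integral {x n..x (n + 1)} (\<lambda>t. (u t)\<^sup>2) \<le> integral {x n..x (n + 1)} (\<lambda>t. 4 * K ^ 10)"
    by (rule integral_le[OF u2_cell_integrable[OF n]]) (use u_bounds(2) cell_subset[OF n] in auto)
  also have "\<dots> = (x (n + 1) - x n) * (4 * K ^ 10)" using cell_range[OF n] by simp
  also have "\<dots> \<le> h * (4 * K ^ 10)" using cell_length_le[OF n] K_pos by (intro mult_right_mono) auto
  finally show ?thesis by (simp add: mult_ac)
qed

text \<open>The inner product of two families of derivatives in \<open>L^2\<close>, as a sum over cells.\<close>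

definition cell_form :: "(nat \<Rightarrow> real \<Rightarrow> real) \<Rightarrow> (nat \<Rightarrow> real \<Rightarrow> real) \<Rightarrow> real" where
  "cell_form f g = (\<Sum>n\<in>{1..<N}. integral {x n..x (n + 1)} (\<lambda>t. f n t * g n t))"

lemma integral_pw_mult:
  assumes "\<And>n. n \<in> {1..<N} \<Longrightarrow> continuous_on {x n..x (n + 1)} (f n)"
    "\<And>n. n \<in> {1..<N} \<Longrightarrow> continuous_on {x n..x (n + 1)} (g n)"
  shows "integral {0..d} (\<lambda>t. pw f t * pw g t) = cell_form f g"
  unfolding cell_form_def by (rule pw_mult_integral(2)[OF assms])

lemma fem_form: "integral {0..d} (\<lambda>t. pw (fem_deriv y) t * pw (fem_deriv z) t) = cell_form (fem_deriv y) (fem_deriv z)"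
  by (rule integral_pw_mult) (rule fem_deriv_continuous; assumption)+

lemma cell_form_nonneg: "0 \<le> cell_form (fem_deriv z) (fem_deriv z)"
  unfolding cell_form_def
  by (intro sum_nonneg integral_nonneg integrable_continuous_real continuous_on_mult fem_deriv_continuous) auto

lemma \<eta>_form: "integral {0..d} (\<lambda>t. pw \<eta>1 t * pw (fem_deriv z) t) = cell_form \<eta>1 (fem_deriv z)"
  by (rule integral_pw_mult) (rule \<eta>1_continuous fem_deriv_continuous; assumption)+

lemma cell_form_diff:
  assumes "\<And>n. n \<in> {1..<N} \<Longrightarrow> continuous_on {x n..x (n + 1)} (f n)"
    "\<And>n. n \<in> {1..<N} \<Longrightarrow> continuous_on {x n..x (n + 1)} (f' n)"
    "\<And>n. n \<in> {1..<N} \<Longrightarrow> continuous_on {x n..x (n + 1)} (g n)"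
  shows "cell_form (\<lambda>n t. f n t - f' n t) g = cell_form f g - cell_form f' g"
  unfolding cell_form_def sum_subtractf[symmetric]
proof (rule sum.cong)
  fix n assume n: "n \<in> {1..<N}"
  have "integral {x n..x (n + 1)} (\<lambda>t. f n t * g n t - f' n t * g n t)
    = integral {x n..x (n + 1)} (\<lambda>t. f n t * g n t) - integral {x n..x (n + 1)} (\<lambda>t. f' n t * g n t)"
    by (intro HK_integral_diff integrable_continuous_real continuous_intros assms n)
  then show "integral {x n..x (n + 1)} (\<lambda>t. (f n t - f' n t) * g n t)
    = integral {x n..x (n + 1)} (\<lambda>t. f n t * g n t) - integral {x n..x (n + 1)} (\<lambda>t. f' n t * g n t)"
    by (simp add: left_diff_distrib)
qed simp

text \<open>The local estimates, summed over the cells. The energy of \<open>u\<close> on a cell enters the sums through its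
total, and the bounds at points through the length of the cell times the supremum of \<open>u\<^sup>2\<close>.\<close>

lemma interpolation_L2:
  "integral {0..d} (\<lambda>t. (\<eta> t)\<^sup>2) \<le> 2 * K ^ 25 * m ^ 4 * \<epsilon>"
  "\<epsilon>\<^sup>2 * cell_form \<eta>1 \<eta>1 \<le> 8 * K ^ 25 * \<epsilon> ^ 3 * m\<^sup>2"
  and interpolation_sup:
  "t \<in> {0..d} \<Longrightarrow> (\<eta> t)\<^sup>2 \<le> 8 * K ^ 26 * m ^ 3 * h"
  "n \<in> {1..<N} \<Longrightarrow> t \<in> {x n..x (n + 1)} \<Longrightarrow> (\<eta>1 n t)\<^sup>2 \<le> 56 * K ^ 26 * m * h"
proof -
  let ?D = "\<lambda>n. integral {x n..x (n + 1)} (\<lambda>t. (u t)\<^sup>2)"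
  let ?\<mu> = "\<lambda>n. min \<epsilon> (x (n + 1) - x n)"
  note E = cell_interpolation_estimates[OF eps cell_range continuous_cell[OF u_continuous] \<eta>_cell \<eta>_node \<eta>_node refl refl]
  have \<mu>: "0 < ?\<mu> n" "?\<mu> n \<le> m" if "n \<in> {1..<N}" for n
    using cell_range[OF that] cell_length_le[OF that] eps unfolding m_def by auto
  have sumD: "(\<Sum>n\<in>{1..<N}. ?D n) \<le> 2 * K ^ 9 * \<epsilon>"
    using integral_cells[OF u2_integrable] u_bounds(1) by simp
  have e2: "integral {x n..x (n + 1)} (\<lambda>t. (\<epsilon> * \<eta>1 n t)\<^sup>2) = \<epsilon>\<^sup>2 * integral {x n..x (n + 1)} (\<lambda>t. \<eta>1 n t * \<eta>1 n t)" for n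
    unfolding integral_mult_right[symmetric] by (simp add: power2_eq_square mult_ac)
  have b: "integral {x n..x (n + 1)} (\<lambda>t. (\<eta> t)\<^sup>2) \<le> K ^ 16 * m ^ 4 * ?D n"
     "\<epsilon>\<^sup>2 * integral {x n..x (n + 1)} (\<lambda>t. \<eta>1 n t * \<eta>1 n t) \<le> 4 * K ^ 16 * \<epsilon>\<^sup>2 * m\<^sup>2 * ?D n"
     "\<And>t. t \<in> {x n..x (n + 1)} \<Longrightarrow> (\<eta> t)\<^sup>2 \<le> 8 * K ^ 26 * m ^ 3 * h"
     "\<And>t. t \<in> {x n..x (n + 1)} \<Longrightarrow> (\<eta>1 n t)\<^sup>2 \<le> 56 * K ^ 26 * m * h" if n: "n \<in> {1..<N}" for n
  proof -
    note Dn = cell_energy_nonneg[OF n] cell_energy_le[OF n]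
    have nn: "n \<in> {1..N}" "n + 1 \<in> {1..N}" using n by auto
    have mono: "?\<mu> n ^ k * ?D n \<le> m ^ k * ?D n" for k
      using \<mu>[OF n] Dn by (intro mult_right_mono power_mono) auto
    have mono2: "?\<mu> n ^ k * ?D n \<le> m ^ k * (4 * K ^ 10 * h)" for k
      using \<mu>[OF n] Dn m_bounds by (intro mult_mono power_mono) auto
    show "integral {x n..x (n + 1)} (\<lambda>t. (\<eta> t)\<^sup>2) \<le> K ^ 16 * m ^ 4 * ?D n"
      using order_trans[OF E(1)[OF n n n n n n nn, unfolded mult.assoc] mult_left_mono[OF mono[of 4], of "K ^ 16"]] K_pos
      by (simp add: mult.assoc)
    show "\<epsilon>\<^sup>2 * integral {x n..x (n + 1)} (\<lambda>t. \<eta>1 n t * \<eta>1 n t) \<le> 4 * K ^ 16 * \<epsilon>\<^sup>2 * m\<^sup>2 * ?D n"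
      using order_trans[OF E(2)[OF n n n n n n nn, unfolded mult.assoc[of _ "_ ^ _" "integral _ _"]] mult_left_mono[OF mono[of 2], of "4 * K ^ 16 * \<epsilon>\<^sup>2"]] K_pos eps unfolding e2
      by (simp add: mult.assoc)
    fix t assume t: "t \<in> {x n..x (n + 1)}"
    have "(\<eta> t)\<^sup>2 \<le> 2 * K ^ 16 * (m ^ 3 * (4 * K ^ 10 * h))"
      using order_trans[OF E(3)[OF n n n n n n nn t, unfolded mult.assoc[of _ "_ ^ _" "integral _ _"]]
          mult_left_mono[OF mono2[of 3], of "2 * K ^ 16"]] K_pos by simp
    also have "\<dots> = 8 * K ^ 26 * m ^ 3 * h" by (simp add: eval_nat_numeral mult_ac)
    finally show "(\<eta> t)\<^sup>2 \<le> 8 * K ^ 26 * m ^ 3 * h" .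
    have "(\<epsilon> * \<eta>1 n t)\<^sup>2 \<le> 14 * K ^ 16 * \<epsilon>\<^sup>2 * (m * (4 * K ^ 10 * h))"
      using order_trans[OF E(4)[OF n n n n n n nn t, unfolded mult.assoc[of _ "min _ _" "integral _ _"]]
          mult_left_mono[OF mono2[of 1, unfolded power_one_right], of "14 * K ^ 16 * \<epsilon>\<^sup>2"]] K_pos eps by simp
    then have "\<epsilon>\<^sup>2 * (\<eta>1 n t)\<^sup>2 \<le> \<epsilon>\<^sup>2 * (56 * K ^ 26 * m * h)"
      by (simp add: eval_nat_numeral mult_ac)
    then show "(\<eta>1 n t)\<^sup>2 \<le> 56 * K ^ 26 * m * h" using eps by simp
  qed
  have "integral {0..d} (\<lambda>t. (\<eta> t)\<^sup>2) = (\<Sum>n\<in>{1..<N}. integral {x n..x (n + 1)} (\<lambda>t. (\<eta> t)\<^sup>2))"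
    by (intro integral_cells integrable_continuous_real continuous_intros \<eta>_continuous)
  also have "\<dots> \<le> (\<Sum>n\<in>{1..<N}. K ^ 16 * m ^ 4 * ?D n)" by (intro sum_mono b)
  also have "\<dots> = K ^ 16 * m ^ 4 * (\<Sum>n\<in>{1..<N}. ?D n)" by (rule sum_distrib_left[symmetric])
  also have "\<dots> \<le> K ^ 16 * m ^ 4 * (2 * K ^ 9 * \<epsilon>)"
    using sumD K_pos m_bounds by (intro mult_left_mono) auto
  also have "\<dots> = 2 * K ^ 25 * m ^ 4 * \<epsilon>" by (simp add: eval_nat_numeral mult_ac)
  finally show "integral {0..d} (\<lambda>t. (\<eta> t)\<^sup>2) \<le> 2 * K ^ 25 * m ^ 4 * \<epsilon>" .
  have "\<epsilon>\<^sup>2 * cell_form \<eta>1 \<eta>1 \<le> (\<Sum>n\<in>{1..<N}. 4 * K ^ 16 * \<epsilon>\<^sup>2 * m\<^sup>2 * ?D n)"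
    unfolding cell_form_def sum_distrib_left by (intro sum_mono b)
  also have "\<dots> = 4 * K ^ 16 * \<epsilon>\<^sup>2 * m\<^sup>2 * (\<Sum>n\<in>{1..<N}. ?D n)" by (rule sum_distrib_left[symmetric])
  also have "\<dots> \<le> 4 * K ^ 16 * \<epsilon>\<^sup>2 * m\<^sup>2 * (2 * K ^ 9 * \<epsilon>)"
    using sumD K_pos by (intro mult_left_mono) auto
  also have "\<dots> = 8 * K ^ 25 * \<epsilon> ^ 3 * m\<^sup>2" by (simp add: eval_nat_numeral mult_ac)
  finally show "\<epsilon>\<^sup>2 * cell_form \<eta>1 \<eta>1 \<le> 8 * K ^ 25 * \<epsilon> ^ 3 * m\<^sup>2" .
  show "(\<eta> t)\<^sup>2 \<le> 8 * K ^ 26 * m ^ 3 * h" if t: "t \<in> {0..d}"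
  proof (cases "t < d")
    case True
    then obtain n where "n \<in> {1..<N}" "x n \<le> t" "t < x (n + 1)" using t by (auto elim: cell_cases)
    then show ?thesis using b(3) by simp
  next
    case False
    then have "\<eta> t = 0" using \<eta>_node[of N] grid_ends t by simp
    then show ?thesis using m_bounds mesh_bounds K_pos by simp
  qed
  show "n \<in> {1..<N} \<Longrightarrow> t \<in> {x n..x (n + 1)} \<Longrightarrow> (\<eta>1 n t)\<^sup>2 \<le> 56 * K ^ 26 * m * h" by (rule b(4))
qed

text \<open>Galerkin orthogonality. The interpolation error vanishes at the nodes, so \<open>\<delta>\<close> solves the
discrete problem with the small load \<open>\<epsilon>\<^sup>2 * r * \<eta>\<close>.\<close>

lemma error_equation:
  "\<epsilon>\<^sup>2 * cell_form \<delta>1 (fem_deriv z) + integral {0..d} (\<lambda>t. p t * \<delta> t * fem z t) + \<epsilon> * \<kappa> * \<delta> 0 * fem z 0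
   = \<epsilon>\<^sup>2 * integral {0..d} (\<lambda>t. r t * (\<eta> t * fem z t))"
proof -
  let ?\<theta> = "fem z" and ?\<theta>1 = "fem_deriv z"
  note c\<theta>1 = fem_deriv_continuous[of _ z]
  have cu1: "n \<in> {1..<N} \<Longrightarrow> continuous_on {x n..x (n + 1)} u1" for n by (rule continuous_cell[OF u1_continuous])
  have pi: "(\<lambda>t. p t * v t * ?\<theta> t) integrable_on {0..d}" if "continuous_on {0..d} v" for v
    by (intro integrable_continuous_real continuous_intros p_continuous that fem_continuous)
  have exact: "\<epsilon>\<^sup>2 * cell_form (\<lambda>n. u1) ?\<theta>1 + integral {0..d} (\<lambda>t. p t * u t * ?\<theta> t) + \<epsilon> * \<kappa> * u 0 * ?\<theta> 0 = \<epsilon> * l * ?\<theta> d"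
  proof -
    have i1: "(\<lambda>t. u1 t * pw ?\<theta>1 t) integrable_on {0..d}"
      by (rule abs_int_integrable[OF abs_int_mult_continuous(2)[OF ac_integrable[OF fem_ac] u1_continuous]])
    have i2: "(\<lambda>t. 1 / \<epsilon>\<^sup>2 * (p t * u t * ?\<theta> t)) integrable_on {0..d}"
      by (intro integrable_on_mult_right pi u_continuous)
    have "integral {0..d} (\<lambda>t. p t / \<epsilon>\<^sup>2 * u t * ?\<theta> t + u1 t * pw ?\<theta>1 t) = u1 d * ?\<theta> d - u1 0 * ?\<theta> 0"
      using integral_by_parts_ac[OF ac_u1 fem_ac] d_pos by simp
    moreover have "p t / \<epsilon>\<^sup>2 * u t * ?\<theta> t = 1 / \<epsilon>\<^sup>2 * (p t * u t * ?\<theta> t)" for t by simp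
    ultimately have "1 / \<epsilon>\<^sup>2 * integral {0..d} (\<lambda>t. p t * u t * ?\<theta> t) + integral {0..d} (\<lambda>t. u1 t * pw ?\<theta>1 t) = u1 d * ?\<theta> d - u1 0 * ?\<theta> 0"
      using HK_integral_add[OF i2 i1] by (simp only: integral_mult_right)
    moreover have "integral {0..d} (\<lambda>t. u1 t * pw ?\<theta>1 t) = cell_form (\<lambda>n. u1) ?\<theta>1"
    proof -
      have "integral {0..d} (\<lambda>t. u1 t * pw ?\<theta>1 t) = integral {0..d} (\<lambda>t. pw (\<lambda>n. u1) t * pw ?\<theta>1 t)"
      proof (rule integral_spike[of "{d}"])
        fix t assume t: "t \<in> {0..d} - {d}"
        then obtain n where "n \<in> {1..<N}" "x n \<le> t" "t < x (n + 1)" using cell_cases[of t] by auto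
        then show "pw (\<lambda>n. u1) t * pw ?\<theta>1 t = u1 t * pw ?\<theta>1 t" by (simp add: pw_cell)
      qed simp
      also have "\<dots> = cell_form (\<lambda>n. u1) ?\<theta>1"
        by (rule integral_pw_mult[OF cu1 c\<theta>1])
      finally show ?thesis .
    qed
    ultimately have "\<epsilon>\<^sup>2 * cell_form (\<lambda>n. u1) ?\<theta>1 + integral {0..d} (\<lambda>t. p t * u t * ?\<theta> t) = \<epsilon>\<^sup>2 * (u1 d * ?\<theta> d - u1 0 * ?\<theta> 0)"
      using eps by (simp add: field_simps)
    also have "\<dots> = \<epsilon> * (\<epsilon> * u1 d) * ?\<theta> d - \<epsilon> * (\<epsilon> * u1 0) * ?\<theta> 0"
      by (simp add: power2_eq_square algebra_simps)
    also have "\<dots> = \<epsilon> * l * ?\<theta> d - \<epsilon> * \<kappa> * u 0 * ?\<theta> 0" unfolding bc by simp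
    finally show ?thesis by simp
  qed
  have discrete: "\<epsilon>\<^sup>2 * cell_form (fem_deriv c) ?\<theta>1 + integral {0..d} (\<lambda>t. p t * fem c t * ?\<theta> t) + \<epsilon> * \<kappa> * fem c 0 * ?\<theta> 0 = \<epsilon> * l * ?\<theta> d"
    using galerkin[of z] unfolding b_real_def fem_form .
  have interp: "\<epsilon>\<^sup>2 * cell_form \<eta>1 ?\<theta>1 + integral {0..d} (\<lambda>t. p t * \<eta> t * ?\<theta> t) + \<epsilon> * \<kappa> * \<eta> 0 * ?\<theta> 0 = - \<epsilon>\<^sup>2 * integral {0..d} (\<lambda>t. r t * (\<eta> t * ?\<theta> t))"
    using nodal_zero_consistency[OF \<eta>_cell(1) \<eta>_continuous \<eta>1_continuous \<eta>_node, of \<kappa> z]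
    unfolding b_real_def \<eta>_form .
  have eqs: "\<delta> t = u t - \<eta> t - fem c t" "\<delta>1 n t = u1 t - \<eta>1 n t - fem_deriv c n t" for n t
    unfolding w_def[abs_def] by (simp_all add: fem_diff fem_deriv_diff \<eta>_def \<eta>1_def)
  have "cell_form \<delta>1 ?\<theta>1 = cell_form (\<lambda>n t. (\<lambda>n t. u1 t - \<eta>1 n t) n t - fem_deriv c n t) ?\<theta>1"
    unfolding cell_form_def eqs by simp
  also have "\<dots> = cell_form (\<lambda>n t. u1 t - \<eta>1 n t) ?\<theta>1 - cell_form (fem_deriv c) ?\<theta>1"
    by (rule cell_form_diff) (intro continuous_intros cu1 \<eta>1_continuous fem_deriv_continuous; assumption)+
  also have "cell_form (\<lambda>n t. u1 t - \<eta>1 n t) ?\<theta>1 = cell_form (\<lambda>n. u1) ?\<theta>1 - cell_form \<eta>1 ?\<theta>1"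
    by (rule cell_form_diff) (intro cu1 \<eta>1_continuous fem_deriv_continuous; assumption)+
  finally have 1: "cell_form \<delta>1 ?\<theta>1 = cell_form (\<lambda>n. u1) ?\<theta>1 - cell_form \<eta>1 ?\<theta>1 - cell_form (fem_deriv c) ?\<theta>1" .
  have "integral {0..d} (\<lambda>t. p t * \<delta> t * ?\<theta> t)
     = integral {0..d} (\<lambda>t. p t * u t * ?\<theta> t - p t * \<eta> t * ?\<theta> t - p t * fem c t * ?\<theta> t)"
    unfolding eqs by (simp add: algebra_simps)
  also have "\<dots> = integral {0..d} (\<lambda>t. p t * u t * ?\<theta> t) - integral {0..d} (\<lambda>t. p t * \<eta> t * ?\<theta> t) - integral {0..d} (\<lambda>t. p t * fem c t * ?\<theta> t)"
    using HK_integral_diff[OF integrable_diff[OF pi[OF u_continuous] pi[OF \<eta>_continuous]] pi[OF fem_continuous]]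
      HK_integral_diff[OF pi[OF u_continuous] pi[OF \<eta>_continuous]] by simp
  finally have 2: "integral {0..d} (\<lambda>t. p t * \<delta> t * ?\<theta> t) = integral {0..d} (\<lambda>t. p t * u t * ?\<theta> t) - integral {0..d} (\<lambda>t. p t * \<eta> t * ?\<theta> t) - integral {0..d} (\<lambda>t. p t * fem c t * ?\<theta> t)" .
  show ?thesis
    using exact discrete interp unfolding 1 2 eqs(1)[of 0]
    by (simp only: left_diff_distrib right_diff_distrib)
qed

text \<open>The error equation tested with \<open>\<delta>\<close> itself: the energy of \<open>\<delta>\<close> is at most a constant times
\<open>\<epsilon> ^ 4\<close> times the integral of \<open>\<eta>\<^sup>2\<close>.\<close>

lemma discrete_energy: "integral {0..d} (\<lambda>t. (\<delta> t)\<^sup>2) + \<epsilon>\<^sup>2 * cell_form \<delta>1 \<delta>1 \<le> 2 * K ^ 37 * \<epsilon> ^ 5 * m ^ 4"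
proof -
  define H where "H = integral {0..d} (\<lambda>t. (\<eta> t)\<^sup>2)"
  define X where "X = integral {0..d} (\<lambda>t. (\<delta> t)\<^sup>2)"
  define C where "C = cell_form \<delta>1 \<delta>1"
  define I where "I = integral {0..d} (\<lambda>t. \<bar>\<eta> t\<bar> * \<bar>\<delta> t\<bar>)"
  have di: "(\<lambda>t. (\<delta> t)\<^sup>2) integrable_on {0..d}"
    by (intro integrable_continuous_real continuous_intros fem_continuous)
  have ai: "(\<lambda>t. \<bar>\<eta> t\<bar> * \<bar>\<delta> t\<bar>) integrable_on {0..d}"
    by (intro integrable_continuous_real continuous_intros fem_continuous \<eta>_continuous)
  have X0: "0 \<le> X" unfolding X_def using di by (intro integral_nonneg) auto
  have C0: "0 \<le> C" unfolding C_def by (rule cell_form_nonneg)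
  have H0: "0 \<le> H" unfolding H_def
    by (intro integral_nonneg integrable_continuous_real continuous_intros \<eta>_continuous) auto
  have CS: "I\<^sup>2 \<le> H * X" unfolding I_def H_def X_def
    by (rule Cauchy_Schwarz_integral[OF \<eta>_continuous fem_continuous])
  have "X / K ^ 4 \<le> integral {0..d} (\<lambda>t. p t * \<delta> t * \<delta> t)"
  proof -
    have "integral {0..d} (\<lambda>t. (\<delta> t)\<^sup>2 / K ^ 4) \<le> integral {0..d} (\<lambda>t. p t * \<delta> t * \<delta> t)"
    proof (rule integral_le[OF integrable_on_divide[OF di]])
      show "(\<lambda>t. p t * \<delta> t * \<delta> t) integrable_on {0..d}"
        by (intro integrable_continuous_real continuous_intros p_continuous fem_continuous)
      fix t assume "t \<in> {0..d}"
      then show "(\<delta> t)\<^sup>2 / K ^ 4 \<le> p t * \<delta> t * \<delta> t"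
        using mult_right_mono[of "1 / K ^ 4" "p t" "(\<delta> t)\<^sup>2"] p_bounds[of t] by (simp add: power2_eq_square mult.assoc)
    qed
    then show ?thesis by (simp add: X_def)
  qed
  moreover have "\<epsilon>\<^sup>2 * C / K ^ 4 \<le> \<epsilon>\<^sup>2 * C"
  proof -
    have "\<epsilon>\<^sup>2 * C * 1 \<le> \<epsilon>\<^sup>2 * C * K ^ 4" using C0 K_ge by (intro mult_left_mono) auto
    then show ?thesis using K_pos by (simp add: pos_divide_le_eq)
  qed
  moreover have "0 \<le> \<epsilon> * \<kappa> * \<delta> 0 * \<delta> 0" using eps \<kappa> by (simp add: mult.assoc)
  moreover have "integral {0..d} (\<lambda>t. r t * (\<eta> t * \<delta> t)) \<le> K\<^sup>2 * I"
  proof -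
    have "integral {0..d} (\<lambda>t. r t * (\<eta> t * \<delta> t)) \<le> integral {0..d} (\<lambda>t. K\<^sup>2 * (\<bar>\<eta> t\<bar> * \<bar>\<delta> t\<bar>))"
    proof (rule integral_le[OF _ integrable_on_mult_right[OF ai]])
      show "(\<lambda>t. r t * (\<eta> t * \<delta> t)) integrable_on {0..d}"
        by (intro zero_order_abs_int continuous_intros \<eta>_continuous fem_continuous)
      fix t assume t: "t \<in> {0..d}"
      have "r t * (\<eta> t * \<delta> t) \<le> \<bar>r t\<bar> * (\<bar>\<eta> t\<bar> * \<bar>\<delta> t\<bar>)" by (metis abs_ge_self abs_mult)
      also have "\<dots> \<le> K\<^sup>2 * (\<bar>\<eta> t\<bar> * \<bar>\<delta> t\<bar>)" using r_bound[OF t] by (intro mult_right_mono) auto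
      finally show "r t * (\<eta> t * \<delta> t) \<le> K\<^sup>2 * (\<bar>\<eta> t\<bar> * \<bar>\<delta> t\<bar>)" .
    qed
    then show ?thesis by (simp add: I_def)
  qed
  then have "\<epsilon>\<^sup>2 * integral {0..d} (\<lambda>t. r t * (\<eta> t * \<delta> t)) \<le> \<epsilon>\<^sup>2 * (K\<^sup>2 * I)" by (intro mult_left_mono) auto
  ultimately have "(X + \<epsilon>\<^sup>2 * C) / K ^ 4 \<le> \<epsilon>\<^sup>2 * (K\<^sup>2 * I)"
    using error_equation[of w] unfolding C_def add_divide_distrib by linarith
  then have "X + \<epsilon>\<^sup>2 * C \<le> \<epsilon>\<^sup>2 * (K\<^sup>2 * I) * K ^ 4" using K_pos by (simp add: pos_divide_le_eq)
  then have "X + \<epsilon>\<^sup>2 * C \<le> K ^ 6 * \<epsilon>\<^sup>2 * I" by (simp add: eval_nat_numeral mult_ac)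
  then have "(X + \<epsilon>\<^sup>2 * C)\<^sup>2 \<le> (K ^ 6 * \<epsilon>\<^sup>2 * I)\<^sup>2" using X0 C0 by (intro power_mono) auto
  also have "\<dots> = K ^ 12 * \<epsilon> ^ 4 * I\<^sup>2" by (simp add: eval_nat_numeral mult_ac)
  also have "\<dots> \<le> K ^ 12 * \<epsilon> ^ 4 * (H * X)" using CS by (intro mult_left_mono) auto
  also have "\<dots> \<le> K ^ 12 * \<epsilon> ^ 4 * (2 * K ^ 25 * m ^ 4 * \<epsilon> * (X + \<epsilon>\<^sup>2 * C))"
    using interpolation_L2(1) X0 C0 H0 K_pos eps by (intro mult_left_mono mult_mono) (auto simp: H_def)
  also have "\<dots> = 2 * K ^ 37 * \<epsilon> ^ 5 * m ^ 4 * (X + \<epsilon>\<^sup>2 * C)" by (simp add: eval_nat_numeral mult_ac)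
  finally have "(X + \<epsilon>\<^sup>2 * C)\<^sup>2 \<le> 2 * K ^ 37 * \<epsilon> ^ 5 * m ^ 4 * (X + \<epsilon>\<^sup>2 * C)" .
  then have "X + \<epsilon>\<^sup>2 * C \<le> 2 * K ^ 37 * \<epsilon> ^ 5 * m ^ 4"
    using X0 C0 K_pos eps by (elim square_le_mult_imp_le) simp_all
  then show ?thesis by (simp add: X_def C_def)
qed

lemma pw_delta_square:
  "(\<lambda>t. (pw \<delta>1 t)\<^sup>2) integrable_on {0..d}" "integral {0..d} (\<lambda>t. (pw \<delta>1 t)\<^sup>2) = cell_form \<delta>1 \<delta>1"
proof -
  have "(\<lambda>t. pw \<delta>1 t * pw \<delta>1 t) absolutely_integrable_on {0..d}"
    by (rule pw_mult_integral(1)) (rule fem_deriv_continuous; assumption)+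
  then show "(\<lambda>t. (pw \<delta>1 t)\<^sup>2) integrable_on {0..d}"
    unfolding power2_eq_square by (rule abs_int_integrable)
  show "integral {0..d} (\<lambda>t. (pw \<delta>1 t)\<^sup>2) = cell_form \<delta>1 \<delta>1"
    unfolding power2_eq_square by (rule fem_form)
qed

lemma discrete_sup:
  assumes "t \<in> {0..d}"
  shows "\<bar>\<delta> t\<bar> \<le> 2 * K ^ 19 * \<epsilon>\<^sup>2 * m\<^sup>2"
proof (rule power2_le_imp_le)
  have "\<bar>\<delta> t\<bar>\<^sup>2 \<le> 2 * K / \<epsilon> * (integral {0..d} (\<lambda>t. (\<delta> t)\<^sup>2) + \<epsilon>\<^sup>2 * cell_form \<delta>1 \<delta>1)"
    using sup_energy_bound[OF eps fem_ac pw_delta_square(1) assms] unfolding pw_delta_square(2) by simp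
  also have "\<dots> \<le> 2 * K / \<epsilon> * (2 * K ^ 37 * \<epsilon> ^ 5 * m ^ 4)"
    using discrete_energy eps K_pos by (intro mult_left_mono) auto
  also have "\<dots> = (2 * K ^ 19 * \<epsilon>\<^sup>2 * m\<^sup>2)\<^sup>2"
    using eps by (simp add: eval_nat_numeral mult_ac)
  finally show "\<bar>\<delta> t\<bar>\<^sup>2 \<le> (2 * K ^ 19 * \<epsilon>\<^sup>2 * m\<^sup>2)\<^sup>2" .
qed (use K_pos in simp)

text \<open>Cells can be much shorter than \<open>h\<close>, so no inverse estimate bounds the derivative of \<open>\<delta>\<close> by its
energy. Instead the error equation is tested with the discrete function that has the nodal values 1 up
to node \<open>j\<close> and 0 afterwards. Integrating by parts on each cell, the sum of boundary terms consists of
increments of the derivative on the cells before \<open>j\<close>, which the WKB equation controls, and of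
the derivative of \<open>\<delta>\<close> at node \<open>j\<close>.\<close>

lemma discrete_derivative_sup:
  assumes j: "j \<in> {1..<N}" and t: "t \<in> {x j..x (j + 1)}"
    and B: "\<And>s. s \<in> {0..d} \<Longrightarrow> \<bar>\<eta> s + \<delta> s\<bar> \<le> B"
  shows "\<bar>\<delta>1 j t\<bar> \<le> K / \<epsilon> * \<bar>\<delta> 0\<bar> + 2 * K ^ 4 * B + 2 * K ^ 4 / \<epsilon>\<^sup>2 * integral {0..d} (\<lambda>s. \<bar>\<delta> s\<bar>)"
proof -
  define z where "z = (\<lambda>m. if m \<le> j then 1 else 0 :: real)"
  let ?\<theta> = "fem z" and ?\<theta>1 = "fem_deriv z"
  define g where "g = (\<lambda>s. 2 * K ^ 4 / \<epsilon>\<^sup>2 * \<bar>\<delta> s\<bar>)"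
  define G where "G = (\<lambda>s. (p s / \<epsilon>\<^sup>2 + r s) * \<delta> s)"
  have \<theta>: "\<bar>?\<theta> s\<bar> \<le> 2 * K\<^sup>2" if s: "s \<in> {0..d}" for s
  proof (cases "s < d")
    case True
    then obtain n where n: "n \<in> {1..<N}" "x n \<le> s" "s < x (n + 1)" using s by (auto elim: cell_cases)
    then have s': "s \<in> {x n..x (n + 1)}" by simp
    have "\<bar>z n * falling n s\<bar> \<le> K\<^sup>2" "\<bar>z (n + 1) * rising n s\<bar> \<le> K\<^sup>2"
      using local_bounds[OF n(1) s'] by (auto simp: z_def)
    then show ?thesis unfolding fem_cell[OF n(1) s'] by linarith
  next
    case False
    then have "?\<theta> s = z N" using fem_node[of N z] grid_ends s by simp
    moreover have "1 \<le> 2 * K\<^sup>2" using power_mono[OF K_ge, of 2] by simp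
    ultimately show ?thesis by (simp add: z_def)
  qed
  have gi: "g integrable_on {0..d}"
    unfolding g_def by (intro integrable_continuous_real continuous_intros fem_continuous)
  have gic: "g integrable_on {x n..x (n + 1)}" if "n \<in> {1..<N}" for n
    by (rule integrable_subinterval_real[OF gi]) (use cell_subset[OF that] in auto)
  have g0: "0 \<le> g s" for s using K_pos by (simp add: g_def)
  have Gg: "\<bar>G s\<bar> \<le> g s" if s: "s \<in> {0..d}" for s
  proof -
    have "p s / \<epsilon>\<^sup>2 \<le> K ^ 4 / \<epsilon>\<^sup>2" "0 \<le> p s / \<epsilon>\<^sup>2"
      using p_bounds[OF s] order_trans[of 0 "1 / K ^ 4" "p s"] K_pos by (auto intro!: divide_right_mono divide_nonneg_nonneg)
    moreover have "\<bar>r s\<bar> \<le> K ^ 4 / \<epsilon>\<^sup>2"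
    proof -
      have "K\<^sup>2 * \<epsilon>\<^sup>2 \<le> K ^ 4 * 1"
        using K_ge eps by (intro mult_mono power_increasing power_le_one) auto
      then have "K\<^sup>2 \<le> K ^ 4 / \<epsilon>\<^sup>2" using eps by (simp add: pos_le_divide_eq)
      then show ?thesis using r_bound[OF s] by linarith
    qed
    ultimately have "\<bar>p s / \<epsilon>\<^sup>2 + r s\<bar> \<le> 2 * (K ^ 4 / \<epsilon>\<^sup>2)" by linarith
    then have "\<bar>p s / \<epsilon>\<^sup>2 + r s\<bar> * \<bar>\<delta> s\<bar> \<le> 2 * (K ^ 4 / \<epsilon>\<^sup>2) * \<bar>\<delta> s\<bar>" by (rule mult_right_mono) simp
    then show ?thesis by (simp add: G_def g_def abs_mult)
  qed
  have inc: "\<bar>\<delta>1 n s - \<delta>1 n s'\<bar> \<le> integral {x n..x (n + 1)} g"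
    if n: "n \<in> {1..<N}" and s: "s \<in> {x n..x (n + 1)}" "s' \<in> {x n..x (n + 1)}" for n s s'
    by (rule ac_increment_bound[OF fem_cell_ac(2)[OF n] gic[OF n] _ s(2,1)])
       (use Gg[unfolded G_def] cell_subset[OF n] in blast)
  define T where "T = (\<Sum>n\<in>{1..<N}. \<delta>1 n (x (n + 1)) * z (n + 1) - \<delta>1 n (x n) * z n)"
  have cont: "continuous_on {0..d} (\<lambda>s. \<delta> s * ?\<theta> s)" "continuous_on {0..d} (\<lambda>s. \<eta> s * ?\<theta> s)"
    by (intro continuous_intros \<eta>_continuous fem_continuous)+
  have form: "cell_form \<delta>1 ?\<theta>1 = T - (1 / \<epsilon>\<^sup>2 * integral {0..d} (\<lambda>s. p s * (\<delta> s * ?\<theta> s)) + integral {0..d} (\<lambda>s. r s * (\<delta> s * ?\<theta> s)))"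
  proof -
    have "integral {x n..x (n + 1)} (\<lambda>s. \<delta>1 n s * ?\<theta>1 n s) =
        (\<delta>1 n (x (n + 1)) * z (n + 1) - \<delta>1 n (x n) * z n) - integral {x n..x (n + 1)} (\<lambda>s. (p s / \<epsilon>\<^sup>2 + r s) * (\<delta> s * ?\<theta> s))"
      if n: "n \<in> {1..<N}" for n
    proof -
      have i1: "(\<lambda>s. (p s / \<epsilon>\<^sup>2 + r s) * (\<delta> s * ?\<theta> s)) integrable_on {x n..x (n + 1)}"
        by (rule integrable_subinterval_real[OF zero_order_abs_int(4)[OF cont(1)]]) (use cell_subset[OF n] in auto)
      have i2: "(\<lambda>s. \<delta>1 n s * ?\<theta>1 n s) integrable_on {x n..x (n + 1)}"
        by (intro integrable_continuous_real continuous_intros fem_deriv_continuous n)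
      have nodes: "?\<theta> (x n) = z n" "?\<theta> (x (n + 1)) = z (n + 1)" using n by (auto intro!: fem_node)
      show ?thesis
        using integral_by_parts_ac[OF fem_cell_ac(2)[OF n, of w] fem_cell_ac(1)[OF n, of z]] cell_range(2)[OF n]
          HK_integral_add[OF i1 i2] nodes
        by (simp add: mult.assoc)
    qed
    then have "cell_form \<delta>1 ?\<theta>1 = T - (\<Sum>n\<in>{1..<N}. integral {x n..x (n + 1)} (\<lambda>s. (p s / \<epsilon>\<^sup>2 + r s) * (\<delta> s * ?\<theta> s)))"
      unfolding cell_form_def T_def sum_subtractf[symmetric] by (intro sum.cong) auto
    then show ?thesis
      unfolding integral_cells[OF zero_order_abs_int(4)[OF cont(1)], symmetric] zero_order_abs_int(3)[OF cont(1)] .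
  qed
  have \<theta>0: "?\<theta> 0 = 1" using fem_node[of 1 z] grid_ends j by (auto simp: z_def)
  have T: "T = integral {0..d} (\<lambda>s. r s * ((\<eta> s + \<delta> s) * ?\<theta> s)) - \<kappa> * \<delta> 0 / \<epsilon>"
  proof -
    have "integral {0..d} (\<lambda>s. r s * ((\<eta> s + \<delta> s) * ?\<theta> s))
        = integral {0..d} (\<lambda>s. r s * (\<eta> s * ?\<theta> s)) + integral {0..d} (\<lambda>s. r s * (\<delta> s * ?\<theta> s))"
      using HK_integral_add[OF zero_order_abs_int(2)[OF cont(2)] zero_order_abs_int(2)[OF cont(1)]]
      by (simp add: distrib_left distrib_right)
    moreover have "\<epsilon>\<^sup>2 * (T - (1 / \<epsilon>\<^sup>2 * P + R)) + P + \<epsilon> * \<kappa> * \<delta> 0 = \<epsilon>\<^sup>2 * Q \<Longrightarrow> T = Q + R - \<kappa> * \<delta> 0 / \<epsilon>" for P Q R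
    proof -
      assume a: "\<epsilon>\<^sup>2 * (T - (1 / \<epsilon>\<^sup>2 * P + R)) + P + \<epsilon> * \<kappa> * \<delta> 0 = \<epsilon>\<^sup>2 * Q"
      have "\<epsilon>\<^sup>2 * (T - (1 / \<epsilon>\<^sup>2 * P + R)) = \<epsilon>\<^sup>2 * T - P - \<epsilon>\<^sup>2 * R" using eps by (simp add: right_diff_distrib distrib_left)
      then have "\<epsilon> * (\<epsilon> * T + \<kappa> * \<delta> 0) = \<epsilon> * (\<epsilon> * (Q + R))"
        using a by (simp add: power2_eq_square algebra_simps)
      then have "\<epsilon> * T + \<kappa> * \<delta> 0 = \<epsilon> * (Q + R)" using eps mult_left_cancel[of \<epsilon>] by force
      then show "T = Q + R - \<kappa> * \<delta> 0 / \<epsilon>" using eps by (simp add: field_simps)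
    qed
    ultimately show ?thesis
      using error_equation[of z] unfolding form \<theta>0 by (simp add: mult.assoc)
  qed
  have Tj: "T = (\<Sum>n\<in>{1..<j}. \<delta>1 n (x (n + 1)) - \<delta>1 n (x n)) - \<delta>1 j (x j)"
  proof -
    have "T = (\<Sum>n\<in>{1..<Suc j}. \<delta>1 n (x (n + 1)) * z (n + 1) - \<delta>1 n (x n) * z n)"
      unfolding T_def by (rule sum.mono_neutral_right) (use j in \<open>auto simp: z_def\<close>)
    also have "\<dots> = (\<Sum>n\<in>{1..<j}. \<delta>1 n (x (n + 1)) * z (n + 1) - \<delta>1 n (x n) * z n) - \<delta>1 j (x j)"
      using j by (simp add: z_def)
    also have "(\<Sum>n\<in>{1..<j}. \<delta>1 n (x (n + 1)) * z (n + 1) - \<delta>1 n (x n) * z n) = (\<Sum>n\<in>{1..<j}. \<delta>1 n (x (n + 1)) - \<delta>1 n (x n))"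
      by (intro sum.cong) (auto simp: z_def)
    finally show ?thesis .
  qed
  have sumg: "\<bar>\<Sum>n\<in>{1..<j}. \<delta>1 n (x (n + 1)) - \<delta>1 n (x n)\<bar> + \<bar>\<delta>1 j t - \<delta>1 j (x j)\<bar> \<le> integral {0..d} g"
  proof -
    have "\<bar>\<Sum>n\<in>{1..<j}. \<delta>1 n (x (n + 1)) - \<delta>1 n (x n)\<bar> \<le> (\<Sum>n\<in>{1..<j}. integral {x n..x (n + 1)} g)"
    proof (rule order_trans[OF sum_abs], rule sum_mono)
      fix n assume "n \<in> {1..<j}"
      then have n: "n \<in> {1..<N}" using j by auto
      show "\<bar>\<delta>1 n (x (n + 1)) - \<delta>1 n (x n)\<bar> \<le> integral {x n..x (n + 1)} g"
        by (rule inc[OF n]) (use cell_range[OF n] in auto)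
    qed
    moreover have "\<bar>\<delta>1 j t - \<delta>1 j (x j)\<bar> \<le> integral {x j..x (j + 1)} g"
      by (rule inc[OF j t]) (use cell_range[OF j] in auto)
    moreover have "(\<Sum>n\<in>{1..<j}. integral {x n..x (n + 1)} g) + integral {x j..x (j + 1)} g = (\<Sum>n\<in>{1..<Suc j}. integral {x n..x (n + 1)} g)"
      using j by simp
    moreover have "\<dots> \<le> (\<Sum>n\<in>{1..<N}. integral {x n..x (n + 1)} g)"
      by (rule sum_mono2) (use j g0 gic in \<open>auto intro!: integral_nonneg\<close>)
    ultimately show ?thesis unfolding integral_cells[OF gi] by linarith
  qed
  have rB: "\<bar>integral {0..d} (\<lambda>s. r s * ((\<eta> s + \<delta> s) * ?\<theta> s))\<bar> \<le> 2 * K ^ 4 * B"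
  proof -
    have B0: "0 \<le> B" using B[of 0] d_pos by (smt (verit) atLeastAtMost_iff)
    have "norm (integral {0..d} (\<lambda>s. r s * ((\<eta> s + \<delta> s) * ?\<theta> s))) \<le> integral {0..d} (\<lambda>s. K\<^sup>2 * (B * (2 * K\<^sup>2)))"
    proof (rule integral_norm_bound_integral)
      show "(\<lambda>s. r s * ((\<eta> s + \<delta> s) * ?\<theta> s)) integrable_on {0..d}"
        by (intro zero_order_abs_int continuous_intros \<eta>_continuous fem_continuous)
      fix s assume s: "s \<in> {0..d}"
      show "norm (r s * ((\<eta> s + \<delta> s) * ?\<theta> s)) \<le> K\<^sup>2 * (B * (2 * K\<^sup>2))"
        unfolding real_norm_def abs_mult
        using r_bound[OF s] B[OF s] \<theta>[OF s] B0 by (intro mult_mono) auto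
    qed (rule integrable_const_ivl)
    also have "\<dots> = d * (2 * K ^ 4 * B)" using d_pos by (simp add: eval_nat_numeral mult_ac)
    also have "\<dots> \<le> 1 * (2 * K ^ 4 * B)" using d_less B0 by (intro mult_right_mono) auto
    finally show ?thesis by simp
  qed
  have "\<bar>\<kappa> * \<delta> 0 / \<epsilon>\<bar> \<le> K / \<epsilon> * \<bar>\<delta> 0\<bar>"
    using \<kappa> eps mult_right_mono[of \<kappa> K "\<bar>\<delta> 0\<bar>"] by (simp add: abs_mult divide_right_mono)
  moreover have "integral {0..d} g = 2 * K ^ 4 / \<epsilon>\<^sup>2 * integral {0..d} (\<lambda>s. \<bar>\<delta> s\<bar>)"
    unfolding g_def by (rule integral_mult_right)
  ultimately show ?thesis using T Tj sumg rB by linarith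
qed

definition e :: "real \<Rightarrow> real" where "e t = u t - fem c t"
definition e1 :: "nat \<Rightarrow> real \<Rightarrow> real" where "e1 n t = u1 t - fem_deriv c n t"

lemma e_split: "e t = \<eta> t + \<delta> t" "e1 n t = \<eta>1 n t + \<delta>1 n t"
  unfolding w_def[abs_def] by (simp_all add: e_def e1_def \<eta>_def \<eta>1_def fem_diff fem_deriv_diff)

lemma e1_continuous: "n \<in> {1..<N} \<Longrightarrow> continuous_on {x n..x (n + 1)} (e1 n)"
  unfolding e1_def[abs_def] by (intro continuous_intros continuous_cell[OF u1_continuous] fem_deriv_continuous)

lemma e_ac: "ac 0 d e (pw e1)"
proof (rule pw_cell_ac)
  fix n assume n: "n \<in> {1..<N}"
  show "ac (x n) (x (n + 1)) e (e1 n)"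
    unfolding e_def[abs_def] e1_def[abs_def]
    by (rule ac_diff[OF ac_subinterval[OF ac_u cell_range(1,3)[OF n]] fem_cell_ac(1)[OF n]])
qed

lemma square_sum_le: "(a + b)\<^sup>2 \<le> 2 * a\<^sup>2 + 2 * b\<^sup>2" for a b :: real
  using sum_squares_bound[of a b] by (simp add: power2_sum)

text \<open>All four bounds are stated with one common constant. Its power of \<open>K\<close> comes from the derivative of
\<open>\<delta>\<close> at single points.\<close>

lemma e_L2: "integral {0..d} (\<lambda>t. (e t)\<^sup>2) \<le> 1000 * K ^ 46 * (\<epsilon> * h\<^sup>2 * m\<^sup>2)"
proof -
  have i: "(\<lambda>t. (\<eta> t)\<^sup>2) integrable_on {0..d}" "(\<lambda>t. (\<delta> t)\<^sup>2) integrable_on {0..d}" "(\<lambda>t. (e t)\<^sup>2) integrable_on {0..d}"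
    by (intro integrable_continuous_real continuous_intros \<eta>_continuous fem_continuous ac_continuous[OF e_ac])+
  have C0: "0 \<le> \<epsilon>\<^sup>2 * cell_form \<delta>1 \<delta>1" by (simp add: cell_form_nonneg)
  have "integral {0..d} (\<lambda>t. (e t)\<^sup>2) \<le> integral {0..d} (\<lambda>t. 2 * (\<eta> t)\<^sup>2 + 2 * (\<delta> t)\<^sup>2)"
    by (rule integral_le[OF i(3)]) (use i square_sum_le in \<open>auto simp: e_split intro!: integrable_add integrable_on_mult_right\<close>)
  also have "\<dots> = 2 * integral {0..d} (\<lambda>t. (\<eta> t)\<^sup>2) + 2 * integral {0..d} (\<lambda>t. (\<delta> t)\<^sup>2)"
    using HK_integral_add[OF integrable_on_mult_right[OF i(1)] integrable_on_mult_right[OF i(2)], of 2 2] by simp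
  also have "\<dots> \<le> 4 * K ^ 25 * (\<epsilon> * m ^ 4) + 4 * K ^ 37 * (\<epsilon> ^ 5 * m ^ 4)"
    using interpolation_L2(1) discrete_energy C0 by (simp add: mult_ac)
  also have "\<dots> \<le> 4 * K ^ 46 * (\<epsilon> * m ^ 4) + 4 * K ^ 46 * (\<epsilon> ^ 1 * m ^ 4)"
    using K_ge eps m_bounds by (intro add_mono mult_mono power_increasing power_decreasing order_refl) auto
  also have "\<dots> = 8 * K ^ 46 * (\<epsilon> * (m\<^sup>2 * m\<^sup>2))" by (simp add: eval_nat_numeral mult_ac)
  also have "\<dots> \<le> 1000 * K ^ 46 * (\<epsilon> * (h\<^sup>2 * m\<^sup>2))"
    using m_bounds eps K_pos by (intro mult_mono power_mono order_refl) auto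
  finally show ?thesis by (simp add: mult.assoc)
qed

lemma e1_L2:
  "(\<lambda>t. (pw e1 t)\<^sup>2) absolutely_integrable_on {0..d}"
  "\<epsilon>\<^sup>2 * integral {0..d} (\<lambda>t. (pw e1 t)\<^sup>2) \<le> 1000 * K ^ 46 * (\<epsilon> ^ 3 * h\<^sup>2)"
proof -
  show "(\<lambda>t. (pw e1 t)\<^sup>2) absolutely_integrable_on {0..d}"
    unfolding power2_eq_square by (rule pw_mult_integral(1)) (rule e1_continuous; assumption)+
  have "integral {0..d} (\<lambda>t. (pw e1 t)\<^sup>2) = cell_form e1 e1"
    unfolding power2_eq_square by (rule integral_pw_mult) (rule e1_continuous; assumption)+
  also have "\<dots> \<le> (\<Sum>n\<in>{1..<N}. 2 * integral {x n..x (n + 1)} (\<lambda>t. \<eta>1 n t * \<eta>1 n t) + 2 * integral {x n..x (n + 1)} (\<lambda>t. \<delta>1 n t * \<delta>1 n t))"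
    unfolding cell_form_def
  proof (rule sum_mono)
    fix n assume n: "n \<in> {1..<N}"
    have i: "(\<lambda>t. \<eta>1 n t * \<eta>1 n t) integrable_on {x n..x (n + 1)}" "(\<lambda>t. \<delta>1 n t * \<delta>1 n t) integrable_on {x n..x (n + 1)}"
      "(\<lambda>t. e1 n t * e1 n t) integrable_on {x n..x (n + 1)}"
      by (intro integrable_continuous_real continuous_intros \<eta>1_continuous fem_deriv_continuous e1_continuous n)+
    have "integral {x n..x (n + 1)} (\<lambda>t. e1 n t * e1 n t) \<le> integral {x n..x (n + 1)} (\<lambda>t. 2 * (\<eta>1 n t * \<eta>1 n t) + 2 * (\<delta>1 n t * \<delta>1 n t))"
      by (rule integral_le[OF i(3)])
         (use i square_sum_le in \<open>auto simp: e_split power2_eq_square intro!: integrable_add integrable_on_mult_right\<close>)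
    then show "integral {x n..x (n + 1)} (\<lambda>t. e1 n t * e1 n t) \<le> 2 * integral {x n..x (n + 1)} (\<lambda>t. \<eta>1 n t * \<eta>1 n t) + 2 * integral {x n..x (n + 1)} (\<lambda>t. \<delta>1 n t * \<delta>1 n t)"
      using HK_integral_add[OF integrable_on_mult_right[OF i(1)] integrable_on_mult_right[OF i(2)], of 2 2] by simp
  qed
  also have "\<dots> = 2 * cell_form \<eta>1 \<eta>1 + 2 * cell_form \<delta>1 \<delta>1"
    by (simp add: cell_form_def sum.distrib sum_distrib_left)
  finally have "\<epsilon>\<^sup>2 * integral {0..d} (\<lambda>t. (pw e1 t)\<^sup>2) \<le> \<epsilon>\<^sup>2 * (2 * cell_form \<eta>1 \<eta>1 + 2 * cell_form \<delta>1 \<delta>1)"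
    by (rule mult_left_mono) simp
  also have "\<dots> = 2 * (\<epsilon>\<^sup>2 * cell_form \<eta>1 \<eta>1) + 2 * (\<epsilon>\<^sup>2 * cell_form \<delta>1 \<delta>1)" by (simp add: algebra_simps)
  also have "\<dots> \<le> 16 * K ^ 25 * (\<epsilon> ^ 3 * m\<^sup>2) + 4 * K ^ 37 * (\<epsilon> ^ 5 * m ^ 4)"
  proof -
    have "0 \<le> integral {0..d} (\<lambda>t. (\<delta> t)\<^sup>2)"
      by (intro integral_nonneg integrable_continuous_real continuous_intros fem_continuous) auto
    then show ?thesis using interpolation_L2(2) discrete_energy by (simp add: mult_ac)
  qed
  also have "\<dots> \<le> 16 * K ^ 46 * (\<epsilon> ^ 3 * m\<^sup>2) + 4 * K ^ 46 * (\<epsilon> ^ 3 * m\<^sup>2)"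
  proof -
    have "\<epsilon> ^ 5 * m ^ 4 \<le> \<epsilon> ^ 3 * m\<^sup>2"
      by (rule mult_mono[OF power_decreasing power_decreasing]) (use eps m_bounds in auto)
    moreover have "4 * K ^ 37 \<le> 4 * K ^ 46" "16 * K ^ 25 \<le> 16 * K ^ 46"
      using power_increasing[of 37 46 K] power_increasing[of 25 46 K] K_ge by auto
    ultimately show ?thesis
      using eps K_pos by (intro add_mono mult_mono[of "4 * K ^ 37"] mult_right_mono[of "16 * K ^ 25"]) auto
  qed
  also have "\<dots> = 20 * K ^ 46 * (\<epsilon> ^ 3 * m\<^sup>2)" by simp
  also have "\<dots> \<le> 1000 * K ^ 46 * (\<epsilon> ^ 3 * h\<^sup>2)"
    using m_bounds eps K_pos by (intro mult_mono power_mono order_refl) auto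
  finally show "\<epsilon>\<^sup>2 * integral {0..d} (\<lambda>t. (pw e1 t)\<^sup>2) \<le> 1000 * K ^ 46 * (\<epsilon> ^ 3 * h\<^sup>2)" .
qed

lemma e_sup:
  assumes t: "t \<in> {0..d}"
  shows "(e t)\<^sup>2 \<le> 1000 * K ^ 46 * (h * m ^ 3)"
proof -
  have "(e t)\<^sup>2 \<le> 2 * (\<eta> t)\<^sup>2 + 2 * \<bar>\<delta> t\<bar>\<^sup>2" using square_sum_le by (simp add: e_split)
  also have "\<dots> \<le> 2 * (8 * K ^ 26 * m ^ 3 * h) + 2 * (2 * K ^ 19 * \<epsilon>\<^sup>2 * m\<^sup>2)\<^sup>2"
    using interpolation_sup(1)[OF t] discrete_sup[OF t] by (intro add_mono mult_left_mono power_mono) auto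
  also have "\<dots> = 16 * K ^ 26 * (h * m ^ 3) + 8 * K ^ 38 * (\<epsilon> ^ 4 * (m * m ^ 3))"
    by (simp add: eval_nat_numeral mult_ac)
  also have "\<dots> \<le> 16 * K ^ 46 * (h * m ^ 3) + 8 * K ^ 46 * (1 * (h * m ^ 3))"
    using K_ge eps m_bounds mesh_bounds
    by (intro add_mono mult_mono power_increasing power_le_one order_refl) auto
  also have "\<dots> \<le> 1000 * K ^ 46 * (h * m ^ 3)" using m_bounds mesh_bounds K_pos by simp
  finally show ?thesis .
qed

text \<open>The geometric mean \<open>R\<close> of \<open>m\<close> and \<open>h\<close> is the order to be shown; all terms of the bound for the
derivative of \<open>\<delta>\<close> are compared with it.\<close>

lemma e1_sup:
  assumes t: "t \<in> {0..d}"
  shows "(pw e1 t)\<^sup>2 \<le> 1000 * K ^ 46 * (h * m)"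
proof (rule pw_in_range[OF t])
  show "0\<^sup>2 \<le> 1000 * K ^ 46 * (h * m)" using K_pos mesh_bounds m_bounds by simp
  fix n t assume n: "n \<in> {1..<N}" and t: "t \<in> {x n..x (n + 1)}"
  define R where "R = sqrt (m * h)"
  have R2: "R\<^sup>2 = m * h" using m_bounds mesh_bounds by (simp add: R_def)
  have mR: "m \<le> R" unfolding R_def using m_bounds by (intro real_le_rsqrt) (simp add: power2_eq_square)
  have m2R: "m\<^sup>2 \<le> R" 
  proof -
    have "m * m \<le> m * 1" using m_bounds by (intro mult_left_mono) auto
    then show ?thesis using mR by (simp add: power2_eq_square)
  qed
  have e2: "\<epsilon>\<^sup>2 \<le> 1" using eps by (simp add: power_le_one)
  have R0: "0 < R" using mR m_bounds by simp
  have B: "\<bar>\<eta> s + \<delta> s\<bar> \<le> 5 * K ^ 19 * R" if s: "s \<in> {0..d}" for s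
  proof -
    have "\<bar>\<eta> s\<bar> \<le> 3 * K ^ 13 * R"
    proof (rule power2_le_imp_le)
      have "m ^ 3 \<le> m ^ 1" using m_bounds by (intro power_decreasing) auto
      then have "8 * K ^ 26 * m ^ 3 * h \<le> 9 * K ^ 26 * m * h"
        using m_bounds mesh_bounds K_pos by (intro mult_mono) auto
      also have "\<dots> = (3 * K ^ 13 * R)\<^sup>2" using R2 by (simp add: power_mult_distrib flip: power_mult)
      finally show "\<bar>\<eta> s\<bar>\<^sup>2 \<le> (3 * K ^ 13 * R)\<^sup>2" using interpolation_sup(1)[OF s] by simp
    qed (use R0 K_pos in simp)
    also have "\<dots> \<le> 3 * K ^ 19 * R" using R0 K_ge by (intro mult_mono power_increasing) auto
    finally have 1: "\<bar>\<eta> s\<bar> \<le> 3 * K ^ 19 * R" .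
    have "2 * K ^ 19 * (\<epsilon>\<^sup>2 * m\<^sup>2) \<le> 2 * K ^ 19 * (1 * R)"
      using e2 m2R K_pos by (intro mult_left_mono mult_mono) auto
    then have "\<bar>\<delta> s\<bar> \<le> 2 * K ^ 19 * R" using discrete_sup[OF s] by (simp add: mult.assoc)
    then show ?thesis using 1 by linarith
  qed
  have I: "integral {0..d} (\<lambda>s. \<bar>\<delta> s\<bar>) \<le> 2 * K ^ 19 * \<epsilon>\<^sup>2 * m\<^sup>2"
  proof -
    have "integral {0..d} (\<lambda>s. \<bar>\<delta> s\<bar>) \<le> integral {0..d} (\<lambda>s. 2 * K ^ 19 * \<epsilon>\<^sup>2 * m\<^sup>2)"
      using discrete_sup by (intro integral_le integrable_continuous_real continuous_intros fem_continuous) auto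
    also have "\<dots> = d * (2 * K ^ 19 * \<epsilon>\<^sup>2 * m\<^sup>2)" using d_pos by simp
    also have "\<dots> \<le> 1 * (2 * K ^ 19 * \<epsilon>\<^sup>2 * m\<^sup>2)"
      using d_less K_pos by (intro mult_right_mono) auto
    finally show ?thesis by simp
  qed
  have "\<bar>\<delta>1 n t\<bar> \<le> K / \<epsilon> * \<bar>\<delta> 0\<bar> + 2 * K ^ 4 * (5 * K ^ 19 * R) + 2 * K ^ 4 / \<epsilon>\<^sup>2 * integral {0..d} (\<lambda>s. \<bar>\<delta> s\<bar>)"
    by (rule discrete_derivative_sup[OF n t B])
  also have "\<dots> \<le> K / \<epsilon> * (2 * K ^ 19 * \<epsilon>\<^sup>2 * m\<^sup>2) + 2 * K ^ 4 * (5 * K ^ 19 * R) + 2 * K ^ 4 / \<epsilon>\<^sup>2 * (2 * K ^ 19 * \<epsilon>\<^sup>2 * m\<^sup>2)"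
    using discrete_sup[of 0] d_pos I eps K_pos by (intro add_mono mult_left_mono order_refl) auto
  also have "\<dots> = 2 * K ^ 20 * (\<epsilon> * m\<^sup>2) + 10 * K ^ 23 * R + 4 * K ^ 23 * m\<^sup>2"
    using eps by (simp add: eval_nat_numeral mult_ac)
  also have "\<dots> \<le> 2 * K ^ 23 * (1 * R) + 10 * K ^ 23 * R + 4 * K ^ 23 * R"
    using K_ge eps m2R R0 by (intro add_mono mult_mono power_increasing order_refl) auto
  also have "\<dots> = 16 * K ^ 23 * R" by simp
  finally have "\<bar>\<delta>1 n t\<bar>\<^sup>2 \<le> (16 * K ^ 23 * R)\<^sup>2" by (intro power_mono) auto
  also have "\<dots> = 256 * K ^ 46 * (m * h)" using R2 by (simp add: power_mult_distrib flip: power_mult)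
  finally have \<delta>: "(\<delta>1 n t)\<^sup>2 \<le> 256 * K ^ 46 * (m * h)" by simp
  have "(\<eta>1 n t)\<^sup>2 \<le> 56 * K ^ 26 * (m * h)"
    using interpolation_sup(2)[OF n t] by (simp add: mult.assoc)
  also have "\<dots> \<le> 56 * K ^ 46 * (m * h)"
    using K_ge m_bounds mesh_bounds by (intro mult_right_mono mult_left_mono power_increasing) auto
  finally have "(e1 n t)\<^sup>2 \<le> 2 * (56 * K ^ 46 * (m * h)) + 2 * (256 * K ^ 46 * (m * h))"
    using square_sum_le[of "\<eta>1 n t" "\<delta>1 n t"] \<delta> unfolding e_split by linarith
  also have "\<dots> \<le> 1000 * K ^ 46 * (m * h)" using m_bounds mesh_bounds K_pos by simp
  finally show "(e1 n t)\<^sup>2 \<le> 1000 * K ^ 46 * (h * m)" by (simp add: mult_ac)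
qed

end

lemma (in wkb_galerkin) galerkin_error:
  "\<exists>D. ac 0 d (\<lambda>t. u t - fem c t) D \<and> (\<lambda>t. (D t)\<^sup>2) absolutely_integrable_on {0..d} \<and>
     integral {0..d} (\<lambda>t. (u t - fem c t)\<^sup>2) \<le> 1000 * K ^ 46 * (\<epsilon> * h\<^sup>2 * (min \<epsilon> h)\<^sup>2) \<and>
     \<epsilon>\<^sup>2 * integral {0..d} (\<lambda>t. (D t)\<^sup>2) \<le> 1000 * K ^ 46 * (\<epsilon> ^ 3 * h\<^sup>2) \<and>
     (\<forall>t\<in>{0..d}. (u t - fem c t)\<^sup>2 \<le> 1000 * K ^ 46 * (h * min \<epsilon> h ^ 3) \<and>
       (D t)\<^sup>2 \<le> 1000 * K ^ 46 * (h * min \<epsilon> h))"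
  using e_ac e_L2 e1_L2 e_sup e1_sup unfolding e_def[abs_def] m_def by blast

section \<open>Complex solutions and norms\<close>

lemma b_real_cong:
  assumes "\<And>t. t \<in> {0..d} \<Longrightarrow> p t = p' t" "\<And>t. t \<in> {0..d} \<Longrightarrow> u t = u' t" "\<And>t. t \<in> {0..d} \<Longrightarrow> \<theta> t = \<theta>' t" "0 \<le> d"
  shows "b_real d \<epsilon> p \<kappa> u u1 \<theta> \<theta>1 = b_real d \<epsilon> p' \<kappa> u' u1 \<theta>' \<theta>1"
proof -
  have "integral {0..d} (\<lambda>t. p t * u t * \<theta> t) = integral {0..d} (\<lambda>t. p' t * u' t * \<theta>' t)"
    by (rule HK_integral_cong) (simp add: assms)
  then show ?thesis using assms by (simp add: b_real_def)
qed

lemma L_form_real: "L_form d \<epsilon> (\<lambda>t. complex_of_real (\<theta> t)) = Complex (\<epsilon> * \<theta> d) 0"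
  by (simp add: L_form_def complex_eq_iff)

context wkb_coefficient
begin

lemma exact_solution_classical:
  assumes \<epsilon>: "0 < \<epsilon>" and V: "continuous_on {0..d} V" "\<And>t. t \<in> {0..d} \<Longrightarrow> V t - E = p t"
    and ex: "is_exact_solution d E V a0 \<epsilon> v"
  obtains f g where
    "ac 0 d (\<lambda>t. Re (v t)) f" "ac 0 d f (\<lambda>t. p t / \<epsilon>\<^sup>2 * Re (v t))"
    "\<epsilon> * f 0 = sqrt \<bar>a0\<bar> * Re (v 0)" "\<epsilon> * f d = 1"
    "ac 0 d (\<lambda>t. Im (v t)) g" "ac 0 d g (\<lambda>t. p t / \<epsilon>\<^sup>2 * Im (v t))"
    "\<epsilon> * g 0 = sqrt \<bar>a0\<bar> * Im (v 0)" "\<epsilon> * g d = 0"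
proof -
  obtain f0 g0 where fg: "ac 0 d (\<lambda>t. Re (v t)) f0" "ac 0 d (\<lambda>t. Im (v t)) g0"
    using H1_ac_parts[OF d_pos] ex unfolding is_exact_solution_def by blast
  have cV: "continuous_on {0..d} (\<lambda>t. V t - E)" using V by (intro continuous_intros)
  have eq: "b_real d \<epsilon> (\<lambda>t. V t - E) (sqrt \<bar>a0\<bar>) (\<lambda>t. Re (v t)) f0 \<theta> \<theta>1 = \<epsilon> * 1 * \<theta> d \<and>
      b_real d \<epsilon> (\<lambda>t. V t - E) (sqrt \<bar>a0\<bar>) (\<lambda>t. Im (v t)) g0 \<theta> \<theta>1 = \<epsilon> * 0 * \<theta> d"
    if \<theta>: "ac 0 d \<theta> \<theta>1" "continuous_on {0..d} \<theta>1" for \<theta> \<theta>1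
  proof -
    have "b_form d E V a0 \<epsilon> v (\<lambda>t. complex_of_real (\<theta> t)) = L_form d \<epsilon> (\<lambda>t. complex_of_real (\<theta> t))"
      using ex C1_in_H1[OF d_pos \<theta>] unfolding is_exact_solution_def by blast
    then show ?thesis
      unfolding L_form_real
      by (subst (asm) b_form_real_test[OF d_pos V(1) fg \<theta>(1)])
         (auto intro: abs_int_mult_continuous(1) ac_integrable fg \<theta>(2))
  qed
  have "\<exists>w1. ac 0 d w w1 \<and> ac 0 d w1 (\<lambda>t. p t / \<epsilon>\<^sup>2 * w t) \<and> \<epsilon> * w1 0 = sqrt \<bar>a0\<bar> * w 0 \<and> \<epsilon> * w1 d = l"
    if w: "ac 0 d w w0" and weq: "\<And>\<theta> \<theta>1. ac 0 d \<theta> \<theta>1 \<Longrightarrow> continuous_on {0..d} \<theta>1 \<Longrightarrow>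
      b_real d \<epsilon> (\<lambda>t. V t - E) (sqrt \<bar>a0\<bar>) w w0 \<theta> \<theta>1 = \<epsilon> * l * \<theta> d" for w w0 l
  proof -
    obtain w1 where w1: "ac 0 d w w1" "ac 0 d w1 (\<lambda>t. (V t - E) * w t / \<epsilon>\<^sup>2)" "\<epsilon> * w1 0 = sqrt \<bar>a0\<bar> * w 0" "\<epsilon> * w1 d = l"
      using weak_solution_classical[OF d_pos \<epsilon> cV w weq] by blast
    have "ac 0 d w1 (\<lambda>t. p t / \<epsilon>\<^sup>2 * w t)"
      by (rule ac_cong[OF w1(2)]) (simp_all add: V(2))
    with w1 show ?thesis by blast
  qed
  from this[OF fg(1), of 1] this[OF fg(2), of 0] eq that show ?thesis by blast
qed

end

context wkb_grid
begin

text \<open>The phase functions of the method are scaled differences of one global phase \<open>S\<close>, as the integrand is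
\<open>1 / q\<^sup>2\<close>.\<close>

lemma wkb_sigma_eq:
  assumes V: "\<And>t. t \<in> {0..d} \<Longrightarrow> V t - E = p t" and n: "n \<in> {1..N}" and t: "t \<in> {0..d}"
  shows "wkb_sigma E V \<epsilon> x n t = (S t - S (x n)) / \<epsilon>"
proof -
  let ?s = "\<lambda>y. sqrt \<bar>coef E V y\<bar>"
  have s: "?s y = 1 / (q y)\<^sup>2" if "y \<in> {0..d}" for y
  proof -
    have "\<bar>coef E V y\<bar> = (1 / (q y)\<^sup>2)\<^sup>2"
    proof -
      have "coef E V y = - (1 / q y ^ 4)" using V[OF that] unfolding coef_def p_def by linarith
      then show ?thesis by (simp add: power_divide flip: power_mult)
    qed
    then show ?thesis by simp
  qed
  have cs: "continuous_on {0..d} (\<lambda>y. 1 / (q y)\<^sup>2)"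
    using q_pos by (auto intro!: continuous_intros q_continuous simp: less_le)
  have Sac: "ac 0 d S (\<lambda>y. 1 / (q y)\<^sup>2)" by (rule ac_C1[OF _ cs]) (use S_derivative in auto)
  have *: "(LBINT y=a..b. ?s y) = S b - S a" if "a \<in> {0..d}" "b \<in> {0..d}" "a \<le> b" for a b
  proof -
    have "continuous_on {a..b} ?s"
      using continuous_on_subset[OF cs, of "{a..b}"] that
      by (subst continuous_on_cong[OF refl, of _ _ "\<lambda>y. 1 / (q y)\<^sup>2"]) (auto simp: s)
    then have "(LBINT y=a..b. ?s y) = integral {a..b} ?s"
      using that by (intro interval_integral_eq_integral borel_integrable_atLeastAtMost') auto
    also have "\<dots> = integral {a..b} (\<lambda>y. 1 / (q y)\<^sup>2)"
      by (rule HK_integral_cong) (use that s in auto)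
    also have "\<dots> = S b - S a" by (rule ac_integral[OF Sac]) (use that in auto)
    finally show ?thesis .
  qed
  have "(LBINT y=x n..t. ?s y) = S t - S (x n)"
  proof (cases "x n \<le> t")
    case True
    then show ?thesis using * t grid_range[OF n] by simp
  next
    case False
    then show ?thesis using *[OF t grid_range[OF n]]
      by (subst interval_integral_endpoints_reverse) simp
  qed
  then show ?thesis by (simp add: wkb_sigma_def)
qed

lemma wkb_hat_eq:
  assumes V: "\<And>t. t \<in> {0..d} \<Longrightarrow> V t - E = p t" and n: "n \<in> {1..N}" and t: "t \<in> {0..d}"
  shows "wkb_hat E V \<epsilon> N x n t = hat n t"
proof -
  have \<sigma>: "wkb_sigma E V \<epsilon> x k s = (S s - S (x k)) / \<epsilon>" if "k \<in> {1..N}" "s \<in> {0..d}" for k s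
    using wkb_sigma_eq V that by blast
  have pq: "(V s - E) powr (1 / 4) = 1 / q s" if "s \<in> {0..d}" for s
  proof -
    have "V s - E = (1 / q s) powr 4" using V[OF that] q_pos[OF that] by (simp add: p_def power_divide)
    then have "(V s - E) powr (1 / 4) = (1 / q s) powr (4 * (1 / 4))" by (simp only: powr_powr)
    then show ?thesis using q_pos[OF that] by simp
  qed
  have q: "wkb_q E V x k t = q t / q (x k)" if "k \<in> {1..N}" for k
    unfolding wkb_q_def pq[OF grid_range[OF that]] pq[OF t] by simp
  have g: "wkb_gamma E V \<epsilon> x k = \<gamma> k" if "k \<in> {1..<N}" for k
    using \<sigma>[of k "x (k + 1)"] grid_range[of "k + 1"] that
    by (simp add: wkb_gamma_def wkb_sigma_def \<gamma>_def)
  have v: "wkb_v E V \<epsilon> x k t = rising k t" if k: "k \<in> {1..<N}" for k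
  proof -
    have k': "k \<in> {1..N}" "k + 1 \<in> {1..N}" using k by auto
    show ?thesis unfolding wkb_v_def wkb_beta_def g[OF k] q[OF k'(2)] \<sigma>[OF k'(1) t] rising_def by (simp add: mult_ac)
  qed
  have w: "wkb_w E V \<epsilon> x k t = falling k t" if k: "k \<in> {1..<N}" for k
  proof -
    have k': "k \<in> {1..N}" "k + 1 \<in> {1..N}" using k by auto
    show ?thesis unfolding wkb_w_def wkb_alpha_def g[OF k] q[OF k'(1)] \<sigma>[OF k'(2) t] falling_def by (simp add: mult_ac)
  qed
  show ?thesis
  proof -
    have "wkb_v E V \<epsilon> x (n - 1) t = rising (n - 1) t" if "1 < n" by (rule v) (use that n in auto)
    moreover have "wkb_w E V \<epsilon> x n t = falling n t" if "n < N" by (rule w) (use that n in auto)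
    ultimately show ?thesis unfolding wkb_hat_def hat_def by simp
  qed
qed

text \<open>Coefficient and hat functions are real. So the real and the imaginary part of both solutions satisfy
the real problem, with loads 1 and 0.\<close>

lemma complex_galerkin_error:
  assumes V: "continuous_on {0..d} V" "\<And>t. t \<in> {0..d} \<Longrightarrow> V t - E = p t"
    and a0: "sqrt \<bar>a0\<bar> \<le> K"
    and ex: "is_exact_solution d E V a0 \<epsilon> v" and fe: "is_wkb_fem_solution d E V a0 \<epsilon> N x vh"
  obtains F G where
    "ac 0 d (\<lambda>t. Re (v t - vh t)) F" "ac 0 d (\<lambda>t. Im (v t - vh t)) G"
    "(\<lambda>t. (norm (Complex (F t) (G t)))\<^sup>2) absolutely_integrable_on {0..d}"
    "integral {0..d} (\<lambda>t. (norm (v t - vh t))\<^sup>2) \<le> 2000 * K ^ 46 * (\<epsilon> * h\<^sup>2 * (min \<epsilon> h)\<^sup>2)"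
    "\<epsilon>\<^sup>2 * integral {0..d} (\<lambda>t. (norm (Complex (F t) (G t)))\<^sup>2) \<le> 2000 * K ^ 46 * (\<epsilon> ^ 3 * h\<^sup>2)"
    "\<And>t. t \<in> {0..d} \<Longrightarrow> (norm (v t - vh t))\<^sup>2 \<le> 2000 * K ^ 46 * (h * min \<epsilon> h ^ 3)"
    "\<And>t. t \<in> {0..d} \<Longrightarrow> (norm (Complex (F t) (G t)))\<^sup>2 \<le> 2000 * K ^ 46 * (h * min \<epsilon> h)"
proof -
  obtain f g where fg:
    "ac 0 d (\<lambda>t. Re (v t)) f" "ac 0 d f (\<lambda>t. p t / \<epsilon>\<^sup>2 * Re (v t))"
    "\<epsilon> * f 0 = sqrt \<bar>a0\<bar> * Re (v 0)" "\<epsilon> * f d = 1"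
    "ac 0 d (\<lambda>t. Im (v t)) g" "ac 0 d g (\<lambda>t. p t / \<epsilon>\<^sup>2 * Im (v t))"
    "\<epsilon> * g 0 = sqrt \<bar>a0\<bar> * Im (v 0)" "\<epsilon> * g d = 0"
    using exact_solution_classical[OF eps(1) V ex] by blast
  obtain z where vh: "vh = (\<lambda>t. \<Sum>n=1..N. z n * of_real (wkb_hat E V \<epsilon> N x n t))"
    using fe unfolding is_wkb_fem_solution_def wkb_space_def by blast
  have hats: "wkb_hat E V \<epsilon> N x n t = hat n t" if "n \<in> {1..N}" "t \<in> {0..d}" for n t
    using wkb_hat_eq V(2) that by blast
  define zr where "zr = (\<lambda>n. Re (z n))"
  define zi where "zi = (\<lambda>n. Im (z n))"
  have Rvh: "Re (vh t) = fem zr t" and Ivh: "Im (vh t) = fem zi t" if "t \<in> {0..d}" for t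
  proof -
    show "Re (vh t) = fem zr t"
      unfolding vh fem_def zr_def Re_sum by (intro sum.cong refl) (subst hats[OF _ that]; simp)
    show "Im (vh t) = fem zi t"
      unfolding vh fem_def zi_def Im_sum by (intro sum.cong refl) (subst hats[OF _ that]; simp)
  qed
  have acR: "ac 0 d (\<lambda>t. Re (vh t)) (pw (fem_deriv zr))" by (rule ac_cong[OF fem_ac]) (simp_all add: Rvh)
  have acI: "ac 0 d (\<lambda>t. Im (vh t)) (pw (fem_deriv zi))" by (rule ac_cong[OF fem_ac]) (simp_all add: Ivh)
  have gal: "b_real d \<epsilon> p (sqrt \<bar>a0\<bar>) (fem zr) (pw (fem_deriv zr)) (fem y) (pw (fem_deriv y)) = \<epsilon> * 1 * fem y d \<and>
     b_real d \<epsilon> p (sqrt \<bar>a0\<bar>) (fem zi) (pw (fem_deriv zi)) (fem y) (pw (fem_deriv y)) = \<epsilon> * 0 * fem y d" for y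
  proof -
    define \<theta> where "\<theta> t = (\<Sum>n=1..N. y n * wkb_hat E V \<epsilon> N x n t)" for t
    have \<theta>: "\<theta> t = fem y t" if "t \<in> {0..d}" for t
      unfolding \<theta>_def fem_def by (intro sum.cong refl) (subst hats[OF _ that]; simp)
    have "(\<lambda>t. complex_of_real (\<theta> t)) \<in> wkb_space E V \<epsilon> N x"
      unfolding wkb_space_def
      by (rule range_eqI[where x="\<lambda>n. complex_of_real (y n)"]) (simp add: \<theta>_def)
    then have eq: "b_form d E V a0 \<epsilon> vh (\<lambda>t. complex_of_real (\<theta> t)) = L_form d \<epsilon> (\<lambda>t. complex_of_real (\<theta> t))"
      using fe unfolding is_wkb_fem_solution_def by blast
    have ac\<theta>: "ac 0 d \<theta> (pw (fem_deriv y))" by (rule ac_cong[OF fem_ac]) (simp_all add: \<theta>)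
    have i: "(\<lambda>t. pw (fem_deriv w) t * pw (fem_deriv y) t) absolutely_integrable_on {0..d}" for w
      by (rule pw_mult_integral(1)) (rule fem_deriv_continuous; assumption)+
    have "b_real d \<epsilon> (\<lambda>t. V t - E) (sqrt \<bar>a0\<bar>) (\<lambda>t. Re (vh t)) (pw (fem_deriv zr)) \<theta> (pw (fem_deriv y)) = \<epsilon> * \<theta> d \<and>
      b_real d \<epsilon> (\<lambda>t. V t - E) (sqrt \<bar>a0\<bar>) (\<lambda>t. Im (vh t)) (pw (fem_deriv zi)) \<theta> (pw (fem_deriv y)) = 0"
      using eq unfolding L_form_real b_form_real_test[OF d_pos V(1) acR acI ac\<theta> i i] by simp
    moreover have "b_real d \<epsilon> (\<lambda>t. V t - E) (sqrt \<bar>a0\<bar>) (\<lambda>t. Re (vh t)) (pw (fem_deriv zr)) \<theta> (pw (fem_deriv y))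
      = b_real d \<epsilon> p (sqrt \<bar>a0\<bar>) (fem zr) (pw (fem_deriv zr)) (fem y) (pw (fem_deriv y))"
      by (rule b_real_cong) (use V(2) Rvh \<theta> d_pos in auto)
    moreover have "b_real d \<epsilon> (\<lambda>t. V t - E) (sqrt \<bar>a0\<bar>) (\<lambda>t. Im (vh t)) (pw (fem_deriv zi)) \<theta> (pw (fem_deriv y))
      = b_real d \<epsilon> p (sqrt \<bar>a0\<bar>) (fem zi) (pw (fem_deriv zi)) (fem y) (pw (fem_deriv y))"
      by (rule b_real_cong) (use V(2) Ivh \<theta> d_pos in auto)
    ultimately show ?thesis using \<theta>[of d] d_pos by simp
  qed
  interpret Re: wkb_galerkin d K q q1 q2 \<epsilon> N x "\<lambda>t. Re (v t)" f "sqrt \<bar>a0\<bar>" 1 zr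
    by unfold_locales (use fg a0 gal in auto)
  interpret Im: wkb_galerkin d K q q1 q2 \<epsilon> N x "\<lambda>t. Im (v t)" g "sqrt \<bar>a0\<bar>" 0 zi
    by unfold_locales (use fg a0 gal in auto)
  let ?C = "1000 * K ^ 46"
  obtain F where F: "ac 0 d (\<lambda>t. Re (v t) - fem zr t) F" "(\<lambda>t. (F t)\<^sup>2) absolutely_integrable_on {0..d}"
     "integral {0..d} (\<lambda>t. (Re (v t) - fem zr t)\<^sup>2) \<le> ?C * (\<epsilon> * h\<^sup>2 * (min \<epsilon> h)\<^sup>2)"
     "\<epsilon>\<^sup>2 * integral {0..d} (\<lambda>t. (F t)\<^sup>2) \<le> ?C * (\<epsilon> ^ 3 * h\<^sup>2)"
     "\<And>t. t \<in> {0..d} \<Longrightarrow> (Re (v t) - fem zr t)\<^sup>2 \<le> ?C * (h * min \<epsilon> h ^ 3)"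
     "\<And>t. t \<in> {0..d} \<Longrightarrow> (F t)\<^sup>2 \<le> ?C * (h * min \<epsilon> h)"
    using Re.galerkin_error by blast
  obtain G where G: "ac 0 d (\<lambda>t. Im (v t) - fem zi t) G" "(\<lambda>t. (G t)\<^sup>2) absolutely_integrable_on {0..d}"
     "integral {0..d} (\<lambda>t. (Im (v t) - fem zi t)\<^sup>2) \<le> ?C * (\<epsilon> * h\<^sup>2 * (min \<epsilon> h)\<^sup>2)"
     "\<epsilon>\<^sup>2 * integral {0..d} (\<lambda>t. (G t)\<^sup>2) \<le> ?C * (\<epsilon> ^ 3 * h\<^sup>2)"
     "\<And>t. t \<in> {0..d} \<Longrightarrow> (Im (v t) - fem zi t)\<^sup>2 \<le> ?C * (h * min \<epsilon> h ^ 3)"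
     "\<And>t. t \<in> {0..d} \<Longrightarrow> (G t)\<^sup>2 \<le> ?C * (h * min \<epsilon> h)"
    using Im.galerkin_error by blast
  have n1: "(norm (v t - vh t))\<^sup>2 = (Re (v t) - fem zr t)\<^sup>2 + (Im (v t) - fem zi t)\<^sup>2" if "t \<in> {0..d}" for t
    using Rvh[OF that] Ivh[OF that] by (simp add: cmod_power2)
  have n2: "(norm (Complex (F t) (G t)))\<^sup>2 = (F t)\<^sup>2 + (G t)\<^sup>2" for t by (simp add: cmod_power2)
  have c: "(\<lambda>t. (Re (v t) - fem zr t)\<^sup>2) integrable_on {0..d}" "(\<lambda>t. (Im (v t) - fem zi t)\<^sup>2) integrable_on {0..d}"
    by (intro integrable_continuous_real continuous_intros ac_continuous[OF F(1)] ac_continuous[OF G(1)])+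
  have I1: "integral {0..d} (\<lambda>t. (norm (v t - vh t))\<^sup>2) = integral {0..d} (\<lambda>t. (Re (v t) - fem zr t)\<^sup>2) + integral {0..d} (\<lambda>t. (Im (v t) - fem zi t)\<^sup>2)"
    unfolding HK_integral_add[OF c, symmetric]
    by (rule HK_integral_cong) (rule n1)
  have I2: "integral {0..d} (\<lambda>t. (norm (Complex (F t) (G t)))\<^sup>2) = integral {0..d} (\<lambda>t. (F t)\<^sup>2) + integral {0..d} (\<lambda>t. (G t)\<^sup>2)"
    unfolding n2 by (rule HK_integral_add[OF abs_int_integrable[OF F(2)] abs_int_integrable[OF G(2)]])
  show ?thesis
  proof (rule that)
    show "ac 0 d (\<lambda>t. Re (v t - vh t)) F" by (rule ac_cong[OF F(1)]) (simp_all add: Rvh)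
    show "ac 0 d (\<lambda>t. Im (v t - vh t)) G" by (rule ac_cong[OF G(1)]) (simp_all add: Ivh)
    show "(\<lambda>t. (norm (Complex (F t) (G t)))\<^sup>2) absolutely_integrable_on {0..d}"
      unfolding n2 using F(2) G(2) by (rule set_integral_add)
    show "integral {0..d} (\<lambda>t. (norm (v t - vh t))\<^sup>2) \<le> 2000 * K ^ 46 * (\<epsilon> * h\<^sup>2 * (min \<epsilon> h)\<^sup>2)"
      unfolding I1 using F(3) G(3) by linarith
    show "\<epsilon>\<^sup>2 * integral {0..d} (\<lambda>t. (norm (Complex (F t) (G t)))\<^sup>2) \<le> 2000 * K ^ 46 * (\<epsilon> ^ 3 * h\<^sup>2)"
      unfolding I2 distrib_left using F(4) G(4) by linarith
    fix t assume t: "t \<in> {0..d}"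
    show "(norm (v t - vh t))\<^sup>2 \<le> 2000 * K ^ 46 * (h * min \<epsilon> h ^ 3)"
      unfolding n1[OF t] using F(5)[OF t] G(5)[OF t] by linarith
    show "(norm (Complex (F t) (G t)))\<^sup>2 \<le> 2000 * K ^ 46 * (h * min \<epsilon> h)"
      unfolding n2 using F(6)[OF t] G(6)[OF t] by linarith
  qed
qed

lemma error_norms:
  assumes V: "continuous_on {0..d} V" "\<And>t. t \<in> {0..d} \<Longrightarrow> V t - E = p t"
    and a0: "sqrt \<bar>a0\<bar> \<le> K" and C: "C = 2000 * K ^ 46"
    and ex: "is_exact_solution d E V a0 \<epsilon> v" and fe: "is_wkb_fem_solution d E V a0 \<epsilon> N x vh"
  defines "e \<equiv> \<lambda>t. v t - vh t"
  shows "L2_norm d e \<le> C * sqrt \<epsilon> * h * min \<epsilon> h"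
    and "\<epsilon> * L2_norm d (weak_deriv d e) \<le> C * \<epsilon> powr (3/2) * h"
    and "C_norm d e \<le> C * sqrt h * min (\<epsilon> powr (3/2)) (h powr (3/2))"
    and "ereal \<epsilon> * Linf_norm d (weak_deriv d e) \<le> ereal (C * \<epsilon> * sqrt h * min (sqrt \<epsilon>) (sqrt h))"
proof -
  define m where "m = min \<epsilon> h"
  have m: "0 < m" using eps mesh_bounds by (simp add: m_def)
  obtain F G where FG: "ac 0 d (\<lambda>t. Re (e t)) F" "ac 0 d (\<lambda>t. Im (e t)) G"
    and D_int: "(\<lambda>t. (norm (Complex (F t) (G t)))\<^sup>2) absolutely_integrable_on {0..d}"
    and e_int: "integral {0..d} (\<lambda>t. (norm (e t))\<^sup>2) \<le> C * (\<epsilon> * h\<^sup>2 * m\<^sup>2)"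
    and D_le: "\<epsilon>\<^sup>2 * integral {0..d} (\<lambda>t. (norm (Complex (F t) (G t)))\<^sup>2) \<le> C * (\<epsilon> ^ 3 * h\<^sup>2)"
    and e_le: "\<And>t. t \<in> {0..d} \<Longrightarrow> (norm (e t))\<^sup>2 \<le> C * (h * m ^ 3)"
    and D_sup: "\<And>t. t \<in> {0..d} \<Longrightarrow> (norm (Complex (F t) (G t)))\<^sup>2 \<le> C * (h * m)"
    using complex_galerkin_error[OF V a0 ex fe] unfolding C m_def e_def by blast
  have "1 \<le> K ^ 46" using K_ge by simp
  then have C1: "1 \<le> C" unfolding C by linarith
  \<comment> \<open>The previous bounds concern squares of norms with constant \<open>C\<close>; as \<open>1 \<le> C\<close>, the constant \<open>C\<close> also serves after taking roots.\<close>
  have CC: "C * y \<le> C\<^sup>2 * y" if "0 \<le> y" for y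
    using that C1 by (intro mult_right_mono) (auto simp: power2_eq_square)
  have wd: "AE t in ivl_measure d. weak_deriv d e t = Complex (F t) (G t)"
    by (rule weak_deriv_complex[OF d_pos FG])
  have powr32: "y powr (3/2) = y * sqrt y" if "0 < y" for y :: real
  proof -
    have "y powr (3/2) = y powr (1 + 1/2)" by simp
    also have "\<dots> = y * sqrt y" using that unfolding powr_add by (simp add: powr_half_sqrt)
    finally show ?thesis .
  qed
  have ce: "continuous_on {0..d} e"
  proof -
    have "continuous_on {0..d} (\<lambda>t. Complex (Re (e t)) (Im (e t)))"
      unfolding Complex_eq by (intro continuous_intros ac_continuous[OF FG(1)] ac_continuous[OF FG(2)])
    then show ?thesis by simp
  qed
  have "L2_norm d e = sqrt (integral {0..d} (\<lambda>t. (norm (e t))\<^sup>2))"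
    unfolding L2_norm_def
    by (subst integral_ivl) (auto intro!: absolutely_integrable_continuous_real continuous_intros ce)
  also have "\<dots> \<le> C * sqrt \<epsilon> * h * m"
  proof (rule real_le_lsqrt)
    have "C * (\<epsilon> * h\<^sup>2 * m\<^sup>2) \<le> C\<^sup>2 * (\<epsilon> * h\<^sup>2 * m\<^sup>2)" using eps by (intro CC) auto
    also have "\<dots> = (C * sqrt \<epsilon> * h * m)\<^sup>2" using eps by (simp add: power_mult_distrib)
    finally show "integral {0..d} (\<lambda>t. (norm (e t))\<^sup>2) \<le> (C * sqrt \<epsilon> * h * m)\<^sup>2" using e_int by simp
  qed (use C1 eps m mesh_bounds in auto)
  finally show "L2_norm d e \<le> C * sqrt \<epsilon> * h * min \<epsilon> h" by (simp add: m_def)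
  have nD: "AE t in ivl_measure d. (norm (weak_deriv d e t))\<^sup>2 = (norm (Complex (F t) (G t)))\<^sup>2"
    using wd by eventually_elim simp
  have "L2_norm d (weak_deriv d e) = sqrt (integral {0..d} (\<lambda>t. (norm (Complex (F t) (G t)))\<^sup>2))"
    unfolding L2_norm_def using ivl_integral_spike(2)[OF _ nD] D_int by (simp add: integrable_ivl_iff integral_ivl)
  then have "\<epsilon> * L2_norm d (weak_deriv d e) = sqrt (\<epsilon>\<^sup>2 * integral {0..d} (\<lambda>t. (norm (Complex (F t) (G t)))\<^sup>2))"
    using eps by (simp add: real_sqrt_mult)
  also have "\<dots> \<le> C * \<epsilon> powr (3/2) * h"
  proof (rule real_le_lsqrt)
    have "C * (\<epsilon> ^ 3 * h\<^sup>2) \<le> C\<^sup>2 * (\<epsilon> ^ 3 * h\<^sup>2)" using eps by (intro CC) auto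
    also have "\<dots> = (C * \<epsilon> powr (3/2) * h)\<^sup>2"
      using eps by (simp add: powr32 power_mult_distrib) (simp add: power2_eq_square power3_eq_cube)
    finally show "\<epsilon>\<^sup>2 * integral {0..d} (\<lambda>t. (norm (Complex (F t) (G t)))\<^sup>2) \<le> (C * \<epsilon> powr (3/2) * h)\<^sup>2" using D_le by simp
  qed (use C1 eps mesh_bounds in auto)
  finally show "\<epsilon> * L2_norm d (weak_deriv d e) \<le> C * \<epsilon> powr (3/2) * h" .
  have mp: "min (\<epsilon> powr (3/2)) (h powr (3/2)) = m powr (3/2)"
    using eps mesh_bounds powr_mono2[of "3/2" \<epsilon> h] powr_mono2[of "3/2" h \<epsilon>] by (auto simp: m_def min_def)
  show "C_norm d e \<le> C * sqrt h * min (\<epsilon> powr (3/2)) (h powr (3/2))"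
    unfolding C_norm_def mp
  proof (rule cSUP_least)
    fix t assume t: "t \<in> {0..d}"
    show "norm (e t) \<le> C * sqrt h * m powr (3/2)"
    proof (rule power2_le_imp_le)
      have "C * (h * m ^ 3) \<le> C\<^sup>2 * (h * m ^ 3)" using m mesh_bounds by (intro CC) auto
      also have "\<dots> = (C * sqrt h * m powr (3/2))\<^sup>2"
        using m mesh_bounds by (simp add: powr32 power_mult_distrib) (simp add: power2_eq_square power3_eq_cube)
      finally show "(norm (e t))\<^sup>2 \<le> (C * sqrt h * m powr (3/2))\<^sup>2" using e_le[OF t] by simp
    qed (use C1 mesh_bounds in auto)
  qed (use d_pos in auto)
  have "Linf_norm d (weak_deriv d e) \<le> ereal (C * sqrt h * sqrt m)"
    unfolding Linf_norm_def
  proof (rule esssup_I)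
    have "integrable (ivl_measure d) (\<lambda>t. Complex (F t) (G t))"
      using ac_integrable[OF FG(1)] ac_integrable[OF FG(2)] by (intro integrable_Complex) (simp_all add: integrable_ivl_iff)
    then have "integrable (ivl_measure d) (weak_deriv d e)" using wd by (rule ivl_integral_spike(1))
    then have "weak_deriv d e \<in> borel_measurable (ivl_measure d)" by simp
    then show "(\<lambda>t. ereal (norm (weak_deriv d e t))) \<in> borel_measurable (ivl_measure d)" by measurable
    have "AE t in ivl_measure d. norm (Complex (F t) (G t)) \<le> C * sqrt h * sqrt m"
    proof (rule negligible_AE_ivl[OF negligible_empty])
      fix t assume t: "t \<in> {0..d} - {}"
      show "norm (Complex (F t) (G t)) \<le> C * sqrt h * sqrt m"
      proof (rule power2_le_imp_le)
        have "C * (h * m) \<le> C\<^sup>2 * (h * m)" using m mesh_bounds by (intro CC) auto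
        also have "\<dots> = (C * sqrt h * sqrt m)\<^sup>2" using m mesh_bounds by (simp add: power_mult_distrib)
        finally show "(norm (Complex (F t) (G t)))\<^sup>2 \<le> (C * sqrt h * sqrt m)\<^sup>2" using D_sup[of t] t by simp
      qed (use C1 m mesh_bounds in auto)
    qed
    then show "AE t in ivl_measure d. ereal (norm (weak_deriv d e t)) \<le> ereal (C * sqrt h * sqrt m)"
      using wd by eventually_elim simp
  qed
  then have "ereal \<epsilon> * Linf_norm d (weak_deriv d e) \<le> ereal \<epsilon> * ereal (C * sqrt h * sqrt m)"
    using eps by (intro ereal_mult_left_mono) auto
  moreover have "sqrt m = min (sqrt \<epsilon>) (sqrt h)" by (auto simp: m_def min_def)
  ultimately show "ereal \<epsilon> * Linf_norm d (weak_deriv d e) \<le> ereal (C * \<epsilon> * sqrt h * min (sqrt \<epsilon>) (sqrt h))"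
    by (simp add: mult_ac)
qed

end

text \<open>On the closed interval \<open>V - E\<close> is bounded below by \<open>\<tau>\<close> because \<open>V\<close> is continuous. Hence powers of it
are as regular as \<open>V\<close>: two derivatives, the second one only almost everywhere and bounded.\<close>

lemma coefficient_regularity:
  assumes d: "0 < d" "d < 1" and V: "V \<in> W2inf d" and \<tau>: "0 < \<tau>"
    and bounds: "\<And>t. t \<in> {0<..<d} \<Longrightarrow> \<tau> \<le> V t - E"
  obtains K q q1 q2 where "wkb_coefficient d K q q1 q2" "\<kappa> \<le> K" "\<And>t. t \<in> {0..d} \<Longrightarrow> V t - E = 1 / q t ^ 4"
proof -
  obtain V1 V2 K0 where V1: "ac 0 d V V1" and V2: "ac 0 d V1 V2" and K0: "\<And>t. \<bar>V2 t\<bar> \<le> K0"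
    using W2inf_regular[OF d(1) V] by metis
  note cV = ac_continuous[OF V1] and cV1 = ac_continuous[OF V2]
  define P where "P = (\<lambda>t. V t - E)"
  have cP: "continuous_on {0..d} P" unfolding P_def by (intro continuous_intros cV)
  have P0: "0 < P t" if t: "t \<in> {0..d}" for t
  proof -
    have "t \<in> closure {0<..<d}" using d t by simp
    moreover have "continuous_on (closure {0<..<d}) P" using cP d by simp
    ultimately have "\<tau> \<le> P t"
      using bounds continuous_ge_on_closure[of "{0<..<d}" P t \<tau>] by (simp add: P_def)
    then show ?thesis using \<tau> by simp
  qed
  have DP: "((\<lambda>t. P t powr a) has_real_derivative a * P t powr (a - 1) * V1 t) (at t within {0..d})" if t: "t \<in> {0..d}" for t a
  proof -
    have "(P has_real_derivative V1 t - 0) (at t within {0..d})"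
      unfolding P_def by (intro DERIV_diff DERIV_const ac_has_derivative[OF V1 cV1 t])
    then have "(P has_real_derivative V1 t) (at t within {0..d})" by simp
    then show ?thesis
      by (rule DERIV_chain2[where f="\<lambda>y. y powr a" and g=P, OF has_real_derivative_powr[OF P0[OF t]]])
  qed
  have cpow: "continuous_on {0..d} (\<lambda>t. P t powr a)" for a
    using P0 by (intro continuous_on_powr cP continuous_on_const) force
  have acpow: "ac 0 d (\<lambda>t. P t powr a) (\<lambda>t. a * P t powr (a - 1) * V1 t)" for a
    by (rule ac_C1) (use DP in \<open>auto intro!: continuous_intros cpow cV1\<close>)
  define q where "q = (\<lambda>t. P t powr (-1/4))"
  define q1 where "q1 = (\<lambda>t. (-1/4) * (P t powr (-5/4) * V1 t))"
  define q2 where "q2 = (\<lambda>t. (-1/4) * (((-5/4) * P t powr (-9/4) * V1 t) * V1 t + P t powr (-5/4) * V2 t))"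
  have acq: "ac 0 d q q1" using acpow[of "-1/4"] by (simp add: q_def q1_def mult.assoc)
  have acq1: "ac 0 d q1 q2"
    unfolding q1_def q2_def using ac_cmult[OF ac_mult[OF acpow[of "-5/4"] V2], of "-1/4"] by simp
  have qpos: "0 < q t" if "t \<in> {0..d}" for t using P0[OF that] by (simp add: q_def)
  have cq: "continuous_on {0..d} q" "continuous_on {0..d} q1" using acq acq1 ac_continuous by blast+
  obtain A1 where A1: "\<And>t. t \<in> {0..d} \<Longrightarrow> \<bar>q t\<bar> \<le> A1" using continuous_bounded_Icc[OF cq(1)] by metis
  obtain A2 where A2: "\<And>t. t \<in> {0..d} \<Longrightarrow> \<bar>q1 t\<bar> \<le> A2" using continuous_bounded_Icc[OF cq(2)] by metis
  have "continuous_on {0..d} (\<lambda>t. 1 / q t)" using qpos by (auto intro!: continuous_intros cq simp: less_le)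
  from continuous_bounded_Icc[OF this] obtain A3 where A3: "\<And>t. t \<in> {0..d} \<Longrightarrow> \<bar>1 / q t\<bar> \<le> A3" by metis
  have "continuous_on {0..d} (\<lambda>t. (5/16) * P t powr (-9/4) * V1 t * V1 t)" by (intro continuous_intros cpow cV1)
  from continuous_bounded_Icc[OF this] obtain A4 where A4: "\<And>t. t \<in> {0..d} \<Longrightarrow> \<bar>(5/16) * P t powr (-9/4) * V1 t * V1 t\<bar> \<le> A4" by metis
  have "continuous_on {0..d} (\<lambda>t. (1/4) * P t powr (-5/4))" by (intro continuous_intros cpow)
  from continuous_bounded_Icc[OF this] obtain A5 where A5: "\<And>t. t \<in> {0..d} \<Longrightarrow> \<bar>(1/4) * P t powr (-5/4)\<bar> \<le> A5" by metis
  define A6 where "A6 = A4 + A5 * K0"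
  have A6: "\<bar>q2 t\<bar> \<le> A6" if t: "t \<in> {0..d}" for t
  proof -
    have "q2 t = (5/16) * P t powr (-9/4) * V1 t * V1 t - (1/4) * P t powr (-5/4) * V2 t"
      by (simp add: q2_def algebra_simps)
    moreover have "\<bar>(1/4) * P t powr (-5/4) * V2 t\<bar> \<le> A5 * K0"
      unfolding abs_mult[of _ "V2 t"] using A5[OF t] K0[of t] order_trans[OF abs_ge_zero A5[OF t]] by (intro mult_mono) auto
    ultimately show ?thesis using A4[OF t] unfolding A6_def by linarith
  qed
  define K where "K = Max {1, 1 / d, A1, A2, A3, A6, \<kappa>}"
  have Kge: "1 \<le> K" "1 / d \<le> K" "A1 \<le> K" "A2 \<le> K" "A3 \<le> K" "A6 \<le> K" "\<kappa> \<le> K"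
    unfolding K_def by (rule Max_ge; simp)+
  have "wkb_coefficient d K q q1 q2"
  proof
    fix t assume t: "t \<in> {0..d}"
    have "1 / q t \<le> K" using A3[OF t] Kge by linarith
    then have "1 / K \<le> q t" using qpos[OF t] Kge(1) by (simp add: field_simps)
    then show "1 / K \<le> q t \<and> q t \<le> K \<and> \<bar>q1 t\<bar> \<le> K \<and> \<bar>q2 t\<bar> \<le> K"
      using A1[OF t] A2[OF t] A6[OF t] Kge by linarith
  qed (use d Kge acq acq1 in auto)
  moreover have "V t - E = 1 / q t ^ 4" if t: "t \<in> {0..d}" for t
  proof -
    have "q t ^ 4 = P t powr (- 1)" using P0[OF t] by (simp add: q_def powr_power)
    then show ?thesis using P0[OF t] by (simp add: powr_minus P_def inverse_eq_divide)
  qed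
  ultimately show ?thesis using Kge(7) that by blast
qed

theorem theorem3p3:
  fixes d E \<tau> M a0 :: real and V :: "real \<Rightarrow> real"
  assumes "0 < d" and "d < 1"
    and "V \<in> W2inf d"
    and "0 < E"
    and "0 < \<tau>"
    and "\<And>t. t \<in> {0<..<d} \<Longrightarrow> \<tau> \<le> - coef E V t \<and> - coef E V t \<le> M"
    and "a0 < 0"
  shows "\<exists>C>0. \<forall>\<epsilon> N x uex uh.
    0 < \<epsilon> \<and> \<epsilon> < 1 \<and> is_grid d N x \<and>
    is_exact_solution d E V a0 \<epsilon> uex \<and> is_wkb_fem_solution d E V a0 \<epsilon> N x uh \<longrightarrow>
    (let h = mesh_size N x; e = (\<lambda>t. uex t - uh t); e' = weak_deriv d e in
      L2_norm d e \<le> C * sqrt \<epsilon> * h * min \<epsilon> h \<and>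
      \<epsilon> * L2_norm d e' \<le> C * \<epsilon> powr (3/2) * h \<and>
      C_norm d e \<le> C * sqrt h * min (\<epsilon> powr (3/2)) (h powr (3/2)) \<and>
      ereal \<epsilon> * Linf_norm d e' \<le> ereal (C * \<epsilon> * sqrt h * min (sqrt \<epsilon>) (sqrt h)))"
proof -
  have "\<tau> \<le> V t - E" if "t \<in> {0<..<d}" for t using assms(6)[OF that] by (simp add: coef_def)
  then obtain K q q1 q2 where coeff: "wkb_coefficient d K q q1 q2" and a0: "sqrt \<bar>a0\<bar> \<le> K"
    and Vq: "\<And>t. t \<in> {0..d} \<Longrightarrow> V t - E = 1 / q t ^ 4"
    using coefficient_regularity[OF assms(1,2,3,5), of E "sqrt \<bar>a0\<bar>"] by blast
  interpret wkb_coefficient d K q q1 q2 by (rule coeff)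
  have Vc: "continuous_on {0..d} V" using assms(3) by (simp add: W2inf_def)
  have Vp: "V t - E = p t" if "t \<in> {0..d}" for t using Vq[OF that] by (simp add: p_def)
  show ?thesis
    unfolding Let_def
  proof (intro exI[of _ "2000 * K ^ 46"] conjI allI impI)
    show "0 < 2000 * K ^ 46" using K_pos by simp
    fix \<epsilon> N x uex uh
    assume *: "0 < \<epsilon> \<and> \<epsilon> < 1 \<and> is_grid d N x \<and> is_exact_solution d E V a0 \<epsilon> uex \<and> is_wkb_fem_solution d E V a0 \<epsilon> N x uh"
    then interpret wkb_grid d K q q1 q2 \<epsilon> N x by unfold_locales auto
    note bounds = error_norms[OF Vc Vp a0 refl, of uex uh]
    show "L2_norm d (\<lambda>t. uex t - uh t) \<le> 2000 * K ^ 46 * sqrt \<epsilon> * mesh_size N x * min \<epsilon> (mesh_size N x)"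
      using bounds(1) * by blast
    show "\<epsilon> * L2_norm d (weak_deriv d (\<lambda>t. uex t - uh t)) \<le> 2000 * K ^ 46 * \<epsilon> powr (3/2) * mesh_size N x"
      using bounds(2) * by blast
    show "C_norm d (\<lambda>t. uex t - uh t) \<le> 2000 * K ^ 46 * sqrt (mesh_size N x) * min (\<epsilon> powr (3/2)) (mesh_size N x powr (3/2))"
      using bounds(3) * by blast
    show "ereal \<epsilon> * Linf_norm d (weak_deriv d (\<lambda>t. uex t - uh t))
        \<le> ereal (2000 * K ^ 46 * \<epsilon> * sqrt (mesh_size N x) * min (sqrt \<epsilon>) (sqrt (mesh_size N x)))"
      using bounds(4) * by blast
  qed
qed

end
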